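(* Let $W\in\{S_n,W^{\mathsf{BC}}_n,W^{\mathsf D}_n\}$ with $n\ge 2$, and let $\mathcal M,\mathcal N$ be the $\mathcal H$-modules described in the context. There are unique $\mathcal H$-compatible bar operators on $\mathcal M$ and on $\mathcal N$ satisfying $\overline{M_z}=M_z$ and $\overline{N_z}=N_z$ for all $z\in\mathcal G$ with $\mathrm{Des}^<(z)=\varnothing$; each is an involution. Moreover $\mathcal M$ has a unique basis $\{\underline M_z:z\in\mathcal G\}$ with $\overline{\underline M_z}=\underline M_z\in M_z+\sum_{y\in\mathcal G,\ \ell(y)<\ell(z)}x^{-1}\mathbb Z[x^{-1}]M_y$, and $\mathcal N$ has a unique basis $\{\underline N_z:z\in\mathcal G\}$ with $\overline{\underline N_z}=\underline N_z\in N_z+\sum_{y\in\mathcal G,\ \ell(y)<\ell(z)}x^{-1}\mathbb Z[x^{-1}]N_y$.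
   Context: For $i>0$ let $s_i=(i,i+1)(-i,-i-1)$, $s_0=(-1,1)$, $s_{-1}=(1,-2)(-1,2)$. $W^{\mathsf{BC}}_N$ is the group of permutations $w$ of $\{\pm1,\dots,\pm N\}$ with $w(-i)=-w(i)$ (Coxeter generators $s_0,\dots,s_{N-1}$); $W^{\mathsf D}_N$ its subgroup with $|\{i\in[N]:w(i)<0\}|$ even (generators $s_{-1},s_1,\dots,s_{N-1}$); $S_N=\langle s_1,\dots,s_{N-1}\rangle$. $\ell$ is Coxeter length. $\mathcal F^{\mathsf A}_{n-1}=\{z\in S_{2n}:z=z^{-1},z(i)\ne i\ \forall i\in[2n]\}$; $\mathcal F^{\mathsf{BC}}_n=\{z\in W^{\mathsf{BC}}_{2n}:z=z^{-1},|z(i)|\ne i\ \forall i\in[2n]\}$; $\mathcal F^{\mathsf D}_n=\{z\in\mathcal F^{\mathsf{BC}}_n:|\{i\in[n]:z(i)<-i\}|\text{ even}\}$. $i>0$ is a visible descent of $z$ if $z(i+1)<\min\{i,z(i)\}$ or $z(i)<-i$. $\mathcal G=\mathcal G(W)$ is the subset of $\mathcal F^{\mathsf A}_{n-1}$, $\mathcal F^{\mathsf{BC}}_n$, $\mathcal F^{\mathsf D}_n$ (for $W=S_n,W^{\mathsf{BC}}_n,W^{\mathsf D}_n$) of elements with no visible descent $>n$; $\ell(z)$ for $z\in\mathcal G$ is length in $S_{2n}$, $W^{\mathsf{BC}}_{2n}$, $W^{\mathsf D}_{2n}$ respectively. For $z\in\mathcal G$: $\mathrm{Des}^=(z)=\{s\in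 S:sz=zs\}$, $\mathrm{Asc}^=(z)=\{s\in S:zsz\in\{s_i:i>n\}\}$, $\mathrm{Des}^<(z)=\{s\in S:\ell(sz)<\ell(z)\}\setminus(\mathrm{Des}^=(z)\sqcup\mathrm{Asc}^=(z))$, $\mathrm{Asc}^<(z)=\{s\in S:\ell(sz)>\ell(z)\}\setminus(\mathrm{Des}^=(z)\sqcup\mathrm{Asc}^=(z))$. $\mathcal H$ is the Iwahori–Hecke algebra of $W$: free $\mathbb Z[x,x^{-1}]$-module with basis $H_w$, $H_sH_w=H_{sw}$ if $\ell(sw)>\ell(w)$, else $H_{sw}+(x-x^{-1})H_w$. A map is antilinear if $\phi(pa)=\bar p\phi(a)$ where $\bar{\ }$ is the ring automorphism of $\mathbb Z[x,x^{-1}]$ with $x\mapsto x^{-1}$. The bar operator of $\mathcal H$ is the antilinear ring involution with $\overline{H_w}=(H_{w^{-1}})^{-1}$. An $\mathcal H$-compatible bar operator on an $\mathcal H$-module $\mathcal A$ is an antilinear map with $\overline{HA}=\overline H\,\overline A$. $\mathcal M$ (resp. $\mathcal N$) is the free $\mathbb Z[x,x^{-1}]$-module with basis $M_z$ (resp. $N_z$), $z\in\mathcal G$, with the $\mathcal H$-module structure: $H_sM_z=M_{szs}$ if $s\in\mathrm{Asc}^<(z)$, $M_{szs}+(x-x^{-1})M_z$ if $s\in\mathrm{Des}^<(z)$, $-x^{-1}M_z$ if $s\in\mathrm{Asc}^=(z)$, $xM_z$ if $s\in\mathrm{Des}^=(z)$; and $H_sN_z=N_{szs}$, $N_{szs}+(x-x^{-1})N_z$,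 $xN_z$, $-x^{-1}N_z$ in the same four cases respectively. *)

theory Defs
  imports Main "HOL-Library.Poly_Mapping"
begin

section \<open>Laurent polynomials Z[x,x^-1] as finitely supported maps int => int\<close>

type_synonym lpoly = "int \<Rightarrow>\<^sub>0 int"

definition lx :: lpoly where "lx = Poly_Mapping.single 1 1"
definition lxinv :: lpoly where "lxinv = Poly_Mapping.single (-1) 1"

definition lbar :: "lpoly \<Rightarrow> lpoly" where
  "lbar p = (\<Sum>k\<in>Poly_Mapping.keys p. Poly_Mapping.single (-k) (Poly_Mapping.lookup p k))"

definition negpart :: "lpoly \<Rightarrow> bool" where
  "negpart p \<longleftrightarrow> Poly_Mapping.keys p \<subseteq> {k. k < 0}"

type_synonym perm = "int \<Rightarrow> int"

definition sgen :: "int \<Rightarrow> perm" where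
  "sgen i = (if i > 0 then
       (\<lambda>j. if j = i then i+1 else if j = i+1 then i else
             if j = -i then -i-1 else if j = -i-1 then -i else j)
     else if i = 0 then (\<lambda>j. if j = 1 then -1 else if j = -1 then 1 else j)
     else (\<lambda>j. if j = 1 then -2 else if j = -2 then 1 else
                if j = -1 then 2 else if j = 2 then -1 else j))"

definition supp_set :: "nat \<Rightarrow> int set" where
  "supp_set N = {i. 1 \<le> \<bar>i\<bar> \<and> \<bar>i\<bar> \<le> int N}"

definition W_BC :: "nat \<Rightarrow> perm set" where
  "W_BC N = {w. bij_betw w (supp_set N) (supp_set N) \<and> (\<forall>i. w (-i) = - w i)
                \<and> (\<forall>i. i \<notin> supp_set N \<longrightarrow> w i = i)}"

definition W_D :: "nat \<Rightarrow> perm set" where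
  "W_D N = {w \<in> W_BC N. even (card {i \<in> {1..int N}. w i < 0})}"

datatype ctype = TA | TBC | TD

definition gens :: "ctype \<Rightarrow> nat \<Rightarrow> perm set" where
  "gens t N = (case t of
      TA \<Rightarrow> sgen ` {1..int N - 1}
    | TBC \<Rightarrow> sgen ` {0..int N - 1}
    | TD \<Rightarrow> sgen ` ({-1} \<union> {1..int N - 1}))"

definition wprod :: "perm list \<Rightarrow> perm" where
  "wprod ws = foldr (\<circ>) ws id"

definition Wgrp :: "ctype \<Rightarrow> nat \<Rightarrow> perm set" where
  "Wgrp t N = (case t of
      TA \<Rightarrow> {wprod ws | ws. set ws \<subseteq> gens TA N}
    | TBC \<Rightarrow> W_BC N
    | TD \<Rightarrow> W_D N)"

definition len :: "ctype \<Rightarrow> nat \<Rightarrow> perm \<Rightarrow> nat" where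
  "len t N w = (LEAST k. \<exists>ws. set ws \<subseteq> gens t N \<and> length ws = k \<and> wprod ws = w)"

definition redword :: "ctype \<Rightarrow> nat \<Rightarrow> perm \<Rightarrow> perm list" where
  "redword t N w = (SOME ws. set ws \<subseteq> gens t N \<and> length ws = len t N w \<and> wprod ws = w)"

definition F_A :: "nat \<Rightarrow> perm set" where
  "F_A n = {z \<in> Wgrp TA (2*n). z \<circ> z = id \<and> (\<forall>i\<in>{1..2*int n}. z i \<noteq> i)}"

definition F_BC :: "nat \<Rightarrow> perm set" where
  "F_BC n = {z \<in> W_BC (2*n). z \<circ> z = id \<and> (\<forall>i\<in>{1..2*int n}. \<bar>z i\<bar> \<noteq> i)}"

definition F_D :: "nat \<Rightarrow> perm set" where
  "F_D n = {z \<in> F_BC n. even (card {i \<in> {1..int n}. z i < -i})}"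

definition visdes :: "perm \<Rightarrow> int \<Rightarrow> bool" where
  "visdes z i \<longleftrightarrow> i > 0 \<and> (z (i+1) < min i (z i) \<or> z i < -i)"

definition Gset :: "ctype \<Rightarrow> nat \<Rightarrow> perm set" where
  "Gset t n = {z \<in> (case t of TA \<Rightarrow> F_A n | TBC \<Rightarrow> F_BC n | TD \<Rightarrow> F_D n).
                 \<forall>i > int n. \<not> visdes z i}"

definition glen :: "ctype \<Rightarrow> nat \<Rightarrow> perm \<Rightarrow> nat" where
  "glen t n z = len t (2*n) z"

definition DesEq :: "ctype \<Rightarrow> nat \<Rightarrow> perm \<Rightarrow> perm set" where
  "DesEq t n z = {s \<in> gens t n. s \<circ> z = z \<circ> s}"

definition AscEq :: "ctype \<Rightarrow> nat \<Rightarrow> perm \<Rightarrow> perm set" where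
  "AscEq t n z = {s \<in> gens t n. z \<circ> s \<circ> z \<in> sgen ` {i. i > int n}}"

definition DesLt :: "ctype \<Rightarrow> nat \<Rightarrow> perm \<Rightarrow> perm set" where
  "DesLt t n z = {s \<in> gens t n. glen t n (s \<circ> z) < glen t n z}
                   - (DesEq t n z \<union> AscEq t n z)"

definition AscLt :: "ctype \<Rightarrow> nat \<Rightarrow> perm \<Rightarrow> perm set" where
  "AscLt t n z = {s \<in> gens t n. glen t n (s \<circ> z) > glen t n z}
                   - (DesEq t n z \<union> AscEq t n z)"

text \<open>Elements of H: coefficient functions W => Z[x,x^-1], h = sum_w h(w) H_w.\<close>
definition delta :: "perm \<Rightarrow> perm \<Rightarrow> lpoly" where
  "delta z = (\<lambda>y. if y = z then 1 else 0)"

definition Hset :: "ctype \<Rightarrow> nat \<Rightarrow> (perm \<Rightarrow> lpoly) set" where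
  "Hset t n = {h. \<forall>w. w \<notin> Wgrp t n \<longrightarrow> h w = 0}"

definition HsHw :: "ctype \<Rightarrow> nat \<Rightarrow> perm \<Rightarrow> perm \<Rightarrow> (perm \<Rightarrow> lpoly)" where
  "HsHw t n s w = (if len t n (s \<circ> w) > len t n w then delta (s \<circ> w)
                   else (\<lambda>v. delta (s \<circ> w) v + (lx - lxinv) * delta w v))"

definition Hs_H :: "ctype \<Rightarrow> nat \<Rightarrow> perm \<Rightarrow> (perm \<Rightarrow> lpoly) \<Rightarrow> (perm \<Rightarrow> lpoly)" where
  "Hs_H t n s h = (\<lambda>v. \<Sum>w\<in>Wgrp t n. h w * HsHw t n s w v)"

definition Hone :: "perm \<Rightarrow> lpoly" where "Hone = delta id"

definition Hbasis :: "ctype \<Rightarrow> nat \<Rightarrow> perm \<Rightarrow> (perm \<Rightarrow> lpoly)" where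
  "Hbasis t n w = foldr (Hs_H t n) (redword t n w) Hone"

definition Hmul :: "ctype \<Rightarrow> nat \<Rightarrow> (perm \<Rightarrow> lpoly) \<Rightarrow> (perm \<Rightarrow> lpoly) \<Rightarrow> (perm \<Rightarrow> lpoly)" where
  "Hmul t n h1 h2 = (\<lambda>v. \<Sum>w\<in>Wgrp t n. h1 w * foldr (Hs_H t n) (redword t n w) h2 v)"

definition Hinv :: "ctype \<Rightarrow> nat \<Rightarrow> (perm \<Rightarrow> lpoly) \<Rightarrow> (perm \<Rightarrow> lpoly)" where
  "Hinv t n h = (THE h'. h' \<in> Hset t n \<and> Hmul t n h h' = Hone \<and> Hmul t n h' h = Hone)"

definition Hbar :: "ctype \<Rightarrow> nat \<Rightarrow> (perm \<Rightarrow> lpoly) \<Rightarrow> (perm \<Rightarrow> lpoly)" where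
  "Hbar t n h = (\<lambda>v. \<Sum>w\<in>Wgrp t n. lbar (h w) * Hinv t n (Hbasis t n (inv w)) v)"

datatype modtype = ModM | ModN

text \<open>Elements: coefficient functions G => Z[x,x^-1], m = sum_z m(z) M_z.\<close>
definition Modset :: "ctype \<Rightarrow> nat \<Rightarrow> (perm \<Rightarrow> lpoly) set" where
  "Modset t n = {m. \<forall>y. y \<notin> Gset t n \<longrightarrow> m y = 0}"

definition HsMz :: "modtype \<Rightarrow> ctype \<Rightarrow> nat \<Rightarrow> perm \<Rightarrow> perm \<Rightarrow> (perm \<Rightarrow> lpoly)" where
  "HsMz mt t n s z =
    (if s \<in> AscLt t n z then delta (s \<circ> z \<circ> s)
     else if s \<in> DesLt t n z then (\<lambda>y. delta (s \<circ> z \<circ> s) y + (lx - lxinv) * delta z y)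
     else if s \<in> AscEq t n z then
       (\<lambda>y. (case mt of ModM \<Rightarrow> - lxinv | ModN \<Rightarrow> lx) * delta z y)
     else if s \<in> DesEq t n z then
       (\<lambda>y. (case mt of ModM \<Rightarrow> lx | ModN \<Rightarrow> - lxinv) * delta z y)
     else (\<lambda>y. 0))"

definition Hs_mod :: "modtype \<Rightarrow> ctype \<Rightarrow> nat \<Rightarrow> perm \<Rightarrow> (perm \<Rightarrow> lpoly) \<Rightarrow> (perm \<Rightarrow> lpoly)" where
  "Hs_mod mt t n s m = (\<lambda>y. \<Sum>z\<in>Gset t n. m z * HsMz mt t n s z y)"

definition Hact :: "modtype \<Rightarrow> ctype \<Rightarrow> nat \<Rightarrow> (perm \<Rightarrow> lpoly) \<Rightarrow> (perm \<Rightarrow> lpoly) \<Rightarrow> (perm \<Rightarrow> lpoly)" where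
  "Hact mt t n h m = (\<lambda>y. \<Sum>w\<in>Wgrp t n. h w * foldr (Hs_mod mt t n) (redword t n w) m y)"

definition msmult :: "lpoly \<Rightarrow> (perm \<Rightarrow> lpoly) \<Rightarrow> (perm \<Rightarrow> lpoly)" where
  "msmult p m = (\<lambda>y. p * m y)"

definition madd :: "(perm \<Rightarrow> lpoly) \<Rightarrow> (perm \<Rightarrow> lpoly) \<Rightarrow> (perm \<Rightarrow> lpoly)" where
  "madd a b = (\<lambda>y. a y + b y)"

definition compat_bar :: "modtype \<Rightarrow> ctype \<Rightarrow> nat \<Rightarrow> ((perm \<Rightarrow> lpoly) \<Rightarrow> (perm \<Rightarrow> lpoly)) \<Rightarrow> bool" where
  "compat_bar mt t n \<phi> \<longleftrightarrow>
     (\<forall>a\<in>Modset t n. \<phi> a \<in> Modset t n)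
   \<and> (\<forall>a\<in>Modset t n. \<forall>b\<in>Modset t n. \<phi> (madd a b) = madd (\<phi> a) (\<phi> b))
   \<and> (\<forall>p. \<forall>a\<in>Modset t n. \<phi> (msmult p a) = msmult (lbar p) (\<phi> a))
   \<and> (\<forall>h\<in>Hset t n. \<forall>a\<in>Modset t n. \<phi> (Hact mt t n h a) = Hact mt t n (Hbar t n h) (\<phi> a))"

definition fixes_std :: "ctype \<Rightarrow> nat \<Rightarrow> ((perm \<Rightarrow> lpoly) \<Rightarrow> (perm \<Rightarrow> lpoly)) \<Rightarrow> bool" where
  "fixes_std t n \<phi> \<longleftrightarrow> (\<forall>z\<in>Gset t n. DesLt t n z = {} \<longrightarrow> \<phi> (delta z) = delta z)"

definition is_basis :: "ctype \<Rightarrow> nat \<Rightarrow> (perm \<Rightarrow> (perm \<Rightarrow> lpoly)) \<Rightarrow> bool" where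
  "is_basis t n C \<longleftrightarrow>
     (\<forall>z\<in>Gset t n. C z \<in> Modset t n)
   \<and> (\<forall>m\<in>Modset t n. \<exists>c. m = (\<lambda>y. \<Sum>z\<in>Gset t n. c z * C z y))
   \<and> (\<forall>c c'. (\<lambda>y. \<Sum>z\<in>Gset t n. c z * C z y) = (\<lambda>y. \<Sum>z\<in>Gset t n. c' z * C z y)
              \<longrightarrow> (\<forall>z\<in>Gset t n. c z = c' z))"

definition canon_basis :: "ctype \<Rightarrow> nat \<Rightarrow> ((perm \<Rightarrow> lpoly) \<Rightarrow> (perm \<Rightarrow> lpoly))
                            \<Rightarrow> (perm \<Rightarrow> (perm \<Rightarrow> lpoly)) \<Rightarrow> bool" where
  "canon_basis t n \<phi> C \<longleftrightarrow> is_basis t n C \<and>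
     (\<forall>z\<in>Gset t n. \<phi> (C z) = C z \<and> C z z = 1 \<and>
        (\<forall>y\<in>Gset t n. y \<noteq> z \<longrightarrow>
            C z y = 0 \<or> (glen t n y < glen t n z \<and> negpart (C z y))))"

end

theory Submission
  imports Defs "HOL-Library.Function_Algebras" "HOL-Combinatorics.Permutations"
begin

text \<open>
  Compatibility with the bar operator of \<open>\<H>\<close> means that \<open>\<phi>(H\<^sub>s m) = H\<^sub>s\<^sup>-\<^sup>1 \<phi>(m)\<close> for all generators \<open>s\<close>, so
  uniqueness and involutivity follow by induction on the length, climbing from the elements without
  descents; the canonical basis then comes from the unitriangularity of the bar operator.

  For existence, let \<open>W\<^sub>2\<^sub>n\<close> act by conjugation on all fixed-point-free involutions. The span of symbols
  \<open>M\<^sub>y\<close> is a module of the Hecke algebra of \<open>W\<^sub>2\<^sub>n\<close>, and up to a unit \<open>M\<^sub>y \<mapsto> H\<^sub>y\<^sup>-\<^sup>1 M\<^sub>y\<close> is a compatible bar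
  operator on it. An element of \<open>\<G>\<close> matches \<open>n + 1, \<dots>, n + k\<close> in increasing order with elements of
  \<open>\<plusminus>[n]\<close> and pairs up \<open>n + k + 1, \<dots>, 2n\<close> consecutively. Dropping the monotonicity gives an
  \<open>(W\<^sub>n \<times> S\<^sub>k)\<close>-stable set, and projecting to its span and factoring out the character of \<open>S\<^sub>k\<close> by which
  the generators in \<open>Asc\<^sup>=\<close> act yields an equivariant map \<open>Q\<close> onto the part of \<open>\<M>\<close> (or \<open>\<N>\<close>) belonging to
  \<open>k\<close>. It transports the module relations and the bar operator; minimal elements stay fixed because each
  part contains only one of them.
\<close>

section \<open>Laurent polynomials and the bar involution\<close>

text \<open>The definitions reach the multiplication of the Hecke algebra and its actions only
  through one arbitrarily chosen reduced word per element, so products, inverses and compatibility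
  become usable only after Matsumoto's theorem; hence the exchange property and the braid words
  precede every module. The relations of the small modules cannot be checked by conjugation inside
  \<open>Gset\<close>: for \<open>s\<close> in \<open>AscEq\<close> the element \<open>s z s\<close>
  leaves \<open>Gset\<close>. It equals \<open>s_j z s_j\<close> for some \<open>j > n\<close>, and
  both conjugations lengthen \<open>z\<close>, so the generators of \<open>s\<close> and
  \<open>s_j\<close> agree on \<open>M_z\<close> in the full module; \<open>Q\<close> turns the
  second into a scalar. This scalar may be either root, x or -x^-1, of X^2 = 1 + (x - x^-1) X,
  independently of the root by which commuting generators act; the two mixed choices are
  \<open>ModM\<close> and \<open>ModN\<close>. The unit in the bar operator is the n-th power of the
  commuting root: the minimal involution of the full module pairs 2i - 1 with 2i, has a reduced word
  of n generators commuting with it, and is therefore multiplied by the inverse of that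
  power.\<close>

lemma lookup_lbar: "Poly_Mapping.lookup (lbar p) k = Poly_Mapping.lookup p (- k)"
proof -
  have "Poly_Mapping.lookup (lbar p) k
      = (\<Sum>j\<in>Poly_Mapping.keys p. (if j = - k then Poly_Mapping.lookup p j else 0))"
    unfolding lbar_def lookup_sum by (intro sum.cong) (auto simp: lookup_single when_def)
  also have "\<dots> = Poly_Mapping.lookup p (- k)"
    by (auto simp: sum.delta in_keys_iff)
  finally show ?thesis .
qed

lemma lbar_lbar [simp]: "lbar (lbar p) = p"
  by (rule poly_mapping_eqI) (simp add: lookup_lbar)

lemma lbar_add: "lbar (p + q) = lbar p + lbar q"
  by (rule poly_mapping_eqI) (simp add: lookup_lbar lookup_add)

lemma lbar_0 [simp]: "lbar 0 = 0"
  by (rule poly_mapping_eqI) (simp add: lookup_lbar)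

lemma lbar_uminus: "lbar (- p) = - lbar p"
  by (rule poly_mapping_eqI) (simp add: lookup_lbar)

lemma lbar_diff: "lbar (p - q) = lbar p - lbar q"
  by (rule poly_mapping_eqI) (simp add: lookup_lbar lookup_minus)

lemma lbar_sum: "lbar (sum f A) = (\<Sum>a\<in>A. lbar (f a))"
  by (induction A rule: infinite_finite_induct) (auto simp: lbar_add)

lemma lbar_single: "lbar (Poly_Mapping.single k c) = Poly_Mapping.single (- k) c"
  by (rule poly_mapping_eqI) (auto simp: lookup_lbar lookup_single when_def)

lemma lbar_1 [simp]: "lbar 1 = 1"
  using lbar_single[of 0 1] by simp

lemma lpoly_expand:
  "(p :: lpoly) = (\<Sum>k\<in>Poly_Mapping.keys p. Poly_Mapping.single k (Poly_Mapping.lookup p k))"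
  by (rule poly_mapping_eqI)
     (auto simp: lookup_sum lookup_single when_def sum.delta in_keys_iff)

lemma lbar_mult: "lbar (p * q) = lbar p * lbar q"
proof -
  let ?m = "\<lambda>p k. Poly_Mapping.single k (Poly_Mapping.lookup p k) :: lpoly"
  have "p * q = (\<Sum>i\<in>Poly_Mapping.keys p. \<Sum>j\<in>Poly_Mapping.keys q. ?m p i * ?m q j)"
    by (subst lpoly_expand[of p], subst lpoly_expand[of q]) (simp add: sum_product)
  then have "lbar (p * q)
      = (\<Sum>i\<in>Poly_Mapping.keys p. \<Sum>j\<in>Poly_Mapping.keys q. lbar (?m p i) * lbar (?m q j))"
    by (simp add: lbar_sum mult_single lbar_single)
  also have "\<dots> = lbar p * lbar q"
    unfolding lbar_def[of p] lbar_def[of q] by (simp add: sum_product lbar_single)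
  finally show ?thesis .
qed

lemma lx_lxinv [simp]: "lx * lxinv = 1" "lxinv * lx = 1"
  by (simp_all add: lx_def lxinv_def mult_single)

lemma lbar_lx [simp]: "lbar lx = lxinv" "lbar lxinv = lx"
  by (simp_all add: lx_def lxinv_def lbar_single)

abbreviation lq :: lpoly where "lq \<equiv> lx - lxinv"

lemma lbar_lq: "lbar lq = - lq"
  by (simp add: lbar_diff)

text \<open>Invariance makes the coefficients at k and -k equal, and those at exponents >= 0 vanish.
  The uniqueness of canonical bases rests on this.\<close>

lemma negpart_self_bar_zero:
  assumes "negpart p" "lbar p = p"
  shows "p = 0"
proof (rule poly_mapping_eqI)
  fix k
  have neg: "Poly_Mapping.lookup p k = 0" if "k \<ge> 0" for k
    using assms(1) that by (force simp: negpart_def in_keys_iff)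
  show "Poly_Mapping.lookup p k = Poly_Mapping.lookup 0 k"
  proof (cases "k \<ge> 0")
    case True then show ?thesis using neg by simp
  next
    case False
    have "Poly_Mapping.lookup p k = Poly_Mapping.lookup p (- k)"
      using arg_cong[OF assms(2), of "\<lambda>p. Poly_Mapping.lookup p k"] by (simp add: lookup_lbar)
    then show ?thesis using neg[of "- k"] False by simp
  qed
qed

lemma negpart_diff: "negpart p \<Longrightarrow> negpart q \<Longrightarrow> negpart (p - q)"
  unfolding negpart_def using keys_diff[of p q] by fastforce

lemma negpart_0 [simp]: "negpart 0"
  by (simp add: negpart_def)

lemma negpart_add: "negpart p \<Longrightarrow> negpart q \<Longrightarrow> negpart (p + q)"
  unfolding negpart_def using keys_add[of p q] by fastforce

lemma negpart_mult: "negpart p \<Longrightarrow> negpart q \<Longrightarrow> negpart (p * q)"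
  unfolding negpart_def using keys_mult[of p q] by fastforce

lemma negpart_sum: "(\<And>a. a \<in> A \<Longrightarrow> negpart (f a)) \<Longrightarrow> negpart (sum f A)"
  by (induction A rule: infinite_finite_induct) (auto intro: negpart_add)

text \<open>\<open>p\<close> is the part of \<open>q\<close> with negative exponents: antisymmetry
  kills the constant coefficient and gives \<open>q = p - lbar p\<close>. This solves for the
  coefficients of a canonical element.\<close>

lemma antisymmetric_split:
  assumes "lbar q = - q"
  obtains p where "negpart p" "q + lbar p = p"
proof -
  define p :: lpoly where "p = Poly_Mapping.mapp (\<lambda>k c. c when k < 0) q"
  have lp: "Poly_Mapping.lookup p k = (if k < 0 then Poly_Mapping.lookup q k else 0)" for k
    by (auto simp: p_def lookup_mapp when_def in_keys_iff)
  have odd: "Poly_Mapping.lookup q (- k) = - Poly_Mapping.lookup q k" for k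
    using arg_cong[OF assms, of "\<lambda>p. Poly_Mapping.lookup p k"] by (simp add: lookup_lbar)
  have "negpart p" by (auto simp: negpart_def in_keys_iff lp split: if_splits)
  moreover have "q + lbar p = p"
    using odd by (intro poly_mapping_eqI) (auto simp: lookup_add lookup_lbar lp, smt (verit))
  ultimately show ?thesis using that by blast
qed

section \<open>Coefficient functions and semilinear maps\<close>

type_synonym vec = "perm \<Rightarrow> lpoly"

definition V :: "perm set \<Rightarrow> vec set" where
  "V X = {m. \<forall>y. y \<notin> X \<longrightarrow> m y = 0}"

lemma Modset_V: "Modset t n = V (Gset t n)" by (simp add: Modset_def V_def)
lemma Hset_V: "Hset t n = V (Wgrp t n)" by (simp add: Hset_def V_def)
lemma madd_plus: "madd a b = a + b" by (simp add: madd_def fun_eq_iff)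

lemma msmult_apply [simp]: "msmult p m y = p * m y" by (simp add: msmult_def)
lemma sum_vec_apply: "(sum f A :: vec) y = (\<Sum>a\<in>A. f a y)"
  by (induction A rule: infinite_finite_induct) auto

lemma msmult_add_right: "msmult p (a + b) = msmult p a + msmult p b"
  by (simp add: fun_eq_iff algebra_simps)
lemma msmult_add_left: "msmult (p + q) a = msmult p a + msmult q a"
  by (simp add: fun_eq_iff algebra_simps)
lemma msmult_msmult [simp]: "msmult p (msmult q a) = msmult (p * q) a"
  by (simp add: fun_eq_iff algebra_simps)
lemma msmult_1 [simp]: "msmult 1 a = a" by (simp add: fun_eq_iff)
lemma msmult_0 [simp]: "msmult 0 a = 0" by (simp add: fun_eq_iff)
lemma msmult_0_right [simp]: "msmult p 0 = 0" by (simp add: fun_eq_iff)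
lemma msmult_sum: "msmult p (sum f A) = (\<Sum>a\<in>A. msmult p (f a))"
  by (rule ext) (simp add: sum_vec_apply sum_distrib_left)

lemma V_add [intro]: "a \<in> V X \<Longrightarrow> b \<in> V X \<Longrightarrow> a + b \<in> V X" by (simp add: V_def)
lemma V_diff [intro]: "a \<in> V X \<Longrightarrow> b \<in> V X \<Longrightarrow> a - b \<in> V X" by (simp add: V_def)
lemma V_msmult [intro]: "a \<in> V X \<Longrightarrow> msmult p a \<in> V X" by (simp add: V_def)
lemma V_zero [simp, intro]: "0 \<in> V X" by (simp add: V_def)
lemma V_sum [intro]: "(\<And>a. a \<in> A \<Longrightarrow> f a \<in> V X) \<Longrightarrow> sum f A \<in> V X"
  by (induction A rule: infinite_finite_induct) auto
lemma V_delta [intro]: "z \<in> X \<Longrightarrow> delta z \<in> V X" by (auto simp: V_def delta_def)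
lemma V_mono: "X \<subseteq> Y \<Longrightarrow> V X \<subseteq> V Y" by (auto simp: V_def)

lemma delta_same [simp]: "delta z z = 1" by (simp add: delta_def)
lemma delta_other: "y \<noteq> z \<Longrightarrow> delta z y = 0" by (simp add: delta_def)

lemma V_expand:
  assumes "finite X" "m \<in> V X"
  shows "m = (\<Sum>z\<in>X. msmult (m z) (delta z))"
proof
  fix y show "m y = (\<Sum>z\<in>X. msmult (m z) (delta z)) y"
    using assms by (cases "y \<in> X") (simp_all add: sum_vec_apply delta_def V_def if_distrib sum.delta cong: if_cong)
qed

lemmas vec_apply = plus_fun_apply minus_apply uminus_apply msmult_apply sum_vec_apply zero_fun_apply

declare plus_fun_apply [simp del] minus_apply [simp del] uminus_apply [simp del] msmult_apply [simp del]

text \<open>One notion covers linear maps (\<open>id\<close>) and antilinear maps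
  (\<open>lbar\<close>), so that \<open>slin_comp\<close> makes the composite of two antilinear maps
  linear. Everything is relative to \<open>V X\<close> because coefficient functions are defined on
  all permutations.\<close>

definition slin :: "(lpoly \<Rightarrow> lpoly) \<Rightarrow> perm set \<Rightarrow> perm set \<Rightarrow> (vec \<Rightarrow> vec) \<Rightarrow> bool" where
  "slin \<sigma> X Y F \<longleftrightarrow> (\<forall>a\<in>V X. F a \<in> V Y)
     \<and> (\<forall>a\<in>V X. \<forall>b\<in>V X. F (a + b) = F a + F b)
     \<and> (\<forall>p. \<forall>a\<in>V X. F (msmult p a) = msmult (\<sigma> p) (F a))"

abbreviation "lin \<equiv> slin id"

lemma slin_V: "slin \<sigma> X Y F \<Longrightarrow> a \<in> V X \<Longrightarrow> F a \<in> V Y" by (simp add: slin_def)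
lemma slin_add: "slin \<sigma> X Y F \<Longrightarrow> a \<in> V X \<Longrightarrow> b \<in> V X \<Longrightarrow> F (a + b) = F a + F b"
  by (simp add: slin_def)
lemma slin_msmult: "slin \<sigma> X Y F \<Longrightarrow> a \<in> V X \<Longrightarrow> F (msmult p a) = msmult (\<sigma> p) (F a)"
  by (simp add: slin_def)
lemma slin_zero: "slin \<sigma> X Y F \<Longrightarrow> F 0 = 0"
  using slin_add[of \<sigma> X Y F 0 0] by simp
lemma slin_diff:
  assumes "slin \<sigma> X Y F" "a \<in> V X" "b \<in> V X"
  shows "F (a - b) = F a - F b"
  using slin_add[OF assms(1) V_diff[OF assms(2,3)] assms(3)] by (simp add: eq_diff_eq)

lemma slin_sum:
  assumes "slin \<sigma> X Y F" "\<And>a. a \<in> A \<Longrightarrow> f a \<in> V X"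
  shows "F (sum f A) = (\<Sum>a\<in>A. F (f a))"
  using assms(2)
proof (induction A rule: infinite_finite_induct)
  case (insert x A)
  have "F (f x + sum f A) = F (f x) + F (sum f A)"
    using insert.prems by (intro slin_add[OF assms(1)] V_sum) auto
  moreover have "F (sum f A) = (\<Sum>a\<in>A. F (f a))" using insert by blast
  ultimately show ?case by (simp only: sum.insert[OF insert.hyps])
qed (use slin_zero[OF assms(1)] in auto)

lemma slin_comp:
  assumes F: "slin \<sigma> X Y F" and G: "slin \<tau> Y Z G"
  shows "slin (\<tau> \<circ> \<sigma>) X Z (\<lambda>m. G (F m))"
  unfolding slin_def[of "\<tau> \<circ> \<sigma>"]
  by (intro conjI ballI allI)
     (simp_all only: o_apply slin_V[OF F] slin_add[OF F] slin_msmult[OF F]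
        slin_V[OF G] slin_add[OF G] slin_msmult[OF G])

lemma slin_subset: "slin \<sigma> X Y F \<Longrightarrow> X' \<subseteq> X \<Longrightarrow> Y \<subseteq> Y' \<Longrightarrow> slin \<sigma> X' Y' F"
  using V_mono[of X' X] V_mono[of Y Y'] unfolding slin_def by (meson subsetD)

lemma slin_expand:
  assumes "finite X" "slin \<sigma> X Y F" "m \<in> V X"
  shows "F m = (\<Sum>z\<in>X. msmult (\<sigma> (m z)) (F (delta z)))"
proof -
  have "F m = F (\<Sum>z\<in>X. msmult (m z) (delta z))"
    using V_expand[OF assms(1,3)] by simp
  also have "\<dots> = (\<Sum>z\<in>X. F (msmult (m z) (delta z)))"
    by (rule slin_sum[OF assms(2)]) auto
  also have "\<dots> = (\<Sum>z\<in>X. msmult (\<sigma> (m z)) (F (delta z)))"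
    by (intro sum.cong refl slin_msmult[OF assms(2)]) auto
  finally show ?thesis .
qed

lemma slin_eqI:
  assumes "finite X" "slin \<sigma> X Y F" "slin \<sigma> X Z G" "\<And>z. z \<in> X \<Longrightarrow> F (delta z) = G (delta z)"
    and "m \<in> V X"
  shows "F m = G m"
  using slin_expand[OF assms(1,2,5)] slin_expand[OF assms(1,3,5)] assms(4) by simp

definition ring_map :: "(lpoly \<Rightarrow> lpoly) \<Rightarrow> bool" where
  "ring_map \<sigma> \<longleftrightarrow> (\<forall>p q. \<sigma> (p + q) = \<sigma> p + \<sigma> q) \<and> (\<forall>p q. \<sigma> (p * q) = \<sigma> p * \<sigma> q) \<and> \<sigma> 1 = 1"

lemma ring_map_id: "ring_map id" by (simp add: ring_map_def)
lemma ring_map_lbar: "ring_map lbar" by (simp add: ring_map_def lbar_add lbar_mult)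
lemma ring_map_0: "ring_map \<sigma> \<Longrightarrow> \<sigma> 0 = 0"
  unfolding ring_map_def by (metis add_cancel_right_right)

definition lext :: "(lpoly \<Rightarrow> lpoly) \<Rightarrow> perm set \<Rightarrow> (perm \<Rightarrow> vec) \<Rightarrow> vec \<Rightarrow> vec" where
  "lext \<sigma> X f m = (\<Sum>z\<in>X. msmult (\<sigma> (m z)) (f z))"

lemma slin_lext:
  assumes "ring_map \<sigma>" "\<And>z. z \<in> X \<Longrightarrow> f z \<in> V Y"
  shows "slin \<sigma> X Y (lext \<sigma> X f)"
proof -
  have add: "\<sigma> (p + q) = \<sigma> p + \<sigma> q" and mult: "\<sigma> (p * q) = \<sigma> p * \<sigma> q" for p q
    using assms(1) by (simp_all add: ring_map_def)
  show ?thesis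
    unfolding slin_def lext_def
    by (intro conjI ballI allI)
       (simp_all add: add mult msmult_add_left sum.distrib msmult_sum V_sum V_msmult assms(2) plus_fun_apply msmult_apply)
qed

lemma lext_delta:
  assumes "ring_map \<sigma>" "finite X" "z \<in> X"
  shows "lext \<sigma> X f (delta z) = f z"
proof
  fix y
  have "lext \<sigma> X f (delta z) y = (\<Sum>u\<in>X. if u = z then f u y else 0)"
    unfolding lext_def sum_vec_apply using assms(1) ring_map_0[OF assms(1)]
    by (intro sum.cong refl) (auto simp: ring_map_def delta_def vec_apply)
  then show "lext \<sigma> X f (delta z) y = f z y" using assms by (simp add: sum.delta)
qed

section \<open>Canonical bases for unitriangular semilinear involutions\<close>

lemma finite_has_max:
  fixes ht :: "'a \<Rightarrow> nat"
  assumes "finite B" "B \<noteq> {}"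
  shows "\<exists>u\<in>B. \<forall>v\<in>B. ht v \<le> ht u"
proof -
  have "Max (ht ` B) \<in> ht ` B" using assms by (intro Max_in) auto
  then obtain u where "u \<in> B" "Max (ht ` B) = ht u" by blast
  then show ?thesis using Max_ge[OF finite_imageI[OF assms(1)], of _ ht] by force
qed

text \<open>Peel off the top layer: subtracting the \<open>C y\<close> of maximal height, weighted
  by the coefficients of \<open>m\<close> there, leaves a vector supported on smaller
  heights.\<close>

lemma triangular_span:
  fixes ht :: "perm \<Rightarrow> nat"
  assumes fin: "finite X"
    and tri: "\<And>y. y \<in> X \<Longrightarrow> ht y < L \<Longrightarrow> C y - delta y \<in> V {u\<in>X. ht u < ht y}"
    and m: "m \<in> V {y\<in>X. ht y < L}"
  shows "\<exists>c. m = (\<Sum>y\<in>{y\<in>X. ht y < L}. msmult (c y) (C y))"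
  using tri m
proof (induction L arbitrary: m)
  case 0
  then have "m = 0" by (auto simp: V_def fun_eq_iff)
  then show ?case by auto
next
  case (Suc L)
  let ?E = "{y\<in>X. ht y = L}" and ?X = "\<lambda>L. {y\<in>X. ht y < L}"
  define r where "r = m - (\<Sum>y\<in>?E. msmult (m y) (C y))"
  have XS: "?X (Suc L) = ?X L \<union> ?E" by auto
  have "r \<in> V (?X L)"
  proof -
    have "r = (m - (\<Sum>y\<in>?E. msmult (m y) (delta y))) - (\<Sum>y\<in>?E. msmult (m y) (C y - delta y))"
      unfolding r_def by (simp add: fun_eq_iff vec_apply sum_subtractf right_diff_distrib)
    moreover have "m - (\<Sum>y\<in>?E. msmult (m y) (delta y)) \<in> V (?X L)"
    proof -
      have "(m - (\<Sum>y\<in>?E. msmult (m y) (delta y))) u = 0" if "u \<notin> ?X L" for u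
      proof (cases "u \<in> ?E")
        case True
        have "(\<Sum>y\<in>?E. msmult (m y) (delta y)) u = (\<Sum>y\<in>?E. if y = u then m y else 0)"
          unfolding sum_vec_apply by (intro sum.cong refl) (auto simp: delta_def vec_apply)
        then show ?thesis using True fin by (simp add: vec_apply sum.delta)
      next
        case False
        then have "m u = 0" using Suc.prems(2) that by (auto simp: V_def less_Suc_eq)
        moreover have "(\<Sum>y\<in>?E. msmult (m y) (delta y)) u = 0"
          using False unfolding sum_vec_apply by (intro sum.neutral) (auto simp: delta_def vec_apply)
        ultimately show ?thesis by (simp add: vec_apply)
      qed
      then show ?thesis by (simp add: V_def)
    qed
    moreover have "(\<Sum>y\<in>?E. msmult (m y) (C y - delta y)) \<in> V (?X L)"
    proof (intro V_sum V_msmult)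
      fix a assume "a \<in> ?E"
      then show "C a - delta a \<in> V (?X L)" using Suc.prems(1)[of a] by (simp only: mem_Collect_eq lessI)
    qed
    ultimately show ?thesis by (simp only: V_diff)
  qed
  then obtain c where c: "r = (\<Sum>y\<in>?X L. msmult (c y) (C y))"
    using Suc.IH[of r] Suc.prems(1) less_SucI by blast
  let ?c = "\<lambda>y. if ht y = L then m y else c y"
  have "(\<Sum>y\<in>?X (Suc L). msmult (?c y) (C y))
      = (\<Sum>y\<in>?X L. msmult (?c y) (C y)) + (\<Sum>y\<in>?E. msmult (?c y) (C y))"
    unfolding XS using fin by (intro sum.union_disjoint) auto
  also have "(\<Sum>y\<in>?X L. msmult (?c y) (C y)) = r" unfolding c by (intro sum.cong) auto
  also have "(\<Sum>y\<in>?E. msmult (?c y) (C y)) = (\<Sum>y\<in>?E. msmult (m y) (C y))"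
    by (intro sum.cong) auto
  finally have "m = (\<Sum>y\<in>?X (Suc L). msmult (?c y) (C y))"
    unfolding r_def by simp
  then show ?case by (rule exI[of _ ?c])
qed

text \<open>Among the nonzero coefficients choose one at a \<open>u\<close> of maximal height. No
  other term reaches \<open>u\<close>, so the value of the combination at \<open>u\<close> is that
  coefficient.\<close>

lemma triangular_indep:
  fixes ht :: "perm \<Rightarrow> nat"
  assumes fin: "finite Y" and YX: "Y \<subseteq> X"
    and tri: "\<And>y. y \<in> Y \<Longrightarrow> C y - delta y \<in> V {u\<in>X. ht u < ht y}"
    and zero: "(\<Sum>y\<in>Y. msmult (c y) (C y)) = 0" and y: "y \<in> Y"
  shows "c y = 0"
proof (rule ccontr)
  assume "c y \<noteq> 0"
  define B where "B = {u\<in>Y. c u \<noteq> 0}"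
  have B: "finite B" "B \<noteq> {}" using fin y \<open>c y \<noteq> 0\<close> by (auto simp: B_def)
  obtain u where u: "u \<in> B" "\<And>v. v \<in> B \<Longrightarrow> ht v \<le> ht u"
    using finite_has_max[OF B] by blast
  have val: "C v u = (if v = u then 1 else 0)" if "v \<in> B" for v
  proof -
    have "(C v - delta v) u = 0" using tri[of v] that u(2)[OF that] by (auto simp: V_def B_def)
    then show ?thesis by (auto simp: delta_def vec_apply split: if_splits)
  qed
  have "0 = (\<Sum>v\<in>Y. msmult (c v) (C v)) u" by (simp add: zero)
  also have "\<dots> = (\<Sum>v\<in>Y. c v * C v u)" by (simp add: vec_apply)
  also have "\<dots> = (\<Sum>v\<in>B. c v * C v u)"
    by (intro sum.mono_neutral_right fin) (auto simp: B_def)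
  also have "\<dots> = (\<Sum>v\<in>B. if v = u then c v else 0)" by (intro sum.cong) (auto simp: val)
  also have "\<dots> = c u" using B u by (simp add: sum.delta)
  finally show False using u by (simp add: B_def)
qed

text \<open>The Kazhdan-Lusztig argument: expand the error \<open>\<phi> (delta z) - delta z\<close>
  in the canonical elements below \<open>z\<close>, show that its coefficients are antisymmetric
  under the bar, and correct \<open>delta z\<close> by their negative parts.\<close>

lemma canonical_element_exists:
  fixes ht :: "perm \<Rightarrow> nat"
  assumes fin: "finite X" and \<phi>: "slin lbar X X \<phi>" and inv: "\<And>a. a \<in> V X \<Longrightarrow> \<phi> (\<phi> a) = a"
    and tri: "\<And>z. z \<in> X \<Longrightarrow> \<phi> (delta z) - delta z \<in> V {y\<in>X. ht y < ht z}"
    and z: "z \<in> X"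
  shows "\<exists>C. \<phi> C = C \<and> C - delta z \<in> V {y\<in>X. ht y < ht z} \<and> (\<forall>y. y \<noteq> z \<longrightarrow> negpart (C y))"
  using z
proof (induction "ht z" arbitrary: z rule: less_induct)
  case less
  let ?Y = "{y\<in>X. ht y < ht z}"
  have "\<forall>y\<in>?Y. \<exists>C. \<phi> C = C \<and> C - delta y \<in> V {u\<in>X. ht u < ht y} \<and> (\<forall>u. u \<noteq> y \<longrightarrow> negpart (C u))"
    using less.hyps by auto
  from bchoice[OF this] obtain C where
    C': "\<forall>y\<in>?Y. \<phi> (C y) = C y \<and> C y - delta y \<in> V {u\<in>X. ht u < ht y} \<and> (\<forall>u. u \<noteq> y \<longrightarrow> negpart (C y u))"
    by blast
  have C: "\<phi> (C y) = C y" "C y - delta y \<in> V {u\<in>X. ht u < ht y}"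
      "u \<noteq> y \<Longrightarrow> negpart (C y u)" if "y \<in> ?Y" for y u
    using bspec[OF C' that] by simp_all
  have CV: "C y \<in> V {u\<in>X. ht u < ht z}" if "y \<in> ?Y" for y
  proof -
    have "C y = (C y - delta y) + delta y" by simp
    moreover have "C y - delta y \<in> V ?Y"
      using C(2)[OF that] that by (auto simp: V_def)
    moreover have "delta y \<in> V ?Y" using that by blast
    ultimately show ?thesis by (metis V_add)
  qed
  have CX: "C y \<in> V X" if "y \<in> ?Y" for y using CV[OF that] by (auto simp: V_def)
  obtain q where q: "\<phi> (delta z) - delta z = (\<Sum>y\<in>?Y. msmult (q y) (C y))"
    using triangular_span[OF fin, where L = "ht z" and C = C] C(2) tri[OF less.prems] by blast
  let ?S = "\<lambda>q. \<Sum>y\<in>?Y. msmult (q y) (C y)"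
  have \<phi>S: "\<phi> (?S r) = ?S (\<lambda>y. lbar (r y))" for r
  proof -
    have "\<phi> (?S r) = (\<Sum>y\<in>?Y. \<phi> (msmult (r y) (C y)))"
      by (rule slin_sum[OF \<phi>]) (use CX in blast)
    also have "\<dots> = ?S (\<lambda>y. lbar (r y))"
      by (intro sum.cong refl) (use CX C(1) slin_msmult[OF \<phi>] in auto)
    finally show ?thesis .
  qed
  have dz: "delta z \<in> V X" using less.prems by blast
  have pdz: "\<phi> (delta z) = delta z + ?S q" using q by (simp add: algebra_simps)
  have SX: "?S r \<in> V X" for r using CX by blast
  \<comment> \<open>Applying the involution twice adds the coefficients \<open>q y\<close> and
    \<open>lbar (q y)\<close>; linear independence forces their sum to vanish.\<close>
  have "delta z = \<phi> (delta z + ?S q)" using inv[OF dz] pdz by simp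
  also have "\<dots> = delta z + ?S q + ?S (\<lambda>y. lbar (q y))"
    using slin_add[OF \<phi> dz SX] pdz \<phi>S by simp
  finally have "?S (\<lambda>y. q y + lbar (q y)) = 0"
    by (simp add: msmult_add_left sum.distrib add.assoc)
  then have "q y + lbar (q y) = 0" if "y \<in> ?Y" for y
    using triangular_indep[where c = "\<lambda>y. q y + lbar (q y)" and Y = ?Y and X = X and C = C and ht = ht] C(2) fin that
    by auto
  then have "\<forall>y\<in>?Y. \<exists>p. negpart p \<and> q y + lbar p = p"
    by (metis antisymmetric_split add_eq_0_iff)
  from bchoice[OF this] obtain p where p': "\<forall>y\<in>?Y. negpart (p y) \<and> q y + lbar (p y) = p y"
    by blast
  have p: "negpart (p y)" "q y + lbar (p y) = p y" if "y \<in> ?Y" for y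
    using bspec[OF p' that] by simp_all
  let ?C = "delta z + ?S p"
  have "\<phi> ?C = delta z + (?S q + ?S (\<lambda>y. lbar (p y)))"
    using slin_add[OF \<phi> dz SX] pdz \<phi>S by (simp add: add.assoc)
  also have "?S q + ?S (\<lambda>y. lbar (p y)) = ?S p"
    unfolding sum.distrib[symmetric] msmult_add_left[symmetric] by (intro sum.cong) (auto simp: p)
  finally have 1: "\<phi> ?C = ?C" .
  have 2: "?C - delta z \<in> V ?Y" using CV by (auto simp: algebra_simps)
  have 3: "negpart (?C u)" if "u \<noteq> z" for u
  proof -
    have "negpart (p y * C y u)" if "y \<in> ?Y" for y
    proof (cases "u = y")
      case True
      then have "(C y - delta y) u = 0" using C(2)[OF that] by (auto simp: V_def)
      then have "C y u = 1" using True by (simp add: vec_apply)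
      then show ?thesis using p(1)[OF that] by simp
    next
      case False
      then show ?thesis using negpart_mult p(1) C(3) that by blast
    qed
    then show ?thesis using that by (auto simp: vec_apply delta_other intro!: negpart_sum)
  qed
  show ?case using 1 2 3 by blast
qed

text \<open>At a support point of maximal height, triangularity reduces \<open>\<phi> m = m\<close>
  to invariance of a single coefficient with negative exponents, which must be zero.\<close>

lemma canonical_element_unique:
  fixes ht :: "perm \<Rightarrow> nat"
  assumes fin: "finite X" and \<phi>: "slin lbar X X \<phi>"
    and tri: "\<And>z. z \<in> X \<Longrightarrow> \<phi> (delta z) - delta z \<in> V {y\<in>X. ht y < ht z}"
    and m: "m \<in> V X" "\<phi> m = m" "\<And>y. negpart (m y)"
  shows "m = 0"
proof (rule ccontr)
  assume "m \<noteq> 0"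
  define B where "B = {u\<in>X. m u \<noteq> 0}"
  have "B \<noteq> {}"
  proof
    assume "B = {}"
    then have "m = 0" using m(1) by (auto simp: B_def V_def fun_eq_iff)
    then show False using \<open>m \<noteq> 0\<close> by simp
  qed
  moreover have "finite B" using fin by (simp add: B_def)
  ultimately obtain u where u: "u \<in> B" "\<And>v. v \<in> B \<Longrightarrow> ht v \<le> ht u"
    using finite_has_max[of B ht] by blast
  have val: "\<phi> (delta v) u = (if v = u then 1 else 0)" if "v \<in> B" for v
  proof -
    have "(\<phi> (delta v) - delta v) u = 0"
      using tri[of v] that u(2)[OF that] by (auto simp: V_def B_def)
    then show ?thesis by (auto simp: delta_def vec_apply split: if_splits)
  qed
  have "m u = \<phi> m u" by (simp add: m)
  also have "\<dots> = (\<Sum>v\<in>X. lbar (m v) * \<phi> (delta v) u)"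
    by (subst slin_expand[OF fin \<phi> m(1)]) (simp add: vec_apply)
  also have "\<dots> = (\<Sum>v\<in>B. lbar (m v) * \<phi> (delta v) u)"
    by (intro sum.mono_neutral_right fin) (auto simp: B_def)
  also have "\<dots> = (\<Sum>v\<in>B. if v = u then lbar (m v) else 0)" by (intro sum.cong) (auto simp: val)
  also have "\<dots> = lbar (m u)" using \<open>finite B\<close> u by (simp add: sum.delta)
  finally have "m u = 0" using negpart_self_bar_zero m(3) by metis
  then show False using u by (simp add: B_def)
qed

section \<open>Signed permutations, descents and the exchange property\<close>

declare o_apply [simp del] id_apply [simp del]

definition rfl :: "int \<Rightarrow> int \<Rightarrow> perm" where
  "rfl a b j = (if j = a then b else if j = b then a else if j = - a then - b else if j = - b then - a else j)"

text \<open>The pair \<open>(a, b)\<close> stands for the root \<open>e\<^sub>b - e\<^sub>a\<close>, where \<open>e\<^sub>-\<^sub>i = - e\<^sub>i\<close>; it is positive iff \<open>a < b\<close>,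
  and \<open>(- b, - a)\<close> is the same root. The simple root of \<open>s\<^sub>i\<close> is \<open>(ra i, rb i)\<close>.\<close>

definition ra :: "int \<Rightarrow> int" where "ra i = (if i > 0 then i else -1)"
definition rb :: "int \<Rightarrow> int" where "rb i = (if i > 0 then i + 1 else if i = 0 then 1 else 2)"

lemma ra_less_rb: "ra i < rb i" by (simp add: ra_def rb_def)
lemma ra_rb_nz: "ra i \<noteq> 0" "rb i \<noteq> 0" by (simp_all add: ra_def rb_def)

lemma index_cases: obtains "(i::int) > 0" | "i = 0" | "i < 0" by linarith

lemma sgen_rfl: "sgen i = rfl (ra i) (rb i)"
proof
  fix j show "sgen i j = rfl (ra i) (rb i) j"
    by (cases i rule: index_cases) (simp_all add: sgen_def rfl_def ra_def rb_def)
qed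

lemma sgen_odd: "sgen i (- j) = - sgen i j"
  by (cases i rule: index_cases) (simp_all add: sgen_def, arith?)

lemma sgen_sgen [simp]: "sgen i (sgen i j) = j"
  by (cases i rule: index_cases) (simp_all add: sgen_def)

lemma sgen_comp_sgen [simp]: "sgen i \<circ> sgen i = id"
  by (simp add: fun_eq_iff o_apply id_apply)

lemma sgen_comp_assoc [simp]: "sgen i \<circ> (sgen i \<circ> w) = w" "(w \<circ> sgen i) \<circ> sgen i = w"
  by (simp_all add: fun_eq_iff o_apply)

lemma sgen_eq_iff [simp]: "sgen i j = sgen i k \<longleftrightarrow> j = k"
  by (metis sgen_sgen)

lemma sgen_0 [simp]: "sgen i 0 = 0"
  using sgen_odd[of i 0] by simp

lemma sgen_eq_0_iff [simp]: "sgen i j = 0 \<longleftrightarrow> j = 0"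
  by (metis sgen_0 sgen_eq_iff)

lemma sgen_ra [simp]: "sgen i (ra i) = rb i" "sgen i (rb i) = ra i"
  by (simp_all add: sgen_rfl rfl_def)

text \<open>For \<open>s\<^sub>-\<^sub>1\<close> the pairs \<open>(-d, d)\<close> have to be excluded: they are not roots in type D.\<close>

lemma sgen_mono:
  assumes "c < d" "c \<noteq> 0" "d \<noteq> 0" "i < 0 \<Longrightarrow> c \<noteq> - d"
    and "\<not> (c = ra i \<and> d = rb i)" "\<not> (c = - rb i \<and> d = - ra i)"
  shows "sgen i c < sgen i d"
  using assms
  by (cases i rule: index_cases) (simp_all add: sgen_def ra_def rb_def, (smt (verit))+)

definition oddbij :: "perm \<Rightarrow> bool" where
  "oddbij w \<longleftrightarrow> bij w \<and> (\<forall>i. w (- i) = - w i)"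

lemma oddbij_odd: "oddbij w \<Longrightarrow> w (- i) = - w i" by (simp add: oddbij_def)
lemma oddbij_inj: "oddbij w \<Longrightarrow> w i = w j \<longleftrightarrow> i = j"
  by (auto simp: oddbij_def bij_def inj_def)
lemma oddbij_0: "oddbij w \<Longrightarrow> w 0 = 0" using oddbij_odd[of w 0] by simp
lemma oddbij_eq_0: "oddbij w \<Longrightarrow> w i = 0 \<longleftrightarrow> i = 0" by (metis oddbij_0 oddbij_inj)
lemma oddbij_comp: "oddbij u \<Longrightarrow> oddbij w \<Longrightarrow> oddbij (u \<circ> w)"
  by (simp add: oddbij_def bij_comp o_apply)
lemma oddbij_sgen: "oddbij (sgen i)"
  unfolding oddbij_def by (metis sgen_odd sgen_sgen involuntory_imp_bij)
lemma oddbij_id: "oddbij id" by (simp add: oddbij_def id_apply)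

lemma oddbij_rfl: "oddbij u \<Longrightarrow> u \<circ> rfl a b = rfl (u a) (u b) \<circ> u"
proof
  fix j assume u: "oddbij u"
  have "u j = - u k \<longleftrightarrow> j = - k" for k using oddbij_inj[OF u, of j "- k"] oddbij_odd[OF u, of k] by simp
  then show "(u \<circ> rfl a b) j = (rfl (u a) (u b) \<circ> u) j"
    by (simp add: rfl_def oddbij_inj[OF u] oddbij_odd[OF u] o_apply)
qed

lemma rfl_neg: "rfl (- b) (- a) = rfl a b" if "a \<noteq> 0" "b \<noteq> 0"
  using that by (intro ext) (simp add: rfl_def)

definition inds :: "ctype \<Rightarrow> nat \<Rightarrow> int set" where
  "inds t N = (case t of TA \<Rightarrow> {1..int N - 1} | TBC \<Rightarrow> {0..int N - 1} | TD \<Rightarrow> {-1} \<union> {1..int N - 1})"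

lemma gens_inds: "gens t N = sgen ` inds t N"
  by (cases t) (simp_all add: gens_def inds_def)

lemma inds_neg: "i \<in> inds t N \<Longrightarrow> i < 0 \<Longrightarrow> t = TD"
  by (cases t) (auto simp: inds_def)

lemma wprod_Nil [simp]: "wprod [] = id" by (simp add: wprod_def id_apply)
lemma wprod_Cons [simp]: "wprod (s # ws) = s \<circ> wprod ws" by (simp add: wprod_def o_apply)
lemma wprod_append [simp]: "wprod (us @ ws) = wprod us \<circ> wprod ws"
  by (induction us) (simp_all add: o_assoc)

lemma oddbij_wprod: "set ws \<subseteq> gens t N \<Longrightarrow> oddbij (wprod ws)"
  by (induction ws) (auto simp: gens_inds oddbij_id oddbij_comp oddbij_sgen)

lemma wprod_rev: "set ws \<subseteq> gens t N \<Longrightarrow> wprod (rev ws) \<circ> wprod ws = id"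
proof (induction ws)
  case (Cons s ws)
  then obtain i where "s = sgen i" by (auto simp: gens_inds)
  then have "wprod (rev (s # ws)) \<circ> wprod (s # ws) = wprod (rev ws) \<circ> (sgen i \<circ> (sgen i \<circ> wprod ws))"
    by (simp only: rev.simps wprod_append wprod_Cons wprod_Nil o_id comp_assoc)
  then show ?case using Cons by simp
qed simp

lemma inv_wprod: "set ws \<subseteq> gens t N \<Longrightarrow> inv (wprod ws) = wprod (rev ws)"
  using wprod_rev[of ws t N] wprod_rev[of "rev ws" t N]
  by (intro inv_unique_comp) simp_all

text \<open>Strong exchange. Read the word from the right up to the letter at which the images of
  \<open>a\<close> and \<open>b\<close> change order. A simple reflection reverses no positive root
  but its own, so the image of the pair is the root of that letter, and deleting the letter amounts
  to multiplying by \<open>rfl a b\<close> on the right.\<close>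

lemma exchange:
  assumes "set ws \<subseteq> gens t N" "a < b" "a \<noteq> 0" "b \<noteq> 0" "t = TD \<Longrightarrow> a \<noteq> - b"
    and "wprod ws a > wprod ws b"
  shows "\<exists>ws'. set ws' \<subseteq> gens t N \<and> length ws = Suc (length ws') \<and> wprod ws' = wprod ws \<circ> rfl a b"
  using assms
proof (induction ws)
  case (Cons s u)
  then obtain i where i: "i \<in> inds t N" "s = sgen i" by (auto simp: gens_inds)
  have u: "set u \<subseteq> gens t N" using Cons.prems by simp
  have ou: "oddbij (wprod u)" using oddbij_wprod[OF u] .
  show ?case
  proof (cases "wprod u a > wprod u b")
    case True
    then obtain u' where "set u' \<subseteq> gens t N" "length u = Suc (length u')" "wprod u' = wprod u \<circ> rfl a b"
      using Cons.IH Cons.prems u by blast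
    then show ?thesis using Cons.prems by (intro exI[of _ "s # u'"]) (simp add: comp_assoc)
  next
    case False
    let ?c = "wprod u a" and ?d = "wprod u b"
    have lt: "?c < ?d" using False Cons.prems(2) oddbij_inj[OF ou, of a b] by linarith
    have nz: "?c \<noteq> 0" "?d \<noteq> 0" using Cons.prems oddbij_eq_0[OF ou] by auto
    have nd: "i < 0 \<Longrightarrow> ?c \<noteq> - ?d"
      using Cons.prems inds_neg[OF i(1)] oddbij_inj[OF ou, of a "- b"] oddbij_odd[OF ou] by auto
    have "\<not> sgen i ?c < sgen i ?d" using Cons.prems i by (auto simp: o_apply)
    then have "?c = ra i \<and> ?d = rb i \<or> ?c = - rb i \<and> ?d = - ra i"
      using sgen_mono[OF lt nz nd] by blast
    then have "rfl ?c ?d = s"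
      unfolding i(2) sgen_rfl using rfl_neg[OF ra_rb_nz] by auto
    then have "wprod u \<circ> rfl a b = s \<circ> wprod u" using oddbij_rfl[OF ou] by simp
    then have "wprod (s # u) \<circ> rfl a b = wprod u"
      using i by (metis comp_assoc sgen_comp_assoc(1) wprod_Cons)
    then show ?thesis using u by (intro exI[of _ u]) simp
  qed
qed (simp add: id_apply)

section \<open>The groups of types A, BC and D and their generation by simple reflections\<close>

lemma supp_set_neg [simp]: "- i \<in> supp_set N \<longleftrightarrow> i \<in> supp_set N" by (simp add: supp_set_def)
lemma finite_supp_set [simp]: "finite (supp_set N)"
  by (rule finite_subset[of _ "{- int N..int N}"]) (auto simp: supp_set_def)

lemma W_BC_iff: "w \<in> W_BC N \<longleftrightarrow> oddbij w \<and> (\<forall>i. i \<notin> supp_set N \<longrightarrow> w i = i)"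
proof
  assume w: "w \<in> W_BC N"
  then have "w permutes supp_set N" by (intro bij_imp_permutes) (auto simp: W_BC_def)
  then show "oddbij w \<and> (\<forall>i. i \<notin> supp_set N \<longrightarrow> w i = i)"
    using w by (auto simp: W_BC_def oddbij_def permutes_bij)
next
  assume w: "oddbij w \<and> (\<forall>i. i \<notin> supp_set N \<longrightarrow> w i = i)"
  then have "w permutes supp_set N"
    by (auto simp: permutes_def oddbij_def bij_iff)
  then show "w \<in> W_BC N" using w by (auto simp: W_BC_def oddbij_def permutes_imp_bij)
qed

lemma W_BC_supp: "w \<in> W_BC N \<Longrightarrow> w i \<in> supp_set N \<longleftrightarrow> i \<in> supp_set N"
  unfolding W_BC_iff by (metis oddbij_inj)

lemma finite_W_BC: "finite (W_BC N)"
proof (rule finite_subset)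
  show "W_BC N \<subseteq> {w. w permutes supp_set N}"
    by (auto simp: W_BC_def intro!: bij_imp_permutes)
  show "finite {w. w permutes supp_set N}" by (rule finite_permutations) simp
qed

lemma sgen_fix: "i \<in> inds t N \<Longrightarrow> N \<ge> 2 \<Longrightarrow> j \<notin> supp_set N \<Longrightarrow> sgen i j = j"
  by (cases t; cases i rule: index_cases) (auto simp: inds_def supp_set_def sgen_def)

lemma sgen_W_BC: "i \<in> inds t N \<Longrightarrow> N \<ge> 2 \<Longrightarrow> sgen i \<in> W_BC N"
  using sgen_fix by (auto simp: W_BC_iff oddbij_sgen)

lemma W_BC_comp: "u \<in> W_BC N \<Longrightarrow> w \<in> W_BC N \<Longrightarrow> u \<circ> w \<in> W_BC N"
  by (auto simp: W_BC_iff oddbij_comp o_apply)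

lemma id_W_BC: "id \<in> W_BC N" by (simp add: W_BC_iff oddbij_id id_apply)

text \<open>A generator with positive index permutes the positions of the negative values. The
  generator \<open>sgen (-1)\<close> replaces the values at 1 and 2 by minus each other, which flips
  two signs at once.\<close>

lemma W_D_comp_sgen:
  assumes w: "w \<in> W_D N" and i: "i \<in> inds TD N" and N: "N \<ge> 2"
  shows "w \<circ> sgen i \<in> W_D N"
proof -
  let ?neg = "\<lambda>w::perm. {j\<in>{1..int N}. w j < 0}"
  have wbc: "w \<in> W_BC N" "even (card (?neg w))" using w by (auto simp: W_D_def)
  have ow: "oddbij w" using wbc by (simp add: W_BC_iff)
  have "even (card (?neg (w \<circ> sgen i)))"
  proof (cases "i > 0")
    case True
    have rng: "sgen i j \<in> {1..int N} \<longleftrightarrow> j \<in> {1..int N}" for j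
      using True i by (auto simp: sgen_def inds_def)
    have "?neg (w \<circ> sgen i) = sgen i ` ?neg w"
    proof
      show "?neg (w \<circ> sgen i) \<subseteq> sgen i ` ?neg w"
      proof
        fix j assume "j \<in> ?neg (w \<circ> sgen i)"
        then have "sgen i j \<in> ?neg w" using rng[of j] by (auto simp: o_apply)
        then show "j \<in> sgen i ` ?neg w" by (metis imageI sgen_sgen)
      qed
      show "sgen i ` ?neg w \<subseteq> ?neg (w \<circ> sgen i)" using rng by (auto simp: o_apply)
    qed
    then show ?thesis using wbc(2) by (simp add: card_image inj_on_def)
  next
    case False
    then have i1: "i = -1" using i by (auto simp: inds_def)
    let ?B = "{j\<in>{3..int N}. w j < 0}"
    have nz: "w 1 \<noteq> 0" "w 2 \<noteq> 0" using oddbij_eq_0[OF ow] by auto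
    have v: "sgen (-1) 1 = -2" "sgen (-1) 2 = -1" "j \<ge> 3 \<Longrightarrow> sgen (-1) j = j" for j
      by (simp_all add: sgen_def)
    have split: "{1..int N} = {1} \<union> {2} \<union> {3..int N}" using N by auto
    have c: "card (?neg u) = (if u 1 < 0 then 1 else 0) + (if u 2 < 0 then 1 else 0) + card {j\<in>{3..int N}. u j < 0}"
      for u :: perm
    proof -
      have e: "?neg u = ((if u 1 < 0 then {1} else {}) \<union> (if u 2 < 0 then {2} else {})) \<union> {j\<in>{3..int N}. u j < 0}"
        unfolding split by auto
      have "finite {j\<in>{3..int N}. u j < 0}"
        by (rule finite_subset[of _ "{3..int N}"]) auto
      then show ?thesis unfolding e by (subst card_Un_disjoint) auto
    qed
    have "{j\<in>{3..int N}. (w \<circ> sgen i) j < 0} = ?B" using v i1 by (auto simp: o_apply)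
    then show ?thesis using wbc(2) nz unfolding c[of w] c[of "w \<circ> sgen i"]
      by (auto simp: i1 v o_apply oddbij_odd[OF ow] split: if_splits)
  qed
  then show ?thesis using W_BC_comp[OF wbc(1) sgen_W_BC[OF i N]] by (simp add: W_D_def)
qed

lemma increasing_interval_id:
  fixes f :: "int \<Rightarrow> int"
  assumes "\<And>i. m \<le> i \<Longrightarrow> i < N \<Longrightarrow> f i < f (i + 1)" "f m \<ge> m" "f N \<le> N" "m \<le> i" "i \<le> N"
  shows "f i = i"
proof -
  have up: "f i \<ge> i" if "m \<le> i" "i \<le> N" for i
    using that
  proof (induction i rule: int_ge_induct)
    case (step i) then show ?case using assms(1)[of i] by simp
  qed (use assms in simp)
  have down: "f i \<le> i" if "i \<le> N" "m \<le> i" for i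
    using that
  proof (induction i rule: int_le_induct)
    case (step i) then show ?case using assms(1)[of "i - 1"] by simp
  qed (use assms in simp)
  show ?thesis using up down assms by (simp add: order_antisym)
qed

text \<open>A strictly increasing map of an integer interval into itself is the identity. In type BC
  the generator \<open>sgen 0\<close> makes \<open>w 1\<close> positive. In type D one gets only
  \<open>w 2 >= 2\<close>, so \<open>w\<close> fixes 2, ..., N and sends 1 to 1 or -1; the parity
  condition excludes -1. Type A is left out because its group is defined by words.\<close>

lemma no_descent_id:
  assumes w: "w \<in> Wgrp t N" and t: "t \<noteq> TA" and N: "N \<ge> 2"
    and nd: "\<And>i. i \<in> inds t N \<Longrightarrow> w (ra i) \<le> w (rb i)"
  shows "w = id"
proof -
  have wbc: "w \<in> W_BC N" using w t by (cases t) (auto simp: Wgrp_def W_D_def)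
  then have ow: "oddbij w" by (simp add: W_BC_iff)
  have inc: "w i < w (i + 1)" if "1 \<le> i" "i < int N" for i
  proof -
    have "i \<in> inds t N" using that t by (cases t) (auto simp: inds_def)
    from nd[OF this] have "w i \<le> w (i + 1)" using that by (simp add: ra_def rb_def)
    then show ?thesis using oddbij_inj[OF ow, of i "i + 1"] by simp
  qed
  have top: "w (int N) \<le> int N"
    using W_BC_supp[OF wbc, of "int N"] N by (auto simp: supp_set_def)
  have one: "w 1 \<noteq> 0" using oddbij_eq_0[OF ow] by simp
  have pos: "w i = i" if "1 \<le> i" "i \<le> int N" for i
  proof (cases t)
    case TBC
    have "w (- 1) \<le> w 1" using nd[of 0] N TBC by (simp add: inds_def ra_def rb_def)
    then have "w 1 \<ge> 1" using oddbij_odd[OF ow, of 1] one by simp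
    then show ?thesis using increasing_interval_id[of 1 "int N" w, OF inc _ top] that by blast
  next
    case TD
    have "w (- 1) \<le> w 2" using nd[of "-1"] N TD by (simp add: inds_def ra_def rb_def)
    then have "- w 1 \<le> w 2" using oddbij_odd[OF ow, of 1] by simp
    moreover have "w 1 < w 2" using inc[of 1] N by simp
    moreover have "w 2 \<noteq> - w 1"
      using oddbij_inj[OF ow, of 2 "-1"] oddbij_odd[OF ow, of 1] by auto
    ultimately have "w 2 \<ge> 2" using one by simp
    then have ge2: "w i = i" if "2 \<le> i" "i \<le> int N" for i
      using increasing_interval_id[of 2 "int N" w i, OF inc _ top] that by auto
    have "w 1 \<in> supp_set N" using W_BC_supp[OF wbc, of 1] N by (simp add: supp_set_def)
    moreover have "\<not> (2 \<le> \<bar>w 1\<bar> \<and> \<bar>w 1\<bar> \<le> int N)"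
    proof
      assume h: "2 \<le> \<bar>w 1\<bar> \<and> \<bar>w 1\<bar> \<le> int N"
      then have "w \<bar>w 1\<bar> = \<bar>w 1\<bar>" using ge2 by blast
      then have "w \<bar>w 1\<bar> = w 1 \<or> w \<bar>w 1\<bar> = w (- 1)" using oddbij_odd[OF ow, of 1] by linarith
      then show False using oddbij_inj[OF ow] h by auto
    qed
    ultimately have "w 1 = 1 \<or> w 1 = -1" by (auto simp: supp_set_def)
    moreover have "w 1 \<noteq> -1"
    proof
      assume m: "w 1 = -1"
      have "{i \<in> {1..int N}. w i < 0} = {1}"
        using m ge2 N by (auto, smt (verit))
      then show False using w TD by (simp add: Wgrp_def W_D_def)
    qed
    ultimately show ?thesis using ge2[of i] that by (cases "i = 1") auto
  qed (use t in simp)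
  have "w i = i" for i
  proof (cases "i \<in> supp_set N")
    case True
    then show ?thesis using pos[of "\<bar>i\<bar>"] oddbij_odd[OF ow, of i] by (auto simp: supp_set_def abs_if split: if_splits)
  next
    case False then show ?thesis using wbc by (simp add: W_BC_iff)
  qed
  then show ?thesis by (auto simp: id_apply)
qed

lemma Wgrp_comp_sgen:
  assumes "w \<in> Wgrp t N" "i \<in> inds t N" "N \<ge> 2"
  shows "w \<circ> sgen i \<in> Wgrp t N"
proof (cases t)
  case TA
  then obtain ws where "set ws \<subseteq> gens t N" "w = wprod ws" using assms(1) by (auto simp: Wgrp_def)
  then have "w \<circ> sgen i = wprod (ws @ [sgen i])" "set (ws @ [sgen i]) \<subseteq> gens t N"
    using assms(2) by (auto simp: gens_inds)
  then have "\<exists>us. w \<circ> sgen i = wprod us \<and> set us \<subseteq> gens t N" by blast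
  then show ?thesis using TA by (simp add: Wgrp_def)
next
  case TBC then show ?thesis using assms W_BC_comp sgen_W_BC by (auto simp: Wgrp_def)
next
  case TD then show ?thesis using assms W_D_comp_sgen by (auto simp: Wgrp_def)
qed

lemma id_Wgrp: "id \<in> Wgrp t N"
proof (cases t)
  case TA then show ?thesis by (auto simp: Wgrp_def intro!: exI[of _ "[]"])
next
  case TD
  have "{i \<in> {1..int N}. id i < 0} = {}" by (auto simp: id_apply)
  then show ?thesis unfolding TD Wgrp_def W_D_def by (simp only: ctype.case mem_Collect_eq id_W_BC card.empty) simp
qed (simp_all add: Wgrp_def id_W_BC)

lemma wprod_Wgrp: "set ws \<subseteq> gens t N \<Longrightarrow> N \<ge> 2 \<Longrightarrow> wprod ws \<in> Wgrp t N"
proof (induction ws rule: rev_induct)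
  case (snoc s ws)
  then obtain i where "s = sgen i" "i \<in> inds t N" by (auto simp: gens_inds)
  then show ?case using snoc Wgrp_comp_sgen by simp
qed (simp add: id_Wgrp)

text \<open>Induction on the number of inversions. The pairs \<open>(-d, d)\<close> are left out in
  type D because they are not roots there.\<close>

lemma Wgrp_word:
  assumes "w \<in> Wgrp t N" "N \<ge> 2"
  shows "\<exists>ws. set ws \<subseteq> gens t N \<and> wprod ws = w"
proof (cases "t = TA")
  case True then show ?thesis using assms by (auto simp: Wgrp_def)
next
  case nA: False
  let ?I = "\<lambda>w. {(c, d). c \<in> supp_set N \<and> d \<in> supp_set N \<and> c < d \<and> (t = TD \<longrightarrow> c \<noteq> - d) \<and> (w::perm) d < w c}"
  have fin: "finite (?I w)" for w
    by (rule finite_subset[of _ "supp_set N \<times> supp_set N"]) auto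
  show ?thesis using assms(1)
  proof (induction "card (?I w)" arbitrary: w rule: less_induct)
    case less
    show ?case
    proof (cases "\<exists>i\<in>inds t N. w (rb i) < w (ra i)")
      case False
      then have "w = id" using no_descent_id[OF less.prems nA assms(2)] by (auto simp: not_less)
      then show ?thesis by (intro exI[of _ "[]"]) simp
    next
      case True
      then obtain i where i: "i \<in> inds t N" "w (rb i) < w (ra i)" by blast
      let ?w = "w \<circ> sgen i" and ?f = "\<lambda>(c, d). (sgen i c, sgen i d)"
      have ow: "oddbij w"
        using less.prems nA by (cases t) (auto simp: Wgrp_def W_D_def W_BC_iff)
      have sW: "sgen i j \<in> supp_set N \<longleftrightarrow> j \<in> supp_set N" for j
        using W_BC_supp[OF sgen_W_BC[OF i(1) assms(2)]] .
      have sup: "ra i \<in> supp_set N" "rb i \<in> supp_set N"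
        using i(1) assms(2) by (cases t; auto simp: inds_def ra_def rb_def supp_set_def)+
      have rab: "(ra i, rb i) \<in> ?I w"
        using sup i ra_less_rb[of i] nA by (cases t) (auto simp: inds_def ra_def rb_def)
      \<comment> \<open>Conjugating the pair by the generator maps inversions of \<open>w s\<close>
        injectively to inversions of \<open>w\<close>, and misses the simple root of
        \<open>s\<close>, which is itself an inversion of \<open>w\<close>.\<close>
      have "?f ` ?I ?w \<subseteq> ?I w - {(ra i, rb i)}"
      proof clarify
        fix c d assume cd: "c \<in> supp_set N" "d \<in> supp_set N" "c < d" "t = TD \<longrightarrow> c \<noteq> - d" "(w \<circ> sgen i) d < (w \<circ> sgen i) c"
        have nz: "c \<noteq> 0" "d \<noteq> 0" using cd by (auto simp: supp_set_def)
        have "sgen i c < sgen i d"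
        proof (rule sgen_mono[OF cd(3) nz])
          show "i < 0 \<Longrightarrow> c \<noteq> - d" using cd(4) inds_neg[OF i(1)] by blast
          show "\<not> (c = ra i \<and> d = rb i)" using cd(5) i(2) by (auto simp: o_apply)
          show "\<not> (c = - rb i \<and> d = - ra i)" using cd(5) i(2) by (auto simp: o_apply sgen_odd oddbij_odd[OF ow])
        qed
        moreover have "sgen i c \<noteq> - sgen i d" if "c \<noteq> - d"
          using that by (metis sgen_eq_iff sgen_odd)
        moreover have "(sgen i c, sgen i d) \<noteq> (ra i, rb i)"
          using cd(3) ra_less_rb[of i] by (metis Pair_inject order_less_asym sgen_ra sgen_sgen)
        ultimately show "(sgen i c, sgen i d) \<in> ?I w - {(ra i, rb i)}"
          using cd sW by (auto simp: o_apply)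
      qed
      moreover have "inj_on ?f (?I ?w)" by (auto simp: inj_on_def)
      ultimately have "card (?I ?w) \<le> card (?I w - {(ra i, rb i)})"
        using fin by (intro card_inj_on_le[of ?f]) auto
      also have "\<dots> < card (?I w)" using rab fin[of w] by (intro psubset_card_mono) auto
      finally obtain ws where "set ws \<subseteq> gens t N" "wprod ws = ?w"
        using less.hyps[of ?w] Wgrp_comp_sgen[OF less.prems i(1) assms(2)] by blast
      then show ?thesis using i(1) by (intro exI[of _ "ws @ [sgen i]"]) (auto simp: gens_inds)
    qed
  qed
qed

lemma Wgrp_W_BC: "w \<in> Wgrp t N \<Longrightarrow> N \<ge> 2 \<Longrightarrow> w \<in> W_BC N"
proof (drule (1) Wgrp_word, elim exE conjE)
  fix ws assume N: "N \<ge> 2" and "set ws \<subseteq> gens t N" "wprod ws = w"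
  moreover have "set ws \<subseteq> gens t N \<Longrightarrow> wprod ws \<in> W_BC N"
    by (induction ws) (auto simp: gens_inds id_W_BC intro!: W_BC_comp sgen_W_BC N)
  ultimately show "w \<in> W_BC N" by simp
qed

lemma Wgrp_oddbij: "w \<in> Wgrp t N \<Longrightarrow> N \<ge> 2 \<Longrightarrow> oddbij w"
  using Wgrp_W_BC W_BC_iff by blast

lemma finite_Wgrp: "N \<ge> 2 \<Longrightarrow> finite (Wgrp t N)"
  using finite_W_BC Wgrp_W_BC by (metis finite_subset subsetI)

lemma gens_Wgrp: "s \<in> gens t N \<Longrightarrow> N \<ge> 2 \<Longrightarrow> s \<in> Wgrp t N"
  using wprod_Wgrp[of "[s]" t N] by simp

lemma Wgrp_comp: "u \<in> Wgrp t N \<Longrightarrow> w \<in> Wgrp t N \<Longrightarrow> N \<ge> 2 \<Longrightarrow> u \<circ> w \<in> Wgrp t N"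
proof -
  assume "u \<in> Wgrp t N" "w \<in> Wgrp t N" and N: "N \<ge> 2"
  then obtain us ws where "set us \<subseteq> gens t N" "wprod us = u" "set ws \<subseteq> gens t N" "wprod ws = w"
    using Wgrp_word by metis
  then show ?thesis using wprod_Wgrp[of "us @ ws" t N] N by simp
qed

lemma Wgrp_inv: "w \<in> Wgrp t N \<Longrightarrow> N \<ge> 2 \<Longrightarrow> inv w \<in> Wgrp t N"
  using Wgrp_word inv_wprod wprod_Wgrp by (metis set_rev)

lemma gens_mono: "N \<le> N' \<Longrightarrow> gens t N \<subseteq> gens t N'"
  by (cases t) (auto simp: gens_def)

section \<open>Length\<close>

definition is_word :: "ctype \<Rightarrow> nat \<Rightarrow> perm list \<Rightarrow> perm \<Rightarrow> bool" where
  "is_word t N ws w \<longleftrightarrow> set ws \<subseteq> gens t N \<and> wprod ws = w"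

definition is_red :: "ctype \<Rightarrow> nat \<Rightarrow> perm list \<Rightarrow> perm \<Rightarrow> bool" where
  "is_red t N ws w \<longleftrightarrow> is_word t N ws w \<and> length ws = len t N w"

lemma len_le: "is_word t N ws w \<Longrightarrow> len t N w \<le> length ws"
  unfolding len_def is_word_def by (rule Least_le) blast

lemma red_exists: "w \<in> Wgrp t N \<Longrightarrow> N \<ge> 2 \<Longrightarrow> \<exists>ws. is_red t N ws w"
proof -
  assume "w \<in> Wgrp t N" "N \<ge> 2"
  then obtain ws where "set ws \<subseteq> gens t N" "wprod ws = w" using Wgrp_word by blast
  then have "\<exists>k. \<exists>ws. set ws \<subseteq> gens t N \<and> length ws = k \<and> wprod ws = w" by blast
  from LeastI_ex[OF this] show ?thesis unfolding is_red_def is_word_def len_def by blast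
qed

lemma redword_red: "w \<in> Wgrp t N \<Longrightarrow> N \<ge> 2 \<Longrightarrow> is_red t N (redword t N w) w"
proof -
  assume "w \<in> Wgrp t N" "N \<ge> 2"
  then have "\<exists>ws. set ws \<subseteq> gens t N \<and> length ws = len t N w \<and> wprod ws = w"
    using red_exists[of w t N] by (auto simp: is_red_def is_word_def)
  from someI_ex[OF this] show ?thesis unfolding is_red_def is_word_def redword_def by blast
qed

definition sroot :: "perm \<Rightarrow> int \<Rightarrow> int \<Rightarrow> bool" where
  "sroot s a b \<longleftrightarrow> (\<exists>i. s = sgen i \<and> (a = ra i \<and> b = rb i \<or> a = - rb i \<and> b = - ra i))"

lemma sroot_ra: "sroot (sgen i) (ra i) (rb i)" by (auto simp: sroot_def)

lemma sroot_neg: "sroot s a b \<Longrightarrow> sroot s (- b) (- a)" by (auto simp: sroot_def)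

lemma sroot_less: "sroot s a b \<Longrightarrow> a < b" using ra_less_rb by (auto simp: sroot_def)

lemma sroot_nz: "sroot s a b \<Longrightarrow> a \<noteq> 0 \<and> b \<noteq> 0" using ra_rb_nz by (auto simp: sroot_def)

lemma sroot_rfl: "sroot s a b \<Longrightarrow> s = rfl a b"
  unfolding sroot_def using sgen_rfl rfl_neg[OF ra_rb_nz] by metis

lemma sroot_app:
  assumes "sroot s a b"
  shows "s a = b" "s b = a"
  by (simp_all add: sroot_rfl[OF assms] rfl_def)

lemma sroot_unique: "sroot s a b \<Longrightarrow> sroot s c d \<Longrightarrow> (c, d) = (a, b) \<or> (c, d) = (- b, - a)"
proof -
  assume h: "sroot s a b" "sroot s c d"
  have e: "ra i = ra j \<and> rb i = rb j" if "sgen i = sgen j" for i j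
  proof -
    have "sgen i k = sgen j k" for k using that by simp
    \<comment> \<open>The values at 1, 2 and at the points moved by either generator already
      determine the index.\<close>
    from this[of 1] this[of 2] this[of i] this[of j] this[of "i+1"] this[of "j+1"] show ?thesis
      by (cases i rule: index_cases; cases j rule: index_cases) (simp_all add: sgen_def ra_def rb_def split: if_splits)
  qed
  obtain i j where "s = sgen i" "s = sgen j"
      "a = ra i \<and> b = rb i \<or> a = - rb i \<and> b = - ra i" "c = ra j \<and> d = rb j \<or> c = - rb j \<and> d = - ra j"
    using h unfolding sroot_def by blast
  then show ?thesis using e[of i j] by auto
qed

lemma gens_sroot: "s \<in> gens t N \<Longrightarrow> \<exists>a b. sroot s a b"
  using sroot_ra by (auto simp: gens_inds)

lemma gens_inv: "s \<in> gens t N \<Longrightarrow> s \<circ> s = id" by (auto simp: gens_inds)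

lemma gens_inv_app [simp]: "s \<in> gens t N \<Longrightarrow> s (s j) = j" by (auto simp: gens_inds)

lemma gens_oddbij: "s \<in> gens t N \<Longrightarrow> oddbij s" by (auto simp: gens_inds oddbij_sgen)

lemma gens_D: "s \<in> gens TD N \<Longrightarrow> sroot s a b \<Longrightarrow> a \<noteq> - b"
proof -
  assume s: "s \<in> gens TD N" "sroot s a b"
  then obtain i where i: "s = sgen i" "i \<in> inds TD N" by (auto simp: gens_inds)
  have "ra i \<noteq> - rb i" using i by (auto simp: inds_def ra_def rb_def)
  moreover have "(a, b) = (ra i, rb i) \<or> (a, b) = (- rb i, - ra i)"
    using sroot_unique[OF sroot_ra] s(2) i by blast
  ultimately show ?thesis by auto
qed

lemma gens_mono_pair:
  assumes s: "s \<in> gens t N" and r: "sroot s a b"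
    and "c < d" "c \<noteq> 0" "d \<noteq> 0" "t = TD \<Longrightarrow> c \<noteq> - d" "(c, d) \<noteq> (a, b)" "(c, d) \<noteq> (- b, - a)"
  shows "s c < s d"
proof -
  obtain i where i: "s = sgen i" "i \<in> inds t N" using s by (auto simp: gens_inds)
  have e: "(a, b) = (ra i, rb i) \<or> (a, b) = (- rb i, - ra i)"
    using sroot_unique[OF sroot_ra] r i by blast
  show ?thesis unfolding i
    by (rule sgen_mono) (use assms e inds_neg[OF i(2)] in auto)
qed

text \<open>If \<open>w\<close> inverts the root of \<open>s\<close>, exchange shortens
  \<open>w s\<close> by at least one, while appending \<open>s\<close> to a reduced word of
  \<open>w s\<close> shows that the loss is at most one. The ascending case is this one applied to
  \<open>w s\<close>.\<close>

lemma right_descent: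
  assumes w: "w \<in> Wgrp t N" and N: "N \<ge> 2" and s: "s \<in> gens t N" and r: "sroot s a b"
  shows "w b < w a \<Longrightarrow> len t N w = Suc (len t N (w \<circ> s))"
    and "w a < w b \<Longrightarrow> len t N (w \<circ> s) = Suc (len t N w)"
proof -
  have dn: "len t N w = Suc (len t N (w \<circ> s))" if w: "w \<in> Wgrp t N" and d: "w b < w a" for w
  proof -
    obtain ws where ws: "is_red t N ws w" using red_exists[OF w N] by blast
    then have "\<exists>ws'. set ws' \<subseteq> gens t N \<and> length ws = Suc (length ws') \<and> wprod ws' = wprod ws \<circ> rfl a b"
      using sroot_less[OF r] sroot_nz[OF r] gens_D[OF _ r] s d
      by (intro exchange) (auto simp: is_red_def is_word_def)
    then obtain ws' where "is_word t N ws' (w \<circ> s)" "length ws = Suc (length ws')"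
      using ws sroot_rfl[OF r] by (auto simp: is_red_def is_word_def)
    then have 1: "Suc (len t N (w \<circ> s)) \<le> len t N w" using len_le ws by (fastforce simp: is_red_def)
    obtain us where us: "is_red t N us (w \<circ> s)"
      using red_exists[OF Wgrp_comp[OF w gens_Wgrp[OF s N] N] N] by blast
    then have "is_word t N (us @ [s]) w"
      using s by (auto simp: is_red_def is_word_def fun_eq_iff o_apply)
    from len_le[OF this] us 1 show ?thesis by (simp add: is_red_def)
  qed
  show "w b < w a \<Longrightarrow> len t N w = Suc (len t N (w \<circ> s))" using dn[OF w] .
  show "w a < w b \<Longrightarrow> len t N (w \<circ> s) = Suc (len t N w)"
  proof -
    assume "w a < w b"
    then have "(w \<circ> s) b < (w \<circ> s) a" using sroot_app[OF r] by (simp add: o_apply)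
    from dn[OF Wgrp_comp[OF w gens_Wgrp[OF s N] N] this] show ?thesis
      using s by (simp add: comp_assoc gens_inv)
  qed
qed

lemma len_inv: "w \<in> Wgrp t N \<Longrightarrow> N \<ge> 2 \<Longrightarrow> len t N (inv w) = len t N w"
proof -
  assume w: "w \<in> Wgrp t N" and N: "N \<ge> 2"
  have le: "len t N (inv w) \<le> len t N w" if w: "w \<in> Wgrp t N" for w
  proof -
    obtain ws where ws: "is_red t N ws w" using red_exists[OF w N] by blast
    then have "is_word t N (rev ws) (inv w)" using inv_wprod by (auto simp: is_red_def is_word_def)
    then show ?thesis using len_le ws by (fastforce simp: is_red_def)
  qed
  have "inv (inv w) = w" using Wgrp_oddbij[OF w N] by (simp add: oddbij_def inv_inv_eq)
  then show ?thesis using le[OF w] le[OF Wgrp_inv[OF w N]] by simp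
qed

lemma left_descent:
  assumes w: "w \<in> Wgrp t N" and N: "N \<ge> 2" and s: "s \<in> gens t N" and r: "sroot s a b"
  shows "inv w b < inv w a \<Longrightarrow> len t N w = Suc (len t N (s \<circ> w))"
    and "inv w a < inv w b \<Longrightarrow> len t N (s \<circ> w) = Suc (len t N w)"
proof -
  have "inv (s \<circ> w) = inv w \<circ> inv s"
    using gens_oddbij[OF s] Wgrp_oddbij[OF w N] by (simp add: oddbij_def o_inv_distrib)
  also have "inv s = s" using s by (intro inv_unique_comp) (simp_all add: gens_inv)
  finally have e: "len t N (inv w \<circ> s) = len t N (s \<circ> w)"
    using len_inv[OF Wgrp_comp[OF gens_Wgrp[OF s N] w N] N] by simp
  show "inv w b < inv w a \<Longrightarrow> len t N w = Suc (len t N (s \<circ> w))"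
    and "inv w a < inv w b \<Longrightarrow> len t N (s \<circ> w) = Suc (len t N w)"
    using right_descent[OF Wgrp_inv[OF w N] N s r] len_inv[OF w N] e by simp_all
qed

section \<open>Braid words and independence of reduced words\<close>

text \<open>The alternating word of length m(s, t), starting with \<open>s\<close>. Only the orders
  2, 3 and 4 occur for distinct generators in these types, so the order can be read off from the
  relations and no Coxeter matrix is needed.\<close>

definition bw :: "perm \<Rightarrow> perm \<Rightarrow> perm list" where
  "bw s t = (if s \<circ> t = t \<circ> s then [s, t] else if s \<circ> t \<circ> s = t \<circ> s \<circ> t then [s, t, s] else [s, t, s, t])"

text \<open>Beyond commutation, \<open>t\<close> must preserve the root of \<open>s\<close>, as for
  orthogonal roots; this is what carries descents of \<open>s\<close> across
  \<open>t\<close>.\<close>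

definition commuting :: "perm \<Rightarrow> perm \<Rightarrow> bool" where
  "commuting s t \<longleftrightarrow> s \<circ> t = t \<circ> s \<and> (\<forall>a b. sroot s a b \<longrightarrow> sroot s (t a) (t b))"

text \<open>Two roots sharing the coordinate \<open>b\<close>: on \<open>a\<close>,
  \<open>b\<close>, \<open>c\<close> the generators act as adjacent transpositions. Signed
  coordinates let one definition cover the pair \<open>sgen (-1)\<close>, \<open>sgen 2\<close> of
  type D as well, with -1, 2, 3.\<close>

definition braid3 :: "perm \<Rightarrow> perm \<Rightarrow> int \<Rightarrow> int \<Rightarrow> int \<Rightarrow> bool" where
  "braid3 s t a b c \<longleftrightarrow> sroot s a b \<and> sroot t b c \<and> \<bar>a\<bar> \<noteq> \<bar>b\<bar> \<and> \<bar>b\<bar> \<noteq> \<bar>c\<bar> \<and> \<bar>a\<bar> \<noteq> \<bar>c\<bar>"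

lemma sgen_far_commute:
  assumes "i < j" "j \<ge> 2" "i + 1 < j" "i = - 1 \<Longrightarrow> j \<ge> 3" "i \<ge> - 1"
  shows "sgen i (sgen j k) = sgen j (sgen i k)" "sgen j (ra i) = ra i" "sgen j (rb i) = rb i"
    "sgen i (ra j) = ra j" "sgen i (rb j) = rb j"
  using assms
  by (cases i rule: index_cases; simp add: sgen_def ra_def rb_def)+

lemma commutingI:
  assumes "\<And>k. sgen i (sgen j k) = sgen j (sgen i k)"
    and "(sgen j (ra i), sgen j (rb i)) \<in> {(ra i, rb i), (- rb i, - ra i)}"
  shows "commuting (sgen i) (sgen j)"
  unfolding commuting_def
proof (intro conjI allI impI)
  show "sgen i \<circ> sgen j = sgen j \<circ> sgen i" using assms(1) by (simp add: fun_eq_iff o_apply)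
  fix a b assume "sroot (sgen i) a b"
  then have "(a, b) = (ra i, rb i) \<or> (a, b) = (- rb i, - ra i)" using sroot_unique[OF sroot_ra] by blast
  then show "sroot (sgen i) (sgen j a) (sgen j b)"
    using assms(2) sroot_ra[of i] sroot_neg[OF sroot_ra[of i]] by (auto simp: sgen_odd)
qed

text \<open>The edges of the Coxeter diagram. In type D the generators with indices -1 and 1 move
  the same coordinates and yet commute, since their roots are orthogonal.\<close>

lemma index_pair_cases:
  assumes "i \<in> inds ty N" "j \<in> inds ty N" "i < j"
  shows "commuting (sgen i) (sgen j) \<and> commuting (sgen j) (sgen i)
    \<or> (\<exists>a b c. braid3 (sgen i) (sgen j) a b c) \<or> i = 0 \<and> j = 1"
proof -
  have ij: "i \<ge> -1" "j \<ge> 1" "i \<noteq> 0 \<or> ty = TBC"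
    using assms by (cases ty; auto simp: inds_def)+
  consider "i \<ge> 1" "j = i + 1" | "i = 0" "j = 1" | "i = -1" "j = 1" | "i = -1" "j = 2"
    | "j \<ge> 2" "i + 1 < j" "i = - 1 \<Longrightarrow> j \<ge> 3"
  proof -
    have "i = -1 \<Longrightarrow> j \<noteq> 0" using ij by simp
    then show ?thesis using ij assms(3) that by linarith
  qed
  then show ?thesis
  proof cases
    case 1
    then have "braid3 (sgen i) (sgen j) i (i + 1) (2 + i)"
      using sroot_ra[of i] sroot_ra[of j] by (simp add: braid3_def ra_def rb_def)
    then show ?thesis by blast
  next
    case 3
    have v: "sgen (-1) 1 = -2" "sgen (-1) 2 = -1" "sgen 1 1 = 2" "sgen 1 2 = 1" "sgen 1 (-1) = -2"
      by (simp_all add: sgen_def)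
    have "sgen (-1) (sgen 1 k) = sgen 1 (sgen (-1) k)" for k by (simp add: sgen_def)
    then have "commuting (sgen i) (sgen j)" "commuting (sgen j) (sgen i)"
      using 3 v by (auto intro!: commutingI simp: ra_def rb_def)
    then show ?thesis by blast
  next
    case 4
    then have "braid3 (sgen i) (sgen j) (-1) 2 3"
      using sroot_ra[of i] sroot_ra[of j] by (simp add: braid3_def ra_def rb_def)
    then show ?thesis by blast
  next
    case 5
    note f = sgen_far_commute[OF assms(3) 5 ij(1)]
    have "commuting (sgen i) (sgen j)" "commuting (sgen j) (sgen i)"
      by (intro commutingI; simp add: f)+
    then show ?thesis by blast
  qed simp
qed

lemma gens_pair_cases:
  assumes "s \<in> gens ty N" "t \<in> gens ty N" "s \<noteq> t"
  obtains "commuting s t" "commuting t s" | a b c where "braid3 s t a b c" | a b c where "braid3 t s a b c"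
    | "s = sgen 0" "t = sgen 1" | "s = sgen 1" "t = sgen 0"
proof -
  obtain i j where ij: "s = sgen i" "t = sgen j" "i \<in> inds ty N" "j \<in> inds ty N"
    using assms by (auto simp: gens_inds)
  then consider "i < j" | "j < i" using assms(3) by fastforce
  then show ?thesis
  proof cases
    case 1 then show ?thesis using index_pair_cases[OF ij(3,4) 1] ij that by blast
  next
    case 2 then show ?thesis using index_pair_cases[OF ij(4,3) 2] ij that by blast
  qed
qed

lemma sroot_fix: "sroot s a b \<Longrightarrow> \<bar>c\<bar> \<noteq> \<bar>a\<bar> \<Longrightarrow> \<bar>c\<bar> \<noteq> \<bar>b\<bar> \<Longrightarrow> s c = c"
  unfolding sroot_rfl[of s a b] by (auto simp: rfl_def)

lemma sroot_odd: "sroot s a b \<Longrightarrow> s (- j) = - s j"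
  by (auto simp: sroot_def sgen_odd)

lemma braid3_app:
  assumes "braid3 s t a b c"
  shows "s a = b" "s b = a" "s c = c" "t a = a" "t b = c" "t c = b"
  using assms sroot_app[of s a b] sroot_app[of t b c] sroot_fix[of s a b c] sroot_fix[of t b c a]
  unfolding braid3_def by auto

lemma braid3_relation:
  assumes "braid3 s t a b c"
  shows "s \<circ> t \<circ> s = t \<circ> s \<circ> t" "s \<circ> t \<noteq> t \<circ> s"
proof -
  have r: "sroot s a b" "sroot t b c" and d: "\<bar>a\<bar> \<noteq> \<bar>b\<bar>" "\<bar>b\<bar> \<noteq> \<bar>c\<bar>" "\<bar>a\<bar> \<noteq> \<bar>c\<bar>"
    using assms by (auto simp: braid3_def)
  note app = braid3_app[OF assms] and so = sroot_odd[OF r(1)] sroot_odd[OF r(2)]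
  show "s \<circ> t \<circ> s = t \<circ> s \<circ> t"
  proof
    fix j
    consider "j = a" | "j = b" | "j = c" | "j = - a" | "j = - b" | "j = - c"
      | "\<bar>j\<bar> \<noteq> \<bar>a\<bar>" "\<bar>j\<bar> \<noteq> \<bar>b\<bar>" "\<bar>j\<bar> \<noteq> \<bar>c\<bar>"
      by linarith
    then show "(s \<circ> t \<circ> s) j = (t \<circ> s \<circ> t) j"
      by cases (simp_all add: o_apply app so sroot_fix[OF r(1)] sroot_fix[OF r(2)])
  qed
  have "(s \<circ> t) a \<noteq> (t \<circ> s) a" using d by (auto simp: o_apply app)
  then show "s \<circ> t \<noteq> t \<circ> s" by metis
qed

lemma sgen01: "sgen 0 1 = -1" "sgen 0 2 = 2" "sgen 1 1 = 2" "sgen 1 2 = 1" "sgen 0 (-1) = 1" "sgen 1 (-1) = -2" "sgen 1 (-2) = -1"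
  "sgen 0 (-2) = -2" by (simp_all add: sgen_def)

lemma braid4_relation:
  "sgen 0 \<circ> sgen 1 \<noteq> sgen 1 \<circ> sgen 0" "sgen 0 \<circ> sgen 1 \<circ> sgen 0 \<noteq> sgen 1 \<circ> sgen 0 \<circ> sgen 1"
  "sgen 0 \<circ> sgen 1 \<circ> sgen 0 \<circ> sgen 1 = sgen 1 \<circ> sgen 0 \<circ> sgen 1 \<circ> sgen 0"
proof -
  have "(sgen 0 \<circ> sgen 1) 1 \<noteq> (sgen 1 \<circ> sgen 0) 1" by (simp add: o_apply sgen01)
  then show "sgen 0 \<circ> sgen 1 \<noteq> sgen 1 \<circ> sgen 0" by metis
  have "(sgen 0 \<circ> sgen 1 \<circ> sgen 0) 1 \<noteq> (sgen 1 \<circ> sgen 0 \<circ> sgen 1) 1" by (simp add: o_apply sgen01)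
  then show "sgen 0 \<circ> sgen 1 \<circ> sgen 0 \<noteq> sgen 1 \<circ> sgen 0 \<circ> sgen 1" by metis
  show "sgen 0 \<circ> sgen 1 \<circ> sgen 0 \<circ> sgen 1 = sgen 1 \<circ> sgen 0 \<circ> sgen 1 \<circ> sgen 0"
  proof
    fix j :: int
    consider "j = 1" | "j = 2" | "j = -1" | "j = -2" | "j \<noteq> 1" "j \<noteq> 2" "j \<noteq> -1" "j \<noteq> -2" by blast
    then show "(sgen 0 \<circ> sgen 1 \<circ> sgen 0 \<circ> sgen 1) j = (sgen 1 \<circ> sgen 0 \<circ> sgen 1 \<circ> sgen 0) j"
      by cases (simp_all add: o_apply sgen01, simp add: sgen_def)
  qed
qed

lemma bw_commuting: "commuting s t \<Longrightarrow> bw s t = [s, t]" by (simp add: bw_def commuting_def)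

lemma bw_braid3: "braid3 s t a b c \<Longrightarrow> bw s t = [s, t, s] \<and> bw t s = [t, s, t]"
  using braid3_relation[of s t a b c] by (auto simp: bw_def)

lemma bw_braid4: "bw (sgen 0) (sgen 1) = [sgen 0, sgen 1, sgen 0, sgen 1]"
  "bw (sgen 1) (sgen 0) = [sgen 1, sgen 0, sgen 1, sgen 0]"
  using braid4_relation unfolding bw_def by presburger+

lemma bw_wprod:
  assumes "s \<in> gens ty N" "t \<in> gens ty N" "s \<noteq> t"
  shows "wprod (bw s t) = wprod (bw t s)"
  using assms
proof (cases rule: gens_pair_cases)
  case 1 then show ?thesis by (simp add: bw_commuting commuting_def)
next
  case (2 a b c) then show ?thesis using bw_braid3[OF 2] braid3_relation[OF 2] by (simp add: o_assoc)
next
  case (3 a b c) then show ?thesis using bw_braid3[OF 3] braid3_relation[OF 3] by (simp add: o_assoc)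
next
  case 4 then show ?thesis using bw_braid4 braid4_relation by (simp add: o_assoc)
next
  case 5 then show ?thesis using bw_braid4 braid4_relation by (simp add: o_assoc)
qed

lemma bw_length:
  assumes "s \<in> gens ty N" "t \<in> gens ty N" "s \<noteq> t"
  shows "length (bw s t) = length (bw t s)"
  using assms
proof (cases rule: gens_pair_cases)
  case 1 then show ?thesis by (simp add: bw_commuting)
next
  case (2 a b c) then show ?thesis using bw_braid3[OF 2] by simp
next
  case (3 a b c) then show ?thesis using bw_braid3[OF 3] by simp
qed (simp_all add: bw_braid4)

lemma bw_hd: "\<exists>L. bw s t = s # L" by (simp add: bw_def)

lemma bw_set: "set (bw s t) = {s, t}" by (auto simp: bw_def)

text \<open>For an odd bijection this says that \<open>g\<close> makes the simple root of
  \<open>s\<close> negative, so that \<open>s\<close> shortens \<open>g\<close> on the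
  right.\<close>

definition desc :: "perm \<Rightarrow> perm \<Rightarrow> bool" where
  "desc g s \<longleftrightarrow> (\<forall>a b. sroot s a b \<longrightarrow> g b < g a)"

lemma desc_iff: "oddbij g \<Longrightarrow> sroot s a b \<Longrightarrow> desc g s \<longleftrightarrow> g b < g a"
proof
  assume g: "oddbij g" and r: "sroot s a b" and l: "g b < g a"
  show "desc g s" unfolding desc_def
  proof (intro allI impI)
    fix c d assume "sroot s c d"
    from sroot_unique[OF r this] show "g d < g c" using l by (auto simp: oddbij_odd[OF g])
  qed
qed (simp add: desc_def)

lemma not_desc_iff: "oddbij g \<Longrightarrow> sroot s a b \<Longrightarrow> \<not> desc g s \<longleftrightarrow> g a < g b"
  using desc_iff oddbij_inj[of g a b] sroot_less[of s a b] by force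

text \<open>With \<open>g\<close> the inverse of \<open>w\<close>: the letters of the list can be
  stripped from the left of \<open>w\<close> one after the other, each lowering the length.\<close>

primrec chain :: "perm \<Rightarrow> perm list \<Rightarrow> bool" where
  "chain g [] = True"
| "chain g (s # L) = (desc g s \<and> chain (g \<circ> s) L)"

text \<open>The rank-two case of the theory: if both generators are descents, the longest element of
  the dihedral group they generate splits off. It is verified by following the values of
  \<open>g\<close> on the two or three coordinates involved.\<close>

lemma chain_bw:
  assumes st: "s \<in> gens ty N" "t \<in> gens ty N" "s \<noteq> t" and g: "oddbij g" and d: "desc g s" "desc g t"
  shows "chain g (bw s t)"
proof -
  have os: "oddbij s" "oddbij t" using st gens_oddbij by auto
  have gs: "oddbij (g \<circ> s)" "oddbij (g \<circ> s \<circ> t)" "oddbij (g \<circ> s \<circ> t \<circ> s)"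
    using oddbij_comp g os by auto
  show ?thesis using st
  proof (cases rule: gens_pair_cases)
    case 1
    have "desc (g \<circ> s) t" using 1(2) d(2) by (auto simp: desc_def commuting_def o_apply)
    then show ?thesis using bw_commuting[OF 1(1)] d by simp
  next
    case (2 a b c)
    have r: "sroot s a b" "sroot t b c" using 2 by (auto simp: braid3_def)
    have "g b < g a" "g c < g b" using d r by (auto simp: desc_def)
    then have "desc (g \<circ> s) t" "desc (g \<circ> s \<circ> t) s"
      using desc_iff[OF gs(1) r(2)] desc_iff[OF gs(2) r(1)] braid3_app[OF 2] by (auto simp: o_apply)
    then show ?thesis using bw_braid3[OF 2] d by simp
  next
    case (3 a b c)
    have r: "sroot t a b" "sroot s b c" using 3 by (auto simp: braid3_def)
    have "g b < g a" "g c < g b" using d r by (auto simp: desc_def)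
    then have "desc (g \<circ> s) t" "desc (g \<circ> s \<circ> t) s"
      using desc_iff[OF gs(1) r(1)] desc_iff[OF gs(2) r(2)] braid3_app[OF 3] by (auto simp: o_apply)
    then show ?thesis using bw_braid3[OF 3] d by simp
  next
    case 4
    have r: "sroot s (-1) 1" "sroot t 1 2" using sroot_ra[of 0] sroot_ra[of 1] 4 by (simp_all add: ra_def rb_def)
    note od = oddbij_odd[OF g]
    have "g 1 < g (-1)" "g 2 < g 1" using d r by (auto simp: desc_def)
    then have "desc (g \<circ> s) t" "desc (g \<circ> s \<circ> t) s" "desc (g \<circ> s \<circ> t \<circ> s) t"
      using desc_iff[OF gs(1) r(2)] desc_iff[OF gs(2) r(1)] desc_iff[OF gs(3) r(2)] od[of 1] od[of 2]
      by (auto simp: o_apply 4 sgen01)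
    then show ?thesis using bw_braid4 d unfolding 4 by simp
  next
    case 5
    have r: "sroot t (-1) 1" "sroot s 1 2" using sroot_ra[of 0] sroot_ra[of 1] 5 by (simp_all add: ra_def rb_def)
    note od = oddbij_odd[OF g]
    have "g 1 < g (-1)" "g 2 < g 1" using d r by (auto simp: desc_def)
    then have "desc (g \<circ> s) t" "desc (g \<circ> s \<circ> t) s" "desc (g \<circ> s \<circ> t \<circ> s) t"
      using desc_iff[OF gs(1) r(1)] desc_iff[OF gs(2) r(2)] desc_iff[OF gs(3) r(1)] od[of 1] od[of 2]
      by (auto simp: o_apply 5 sgen01)
    then show ?thesis using bw_braid4 d unfolding 5 by simp
  qed
qed

lemma inv_comp_gen:
  assumes "s \<in> gens t N" "oddbij w"
  shows "inv (s \<circ> w) = inv w \<circ> s"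
proof -
  have "inv (s \<circ> w) = inv w \<circ> inv s"
    using gens_oddbij[OF assms(1)] assms(2) by (simp add: oddbij_def o_inv_distrib)
  also have "inv s = s" using assms(1) by (intro inv_unique_comp) (simp_all add: gens_inv)
  finally show ?thesis .
qed

lemma left_desc:
  assumes w: "w \<in> Wgrp t N" and N: "N \<ge> 2" and s: "s \<in> gens t N"
  shows "desc (inv w) s \<Longrightarrow> len t N w = Suc (len t N (s \<circ> w))"
    and "\<not> desc (inv w) s \<Longrightarrow> len t N (s \<circ> w) = Suc (len t N w)"
proof -
  obtain a b where r: "sroot s a b" using gens_sroot[OF s] by blast
  have o: "oddbij (inv w)" using Wgrp_oddbij[OF Wgrp_inv[OF w N] N] .
  show "desc (inv w) s \<Longrightarrow> len t N w = Suc (len t N (s \<circ> w))"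
    using left_descent(1)[OF w N s r] desc_iff[OF o r] by simp
  show "\<not> desc (inv w) s \<Longrightarrow> len t N (s \<circ> w) = Suc (len t N w)"
    using left_descent(2)[OF w N s r] not_desc_iff[OF o r] by simp
qed

lemma red_Cons_iff:
  assumes w: "w \<in> Wgrp t N" and N: "N \<ge> 2" and s: "s \<in> gens t N" and d: "desc (inv w) s"
  shows "is_red t N (s # r) w \<longleftrightarrow> is_red t N r (s \<circ> w)"
proof -
  have "s \<circ> wprod r = w \<longleftrightarrow> wprod r = s \<circ> w"
    using s by (metis comp_assoc gens_inv id_comp)
  then show ?thesis using left_desc(1)[OF w N s d] s by (auto simp: is_red_def is_word_def)
qed

lemma red_Cons_desc:
  assumes "is_red t N (s # r) w" and N: "N \<ge> 2"
  shows "w \<in> Wgrp t N" "s \<in> gens t N" "desc (inv w) s"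
proof -
  show w: "w \<in> Wgrp t N" using assms wprod_Wgrp[of "s # r" t N] by (auto simp: is_red_def is_word_def)
  show s: "s \<in> gens t N" using assms by (auto simp: is_red_def is_word_def)
  show "desc (inv w) s"
  proof (rule ccontr)
    assume "\<not> desc (inv w) s"
    then have "len t N (s \<circ> w) = Suc (len t N w)" using left_desc(2)[OF w N s] by simp
    moreover have "is_word t N r (s \<circ> w)"
    proof -
      have "s \<circ> (s \<circ> wprod r) = wprod r" using s by (metis comp_assoc gens_inv id_comp)
      then show ?thesis using assms(1) by (auto simp: is_red_def is_word_def)
    qed
    ultimately show False using len_le[of t N r "s \<circ> w"] assms(1) by (simp add: is_red_def)
  qed
qed

text \<open>Together with \<open>chain_bw\<close> this gives, for an element with left descents
  \<open>s\<close> and \<open>t\<close>, a reduced word that begins with the braid word.\<close>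

lemma chain_red:
  assumes "w \<in> Wgrp t N" "N \<ge> 2" "set L \<subseteq> gens t N" "chain (inv w) L"
  shows "\<exists>r. is_red t N (L @ r) w"
  using assms
proof (induction L arbitrary: w)
  case Nil then show ?case using red_exists by auto
next
  case (Cons s L)
  have s: "s \<in> gens t N" using Cons.prems by simp
  have "inv (s \<circ> w) = inv w \<circ> s"
    using inv_comp_gen[OF s] Wgrp_oddbij Cons.prems by blast
  then obtain r where "is_red t N (L @ r) (s \<circ> w)"
    using Cons.IH[of "s \<circ> w"] Cons.prems Wgrp_comp[OF gens_Wgrp[OF s]] by auto
  then show ?case using red_Cons_iff[OF Cons.prems(1,2) s] Cons.prems by auto
qed

section \<open>Matsumoto's theorem, stated for operators along words\<close>

primrec opw :: "(perm \<Rightarrow> vec \<Rightarrow> vec) \<Rightarrow> perm list \<Rightarrow> vec \<Rightarrow> vec" where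
  "opw T [] m = m"
| "opw T (s # ws) m = T s (opw T ws m)"

lemma foldr_opw: "List.foldr T ws m = opw T ws m"
  by (induction ws) (simp_all add: id_apply o_apply)

lemma opw_append: "opw T (us @ ws) m = opw T us (opw T ws m)"
  by (induction us) simp_all

lemma opw_V:
  assumes "\<And>s m. s \<in> S \<Longrightarrow> m \<in> V X \<Longrightarrow> T s m \<in> V X" "set ws \<subseteq> S" "m \<in> V X"
  shows "opw T ws m \<in> V X"
  using assms(2) by (induction ws) (auto simp: assms)

text \<open>Reduced words with the same first letter are compared after deleting it. If the first
  letters differ, both are descents, and the two words are joined through reduced words that begin
  with the two braid words and continue identically; deleting first letters again leaves shorter
  words.\<close>

lemma matsumoto:
  assumes N: "N \<ge> 2"
    and TV: "\<And>s m. s \<in> gens t N \<Longrightarrow> m \<in> V X \<Longrightarrow> T s m \<in> V X"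
    and br: "\<And>s s' m. s \<in> gens t N \<Longrightarrow> s' \<in> gens t N \<Longrightarrow> s \<noteq> s' \<Longrightarrow> m \<in> V X
      \<Longrightarrow> opw T (bw s s') m = opw T (bw s' s) m"
    and "is_red t N us w" "is_red t N vs w" "m \<in> V X"
  shows "opw T us m = opw T vs m"
  using assms(4,5)
proof (induction "len t N w" arbitrary: us vs w rule: less_induct)
  case less
  show ?case
  proof (cases us)
    case Nil
    then have "vs = []" using less.prems by (auto simp: is_red_def)
    then show ?thesis using Nil by simp
  next
    case (Cons s u)
    then obtain s' v where v: "vs = s' # v" using less.prems by (cases vs) (auto simp: is_red_def)
    note ds = red_Cons_desc[OF less.prems(1)[unfolded Cons] N]
    note ds' = red_Cons_desc[OF less.prems(2)[unfolded v] N]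
    have ru: "is_red t N u (s \<circ> w)" using red_Cons_iff[OF ds(1) N ds(2,3)] less.prems Cons by simp
    have rv: "is_red t N v (s' \<circ> w)" using red_Cons_iff[OF ds(1) N ds'(2,3)] less.prems v by simp
    have lt: "len t N (s \<circ> w) < len t N w" using left_desc(1)[OF ds(1) N ds(2,3)] by simp
    have lt': "len t N (s' \<circ> w) < len t N w" using left_desc(1)[OF ds(1) N ds'(2,3)] by simp
    show ?thesis
    proof (cases "s = s'")
      case True
      then show ?thesis using less.hyps[OF lt ru] rv Cons v by simp
    next
      case False
      have o: "oddbij (inv w)" using Wgrp_oddbij[OF Wgrp_inv[OF ds(1) N] N] .
      obtain r where r: "is_red t N (bw s s' @ r) w"
        using chain_red[OF ds(1) N _ chain_bw[OF ds(2) ds'(2) False o ds(3) ds'(3)]] bw_set ds(2) ds'(2) by auto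
      have r': "is_red t N (bw s' s @ r) w"
        using r bw_wprod[OF ds(2) ds'(2) False] bw_length[OF ds(2) ds'(2) False]
        by (auto simp: is_red_def is_word_def bw_set)
      obtain L L' where L: "bw s s' = s # L" "bw s' s = s' # L'" using bw_hd by meson
      have "is_red t N (L @ r) (s \<circ> w)" using r red_Cons_iff[OF ds(1) N ds(2,3)] L by simp
      then have 1: "opw T u m = opw T (L @ r) m" using less.hyps[OF lt ru] by blast
      have "is_red t N (L' @ r) (s' \<circ> w)" using r' red_Cons_iff[OF ds(1) N ds'(2,3)] L by simp
      then have 2: "opw T v m = opw T (L' @ r) m" using less.hyps[OF lt' rv] by blast
      have rV: "opw T r m \<in> V X"
        using r by (intro opw_V[of "gens t N"] TV assms(6)) (auto simp: is_red_def is_word_def)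
      have "opw T us m = opw T (bw s s') (opw T r m)" using 1 L Cons by (simp add: opw_append)
      also have "\<dots> = opw T (bw s' s) (opw T r m)" using br[OF ds(2) ds'(2) False rV] .
      also have "\<dots> = opw T vs m" using 2 L v by (simp add: opw_append)
      finally show ?thesis .
    qed
  qed
qed

section \<open>Representations of the Hecke algebra\<close>

text \<open>The braid relation is kept apart because the quadratic relation alone provides inverses
  and the propagation of braid relations along orbits, which is how \<open>hecke_rep\<close> is
  later established.\<close>

locale hecke_pre =
  fixes t :: ctype and N :: nat and X :: "perm set" and T :: "perm \<Rightarrow> vec \<Rightarrow> vec"
  assumes N2: "N \<ge> 2" and finX: "finite X"
    and linT: "s \<in> gens t N \<Longrightarrow> lin X X (T s)"
    and quad: "s \<in> gens t N \<Longrightarrow> m \<in> V X \<Longrightarrow> T s (T s m) = m + msmult lq (T s m)"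
begin

lemma T_V [simp]: "s \<in> gens t N \<Longrightarrow> m \<in> V X \<Longrightarrow> T s m \<in> V X"
  using slin_V[OF linT] by blast

lemma T_add: "s \<in> gens t N \<Longrightarrow> a \<in> V X \<Longrightarrow> b \<in> V X \<Longrightarrow> T s (a + b) = T s a + T s b"
  using slin_add[OF linT] by blast

lemma T_msmult: "s \<in> gens t N \<Longrightarrow> a \<in> V X \<Longrightarrow> T s (msmult p a) = msmult p (T s a)"
  using slin_msmult[OF linT] by (simp add: id_apply)

lemma T_shift: "s \<in> gens t N \<Longrightarrow> a \<in> V X \<Longrightarrow> b \<in> V X \<Longrightarrow> T s (a + msmult p b) = T s a + msmult p (T s b)"
  by (simp add: T_add T_msmult V_msmult)

definition braid_at :: "perm \<Rightarrow> perm \<Rightarrow> vec \<Rightarrow> bool" where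
  "braid_at s s' m \<longleftrightarrow> opw T (bw s s') m = opw T (bw s' s) m"

lemma braid_at_sym: "braid_at s s' m \<Longrightarrow> braid_at s' s m" by (simp add: braid_at_def)

text \<open>Thanks to this step a braid relation has to be checked only at one basis element of each orbit.\<close>

lemma braid_at_step:
  assumes s: "s \<in> gens t N" "s' \<in> gens t N" and m: "m \<in> V X" and b: "braid_at s s' m"
  shows "braid_at s s' (T s m)"
proof -
  have q: "T s (T s m) = m + msmult lq (T s m)" using quad s m by blast
  consider "bw s s' = [s, s']" "bw s' s = [s', s]" | "bw s s' = [s, s', s]" "bw s' s = [s', s, s']"
    | "bw s s' = [s, s', s, s']" "bw s' s = [s', s, s', s]"
    unfolding bw_def by (cases "s \<circ> s' = s' \<circ> s"; cases "s \<circ> s' \<circ> s = s' \<circ> s \<circ> s'") auto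
  then show ?thesis
  proof cases
    case 1
    then have e: "T s (T s' m) = T s' (T s m)" using b by (simp add: braid_at_def)
    have "T s (T s' (T s m)) = T s (T s (T s' m))" using e by simp
    also have "\<dots> = T s' m + msmult lq (T s (T s' m))" using quad s m by simp
    also have "\<dots> = T s' (T s (T s m))" using q e s m by (simp add: T_shift)
    finally show ?thesis using 1 by (simp add: braid_at_def)
  next
    case 2
    then have e: "T s (T s' (T s m)) = T s' (T s (T s' m))" using b by (simp add: braid_at_def)
    have "T s (T s' (T s (T s m))) = T s (T s' m) + msmult lq (T s (T s' (T s m)))"
      using q s m by (simp add: T_shift)
    also have "\<dots> = T s' (T s' (T s (T s' m)))" using quad[of s' "T s (T s' m)"] e s m by simp
    also have "\<dots> = T s' (T s (T s' (T s m)))" using e by simp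
    finally show ?thesis using 2 by (simp add: braid_at_def)
  next
    case 3
    then have e: "T s (T s' (T s (T s' m))) = T s' (T s (T s' (T s m)))" using b by (simp add: braid_at_def)
    have "T s (T s' (T s (T s' (T s m)))) = T s (T s (T s' (T s (T s' m))))" using e by simp
    also have "\<dots> = T s' (T s (T s' m)) + msmult lq (T s (T s' (T s (T s' m))))" using quad s m by simp
    also have "\<dots> = T s' (T s (T s' (T s (T s m))))" using q e s m by (simp add: T_shift)
    finally show ?thesis using 3 by (simp add: braid_at_def)
  qed
qed

lemma opw_T_V [simp]: "set ws \<subseteq> gens t N \<Longrightarrow> m \<in> V X \<Longrightarrow> opw T ws m \<in> V X"
  by (rule opw_V[of "gens t N"]) auto

lemma opw_lin: "set ws \<subseteq> gens t N \<Longrightarrow> lin X X (opw T ws)"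
proof (induction ws)
  case Nil then show ?case by (simp add: slin_def id_apply)
next
  case (Cons s ws)
  then have "lin X X (opw T ws)" "lin X X (T s)" using linT by auto
  from slin_comp[OF this] show ?case by (simp add: slin_def id_apply o_apply)
qed

lemma braid_at_all:
  assumes s: "s \<in> gens t N" "s' \<in> gens t N"
    and b: "\<And>z. z \<in> X \<Longrightarrow> braid_at s s' (delta z)" and m: "m \<in> V X"
  shows "opw T (bw s s') m = opw T (bw s' s) m"
proof (rule slin_eqI[OF finX opw_lin opw_lin _ m])
  show "set (bw s s') \<subseteq> gens t N" "set (bw s' s) \<subseteq> gens t N" using s by (auto simp: bw_set)
qed (use b in \<open>simp add: braid_at_def\<close>)

text \<open>The inverse operator: the quadratic relation reads
  \<open>T (T - lq) = 1\<close>.\<close>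

definition Tinv :: "perm \<Rightarrow> vec \<Rightarrow> vec" where "Tinv s m = T s m - msmult lq m"

lemma Tinv_V [simp]: "s \<in> gens t N \<Longrightarrow> m \<in> V X \<Longrightarrow> Tinv s m \<in> V X"
  unfolding Tinv_def by (intro V_diff T_V V_msmult)

lemma Tinv_T [simp]: "s \<in> gens t N \<Longrightarrow> m \<in> V X \<Longrightarrow> Tinv s (T s m) = m"
  by (simp add: Tinv_def quad)

lemma T_Tinv [simp]: "s \<in> gens t N \<Longrightarrow> m \<in> V X \<Longrightarrow> T s (Tinv s m) = m"
  unfolding Tinv_def using slin_diff[OF linT, of s "T s m" "msmult lq m"]
  by (simp add: quad T_msmult V_msmult)

lemma Tinv_lin: "s \<in> gens t N \<Longrightarrow> lin X X (Tinv s)"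
  unfolding slin_def
  by (auto simp: Tinv_def T_add T_msmult id_apply fun_eq_iff vec_apply algebra_simps intro!: V_diff V_msmult)

lemma opw_Tinv_V [simp]: "set ws \<subseteq> gens t N \<Longrightarrow> m \<in> V X \<Longrightarrow> opw Tinv ws m \<in> V X"
  by (rule opw_V[of "gens t N"]) auto

lemma opw_Tinv_lin: "set ws \<subseteq> gens t N \<Longrightarrow> lin X X (opw Tinv ws)"
proof (induction ws)
  case Nil then show ?case by (simp add: slin_def id_apply)
next
  case (Cons s ws)
  then have "lin X X (opw Tinv ws)" "lin X X (Tinv s)" using Tinv_lin by auto
  from slin_comp[OF this] show ?case by (simp add: slin_def id_apply o_apply)
qed

lemma opw_rev_Tinv: "set ws \<subseteq> gens t N \<Longrightarrow> m \<in> V X \<Longrightarrow> opw T (rev ws) (opw Tinv ws m) = m"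
  by (induction ws) (simp_all add: opw_append)

lemma opw_Tinv_rev: "set ws \<subseteq> gens t N \<Longrightarrow> m \<in> V X \<Longrightarrow> opw Tinv ws (opw T (rev ws) m) = m"
proof (induction ws arbitrary: m)
  case (Cons s ws)
  then have "opw Tinv ws (opw T (rev ws) (T s m)) = T s m" by simp
  then show ?case using Cons by (simp add: opw_append)
qed simp

end

locale hecke_rep = hecke_pre +
  assumes braid: "s \<in> gens t N \<Longrightarrow> s' \<in> gens t N \<Longrightarrow> s \<noteq> s' \<Longrightarrow> m \<in> V X
    \<Longrightarrow> opw T (bw s s') m = opw T (bw s' s) m"
begin

lemma opw_red:
  "is_red t N us w \<Longrightarrow> is_red t N vs w \<Longrightarrow> m \<in> V X \<Longrightarrow> opw T us m = opw T vs m"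
  using matsumoto[OF N2, where T = T and X = X] T_V braid by blast

text \<open>The operator of the inverses along \<open>us\<close> is the inverse of
  \<open>opw T (rev us)\<close>, and reversed words are reduced words of \<open>inv w\<close>.
  Independence is thus inherited, without braid relations for the inverses.\<close>

lemma opw_Tinv_red:
  assumes r: "is_red t N us w" "is_red t N vs w" and m: "m \<in> V X"
  shows "opw Tinv us m = opw Tinv vs m"
proof -
  have g: "set us \<subseteq> gens t N" "set vs \<subseteq> gens t N" using r by (auto simp: is_red_def is_word_def)
  have w: "w \<in> Wgrp t N" using r(1) wprod_Wgrp N2 by (auto simp: is_red_def is_word_def)
  have rr: "is_red t N (rev us) (inv w)" "is_red t N (rev vs) (inv w)"
    using r inv_wprod[OF g(1)] inv_wprod[OF g(2)] len_inv[OF w N2] by (auto simp: is_red_def is_word_def)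
  have "opw Tinv us m = opw Tinv us (opw T (rev vs) (opw Tinv vs m))"
    using opw_rev_Tinv[OF g(2) m] by simp
  also have "opw T (rev vs) (opw Tinv vs m) = opw T (rev us) (opw Tinv vs m)"
    using opw_red[OF rr(2,1)] g m by simp
  also have "opw Tinv us (opw T (rev us) (opw Tinv vs m)) = opw Tinv vs m"
    using opw_Tinv_rev[OF g(1)] g m by simp
  finally show ?thesis .
qed

definition Tw :: "perm \<Rightarrow> vec \<Rightarrow> vec" where "Tw w m = opw T (redword t N w) m"

lemma redword_gens: "w \<in> Wgrp t N \<Longrightarrow> set (redword t N w) \<subseteq> gens t N"
  using redword_red[OF _ N2] by (auto simp: is_red_def is_word_def)

lemma Tw_lin: "w \<in> Wgrp t N \<Longrightarrow> lin X X (Tw w)"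
  using opw_lin[OF redword_gens] by (simp add: Tw_def[abs_def])

lemma Tw_V [simp]: "w \<in> Wgrp t N \<Longrightarrow> m \<in> V X \<Longrightarrow> Tw w m \<in> V X"
  using slin_V[OF Tw_lin] by blast

lemma Tw_red: "is_red t N ws w \<Longrightarrow> m \<in> V X \<Longrightarrow> opw T ws m = Tw w m"
proof -
  assume r: "is_red t N ws w" and m: "m \<in> V X"
  have "w \<in> Wgrp t N" using r wprod_Wgrp N2 by (auto simp: is_red_def is_word_def)
  then show ?thesis unfolding Tw_def using opw_red[OF r redword_red[OF _ N2] m] by blast
qed

lemma Tw_id: "m \<in> V X \<Longrightarrow> Tw id m = m"
proof -
  assume m: "m \<in> V X"
  have "is_word t N [] id" by (simp add: is_word_def)
  then have "is_red t N [] id" using len_le[of t N "[]" id] by (simp add: is_red_def)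
  from Tw_red[OF this m] show ?thesis by simp
qed

lemma Tw_up:
  assumes w: "w \<in> Wgrp t N" and s: "s \<in> gens t N" and m: "m \<in> V X"
    and l: "len t N (s \<circ> w) = Suc (len t N w)"
  shows "T s (Tw w m) = Tw (s \<circ> w) m"
proof -
  have "is_red t N (s # redword t N w) (s \<circ> w)"
    using redword_red[OF w N2] s l by (auto simp: is_red_def is_word_def)
  from Tw_red[OF this m] show ?thesis by (simp add: Tw_def)
qed

lemma Tw_down:
  assumes w: "w \<in> Wgrp t N" and s: "s \<in> gens t N" and m: "m \<in> V X"
    and l: "len t N w = Suc (len t N (s \<circ> w))"
  shows "T s (Tw w m) = Tw (s \<circ> w) m + msmult lq (Tw w m)"
proof -
  have sw: "s \<circ> w \<in> Wgrp t N" using Wgrp_comp[OF gens_Wgrp[OF s N2] w N2] .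
  have ssw: "s \<circ> (s \<circ> w) = w" using s by (metis comp_assoc gens_inv id_comp)
  have "T s (Tw (s \<circ> w) m) = Tw w m" using Tw_up[OF sw s m] l ssw by simp
  then show ?thesis using quad[OF s, of "Tw (s \<circ> w) m"] sw m by simp
qed

definition act :: "vec \<Rightarrow> vec \<Rightarrow> vec" where
  "act h m = (\<Sum>w\<in>Wgrp t N. msmult (h w) (Tw w m))"

lemma act_lext: "act h m = lext id (Wgrp t N) (\<lambda>w. Tw w m) h"
  by (simp add: act_def lext_def id_apply)

lemma act_lin: "m \<in> V X \<Longrightarrow> lin (Wgrp t N) X (\<lambda>h. act h m)"
  unfolding act_lext by (rule slin_lext[OF ring_map_id]) simp

lemma act_delta: "w \<in> Wgrp t N \<Longrightarrow> act (delta w) m = Tw w m"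
  unfolding act_lext using lext_delta[OF ring_map_id finite_Wgrp[OF N2]] by blast

end

section \<open>The Hecke algebra\<close>

lemma HsHw_V: "w \<in> Wgrp t N \<Longrightarrow> s \<in> gens t N \<Longrightarrow> N \<ge> 2 \<Longrightarrow> HsHw t N s w \<in> V (Wgrp t N)"
proof -
  assume w: "w \<in> Wgrp t N" and s: "s \<in> gens t N" and N: "N \<ge> 2"
  have "s \<circ> w \<in> Wgrp t N" using Wgrp_comp[OF gens_Wgrp[OF s N] w N] .
  then show ?thesis using w by (auto simp: HsHw_def V_def delta_def)
qed

lemma Hs_H_lext: "Hs_H t N s = lext id (Wgrp t N) (HsHw t N s)"
  by (intro ext) (simp add: Hs_H_def lext_def vec_apply id_apply)

lemma Hs_H_up:
  assumes "w \<in> Wgrp t N" "s \<in> gens t N" "N \<ge> 2" "len t N (s \<circ> w) = Suc (len t N w)"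
  shows "Hs_H t N s (delta w) = delta (s \<circ> w)"
  unfolding Hs_H_lext lext_delta[OF ring_map_id finite_Wgrp[OF assms(3)] assms(1)]
  using assms(4) by (simp add: HsHw_def)

lemma Hs_H_down:
  assumes "w \<in> Wgrp t N" "s \<in> gens t N" "N \<ge> 2" "len t N w = Suc (len t N (s \<circ> w))"
  shows "Hs_H t N s (delta w) = delta (s \<circ> w) + msmult lq (delta w)"
  unfolding Hs_H_lext lext_delta[OF ring_map_id finite_Wgrp[OF assms(3)] assms(1)]
  using assms(4) by (intro ext) (simp add: HsHw_def vec_apply)

lemma uminus_oddbij: "oddbij g \<Longrightarrow> oddbij (\<lambda>i. - g i)"
proof -
  assume g: "oddbij g"
  have "bij ((\<lambda>i. - i) \<circ> g)" using g by (intro bij_comp) (auto simp: oddbij_def bij_uminus)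
  then show ?thesis using g by (simp add: oddbij_def comp_def)
qed

lemma hecke_pre_regular: "N \<ge> 2 \<Longrightarrow> hecke_pre t N (Wgrp t N) (Hs_H t N)"
proof
  fix s assume N: "N \<ge> 2" and s: "s \<in> gens t N"
  show lin: "lin (Wgrp t N) (Wgrp t N) (Hs_H t N s)"
    unfolding Hs_H_lext using HsHw_V[OF _ s N] by (intro slin_lext[OF ring_map_id])
  let ?T = "Hs_H t N s"
  fix m assume m: "m \<in> V (Wgrp t N)"
  have l2: "lin (Wgrp t N) (Wgrp t N) (\<lambda>m. ?T (?T m))" using slin_comp[OF lin lin] by simp
  have l3: "lin (Wgrp t N) (Wgrp t N) (\<lambda>m. m + msmult lq (?T m))"
    unfolding slin_def using lin
    by (auto simp: slin_add[OF lin] slin_msmult[OF lin] slin_V[OF lin] id_apply fun_eq_iff vec_apply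
        algebra_simps intro!: V_add V_msmult)
  show "?T (?T m) = m + msmult lq (?T m)"
  proof (rule slin_eqI[OF finite_Wgrp[OF N] l2 l3 _ m])
    fix w assume w: "w \<in> Wgrp t N"
    have sw: "s \<circ> w \<in> Wgrp t N" using Wgrp_comp[OF gens_Wgrp[OF s N] w N] .
    have ssw: "s \<circ> (s \<circ> w) = w" using s by (metis comp_assoc gens_inv id_comp)
    show "?T (?T (delta w)) = delta w + msmult lq (?T (delta w))"
    proof (cases "desc (inv w) s")
      case True
      note l = left_desc(1)[OF w N s True]
      have "?T (?T (delta w)) = ?T (delta (s \<circ> w)) + msmult lq (?T (delta w))"
        using slin_add[OF lin] slin_msmult[OF lin] sw w
        by (simp add: Hs_H_down[OF w s N l] V_delta V_msmult id_apply)
      then show ?thesis using Hs_H_up[OF sw s N] l ssw by simp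
    next
      case False
      note l = left_desc(2)[OF w N s False]
      show ?thesis using Hs_H_up[OF w s N l] Hs_H_down[OF sw s N] l ssw by simp
    qed
  qed
qed (use finite_Wgrp in auto)

text \<open>Negating \<open>inv w\<close> exchanges descents and ascents, so every letter of the
  chain lengthens the element. The list is reversed because the last letter of a word acts
  first.\<close>

lemma regular_chain_up:
  assumes "set L \<subseteq> gens t N" "w \<in> Wgrp t N" "N \<ge> 2" "chain (\<lambda>i. - inv w i) L"
  shows "opw (Hs_H t N) (rev L) (delta w) = delta (wprod (rev L) \<circ> w)"
  using assms
proof (induction L arbitrary: w)
  case (Cons s L)
  have s: "s \<in> gens t N" using Cons.prems by simp
  have o: "oddbij (inv w)" using Wgrp_oddbij[OF Wgrp_inv] Cons.prems by blast
  obtain a b where r: "sroot s a b" using gens_sroot[OF s] by blast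
  have "\<not> desc (inv w) s"
    using Cons.prems(4) r not_desc_iff[OF o r] by (auto simp: desc_def)
  note l = left_desc(2)[OF Cons.prems(2,3) s this]
  have sw: "s \<circ> w \<in> Wgrp t N" using Wgrp_comp[OF gens_Wgrp[OF s] Cons.prems(2)] Cons.prems by blast
  have "inv (s \<circ> w) = inv w \<circ> s" using inv_comp_gen[OF s] Wgrp_oddbij Cons.prems by blast
  then have "chain (\<lambda>i. - inv (s \<circ> w) i) L" using Cons.prems(4) by (simp add: comp_def)
  then show ?case
    using Cons.IH[OF _ sw] Cons.prems Hs_H_up[OF Cons.prems(2) s Cons.prems(3) l]
    by (simp add: opw_append comp_assoc)
qed simp

text \<open>Induction on the length: if one of the two generators is a left descent of
  \<open>w\<close>, the braid relation at \<open>delta w\<close> follows from that at a shorter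
  element by \<open>braid_at_step\<close>. If neither is, both braid words only lengthen
  \<open>w\<close> and give the same basis element.\<close>

lemma hecke_rep_regular:
  assumes N: "N \<ge> 2"
  shows "hecke_rep t N (Wgrp t N) (Hs_H t N)"
proof -
  interpret R: hecke_pre t N "Wgrp t N" "Hs_H t N" by (rule hecke_pre_regular[OF N])
  have at: "R.braid_at s s' (delta w)"
    if s: "s \<in> gens t N" "s' \<in> gens t N" "s \<noteq> s'" and w: "w \<in> Wgrp t N" for s s' w
    using w
  proof (induction "len t N w" arbitrary: w rule: less_induct)
    case less
    have step: "R.braid_at u u' (delta w)"
      if u: "u \<in> gens t N" "u' \<in> gens t N" and d: "desc (inv w) u" and IH: "R.braid_at u u' (delta (u \<circ> w))" for u u'
    proof -
      note l = left_desc(1)[OF less.prems N u(1) d]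
      have uw: "u \<circ> w \<in> Wgrp t N" using Wgrp_comp[OF gens_Wgrp[OF u(1) N] less.prems N] .
      have uuw: "u \<circ> (u \<circ> w) = w" using u by (metis comp_assoc gens_inv id_comp)
      have "Hs_H t N u (delta (u \<circ> w)) = delta w" using Hs_H_up[OF uw u(1) N] l uuw by simp
      then show ?thesis using R.braid_at_step[OF u V_delta[OF uw] IH] by simp
    qed
    show ?case
    proof (cases "desc (inv w) s \<or> desc (inv w) s'")
      case True
      then show ?thesis
      proof
        assume d: "desc (inv w) s"
        have "R.braid_at s s' (delta (s \<circ> w))"
          using less.hyps[of "s \<circ> w"] left_desc(1)[OF less.prems N s(1) d]
            Wgrp_comp[OF gens_Wgrp[OF s(1) N] less.prems N] by simp
        then show ?thesis using step[OF s(1,2) d] by blast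
      next
        assume d: "desc (inv w) s'"
        have "R.braid_at s s' (delta (s' \<circ> w))"
          using less.hyps[of "s' \<circ> w"] left_desc(1)[OF less.prems N s(2) d]
            Wgrp_comp[OF gens_Wgrp[OF s(2) N] less.prems N] by simp
        then show ?thesis using step[OF s(2,1) d] R.braid_at_sym by blast
      qed
    next
      case False
      let ?g = "\<lambda>i. - inv w i"
      have o: "oddbij (inv w)" using Wgrp_oddbij[OF Wgrp_inv[OF less.prems N] N] .
      have d: "desc ?g u" if u: "u \<in> {s, s'}" for u
      proof -
        have "u \<in> gens t N" using u s by auto
        then obtain a b where r: "sroot u a b" using gens_sroot by blast
        show ?thesis using desc_iff[OF uminus_oddbij[OF o] r] not_desc_iff[OF o r] False u by auto
      qed
      have c: "chain ?g (bw s s')" "chain ?g (bw s' s)"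
        using chain_bw[OF s uminus_oddbij[OF o]] chain_bw[OF s(2,1) not_sym[OF s(3)] uminus_oddbij[OF o]] d by auto
      have set: "set (bw s s') \<subseteq> gens t N" "set (bw s' s) \<subseteq> gens t N" using s by (auto simp: bw_set)
      have 1: "opw (Hs_H t N) (rev L) (delta w) = delta (wprod (rev L) \<circ> w)" if "L \<in> {bw s s', bw s' s}" for L
        using regular_chain_up[OF _ less.prems N] c set that by auto
      \<comment> \<open>Braid words of odd length are palindromes; those of even length are
        exchanged by reversal.\<close>
      have "rev (bw s s') = bw s s' \<and> rev (bw s' s) = bw s' s \<or> rev (bw s s') = bw s' s \<and> rev (bw s' s) = bw s s'"
        by (auto simp: bw_def)
      then show ?thesis using 1[of "bw s s'"] 1[of "bw s' s"] bw_wprod[OF s]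
        by (auto simp: R.braid_at_def)
    qed
  qed
  show ?thesis
    by unfold_locales (use R.braid_at_all at in blast)
qed

locale hecke_alg =
  fixes t :: ctype and N :: nat
  assumes N2: "N \<ge> 2"

sublocale hecke_alg \<subseteq> R: hecke_rep t N "Wgrp t N" "Hs_H t N"
  by (rule hecke_rep_regular[OF N2])

context hecke_alg
begin

lemma Hone_V: "Hone \<in> V (Wgrp t N)" by (simp add: Hone_def V_delta id_Wgrp)

lemma regular_red: "is_red t N ws w \<Longrightarrow> opw (Hs_H t N) ws Hone = delta w"
proof (induction ws arbitrary: w)
  case Nil then show ?case by (simp add: is_red_def is_word_def Hone_def)
next
  case (Cons s ws)
  note d = red_Cons_desc[OF Cons.prems N2]
  have r: "is_red t N ws (s \<circ> w)" using red_Cons_iff[OF d(1) N2 d(2,3)] Cons.prems by simp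
  have sw: "s \<circ> w \<in> Wgrp t N" using Wgrp_comp[OF gens_Wgrp[OF d(2) N2] d(1) N2] .
  have "s \<circ> (s \<circ> w) = w" using d(2) by (metis comp_assoc gens_inv id_comp)
  then show ?case using Cons.IH[OF r] Hs_H_up[OF sw d(2) N2] left_desc(1)[OF d(1) N2 d(2,3)] by simp
qed

lemma Hbasis_delta: "w \<in> Wgrp t N \<Longrightarrow> Hbasis t N w = delta w"
  unfolding Hbasis_def foldr_opw using regular_red[OF redword_red[OF _ N2]] by blast

lemma Hmul_act: "Hmul t N h1 h2 = R.act h1 h2"
  by (intro ext) (simp add: Hmul_def R.act_def R.Tw_def foldr_opw vec_apply)

text \<open>The bar image of \<open>H_w\<close>: the inverse of \<open>H\<close> at
  \<open>inv w\<close> is the product of the inverse generators along a reduced word of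
  \<open>w\<close>, in the same order.\<close>

definition Hu :: "perm \<Rightarrow> vec" where "Hu w = opw R.Tinv (redword t N w) Hone"

lemma Hu_V: "w \<in> Wgrp t N \<Longrightarrow> Hu w \<in> V (Wgrp t N)"
  unfolding Hu_def using R.redword_gens Hone_V by simp

end

section \<open>Modules over the Hecke algebra and the action of bar images\<close>

locale hecke_module = hecke_alg + M: hecke_rep t N X T for X T
begin

text \<open>Multiplicativity is needed only for left multiplication by a generator; on a basis
  element the two cases of the product rule are those of \<open>Tw_up\<close> and
  \<open>Tw_down\<close>.\<close>

lemma act_Hs: 
  assumes s: "s \<in> gens t N" and h: "h \<in> V (Wgrp t N)" and m: "m \<in> V X"
  shows "M.act (Hs_H t N s h) m = T s (M.act h m)"
proof (rule slin_eqI[OF finite_Wgrp[OF N2] _ _ _ h, where \<sigma> = id and Y = X and Z = X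
      and F = "\<lambda>h. M.act (Hs_H t N s h) m" and G = "\<lambda>h. T s (M.act h m)"])
  show "lin (Wgrp t N) X (\<lambda>h. M.act (Hs_H t N s h) m)"
    using slin_comp[OF R.linT[OF s] M.act_lin[OF m]] by simp
  show "lin (Wgrp t N) X (\<lambda>h. T s (M.act h m))"
    using slin_comp[OF M.act_lin[OF m] M.linT[OF s]] by simp
  fix w assume w: "w \<in> Wgrp t N"
  have sw: "s \<circ> w \<in> Wgrp t N" using Wgrp_comp[OF gens_Wgrp[OF s N2] w N2] .
  show "M.act (Hs_H t N s (delta w)) m = T s (M.act (delta w) m)"
  proof (cases "desc (inv w) s")
    case True
    note l = left_desc(1)[OF w N2 s True]
    have "M.act (delta (s \<circ> w) + msmult lq (delta w)) m = M.Tw (s \<circ> w) m + msmult lq (M.Tw w m)"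
      using slin_add[OF M.act_lin[OF m]] slin_msmult[OF M.act_lin[OF m]] w sw
      by (simp add: V_delta V_msmult id_apply M.act_delta)
    then show ?thesis using Hs_H_down[OF w s N2 l] M.Tw_down[OF w s m l] w by (simp add: M.act_delta)
  next
    case False
    note l = left_desc(2)[OF w N2 s False]
    show ?thesis using Hs_H_up[OF w s N2 l] M.Tw_up[OF w s m l] w sw by (simp add: M.act_delta)
  qed
qed

lemma act_Hsinv:
  assumes s: "s \<in> gens t N" and h: "h \<in> V (Wgrp t N)" and m: "m \<in> V X"
  shows "M.act (R.Tinv s h) m = M.Tinv s (M.act h m)"
proof -
  have "M.act (Hs_H t N s h - msmult lq h) m = M.act (Hs_H t N s h) m - M.act (msmult lq h) m"
    by (rule slin_diff[OF M.act_lin[OF m] R.T_V[OF s h] V_msmult[OF h]])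
  then show ?thesis
    unfolding R.Tinv_def M.Tinv_def by (simp only: act_Hs[OF s h m] slin_msmult[OF M.act_lin[OF m] h] id_apply)
qed

lemma act_Hone: "m \<in> V X \<Longrightarrow> M.act Hone m = m"
  unfolding Hone_def using M.act_delta[OF id_Wgrp] M.Tw_id by simp

lemma act_opw_inv:
  "set ws \<subseteq> gens t N \<Longrightarrow> h \<in> V (Wgrp t N) \<Longrightarrow> m \<in> V X \<Longrightarrow> M.act (opw R.Tinv ws h) m = opw M.Tinv ws (M.act h m)"
  by (induction ws) (simp_all add: act_Hsinv)

lemma act_Hu: "w \<in> Wgrp t N \<Longrightarrow> m \<in> V X \<Longrightarrow> M.act (Hu w) m = opw M.Tinv (redword t N w) m"
  unfolding Hu_def using act_opw_inv[OF R.redword_gens Hone_V] act_Hone by simp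

end

context hecke_alg
begin

text \<open>The algebra as a module over itself, so that \<open>act_Hu\<close> also computes
  products \<open>Hu w\<close> times \<open>h\<close>.\<close>

interpretation RR: hecke_module t N "Wgrp t N" "Hs_H t N"
  by unfold_locales

text \<open>The description in \<open>Hinv\<close> needs exactly one two-sided inverse. Uniqueness
  comes from the right-inverse equation alone: left multiplication by \<open>H\<close> at
  \<open>inv w\<close> is the invertible operator along a reversed reduced word.\<close>

lemma Hinv_Hbasis:
  assumes w: "w \<in> Wgrp t N"
  shows "Hinv t N (Hbasis t N (inv w)) = Hu w"
proof -
  let ?ws = "redword t N w"
  have iw: "inv w \<in> Wgrp t N" using Wgrp_inv[OF w N2] .
  have g: "set ?ws \<subseteq> gens t N" using R.redword_gens[OF w] .
  have r: "is_red t N ?ws w" using redword_red[OF w N2] .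
  have rr: "is_red t N (rev ?ws) (inv w)"
    using r inv_wprod[OF g] len_inv[OF w N2] by (auto simp: is_red_def is_word_def)
  have left: "Hmul t N (delta (inv w)) h = opw (Hs_H t N) (rev ?ws) h" if "h \<in> V (Wgrp t N)" for h
    using R.act_delta[OF iw] R.Tw_red[OF rr that] by (simp add: Hmul_act)
  have 1: "Hmul t N (delta (inv w)) (Hu w) = Hone"
    using left[OF Hu_V[OF w]] R.opw_rev_Tinv[OF g Hone_V] by (simp add: Hu_def)
  have dV: "delta (inv w) \<in> V (Wgrp t N)" using iw by (rule V_delta)
  have "Hmul t N (Hu w) (delta (inv w)) = opw R.Tinv ?ws (delta (inv w))"
    using RR.act_Hu[OF w dV] by (simp add: Hmul_act)
  also have "\<dots> = opw R.Tinv ?ws (opw (Hs_H t N) (rev ?ws) Hone)"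
    using regular_red[OF rr] by simp
  also have "\<dots> = Hone" using R.opw_Tinv_rev[OF g Hone_V] .
  finally have 2: "Hmul t N (Hu w) (delta (inv w)) = Hone" .
  have "h = Hu w" if h: "h \<in> V (Wgrp t N)" "Hmul t N (delta (inv w)) h = Hone" for h
    using R.opw_Tinv_rev[OF g h(1)] left[OF h(1)] h(2) by (simp add: Hu_def)
  then show ?thesis
    unfolding Hinv_def Hbasis_delta[OF iw] Hset_V using 1 2 Hu_V[OF w]
    by (intro the_equality conjI) (assumption+, blast)
qed

lemma Hbar_Hu: "Hbar t N h = (\<Sum>w\<in>Wgrp t N. msmult (lbar (h w)) (Hu w))"
  unfolding Hbar_def using Hinv_Hbasis by (intro ext) (simp add: vec_apply)

end

context hecke_module
begin

lemma act_Hbar: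
  assumes m: "m \<in> V X"
  shows "M.act (Hbar t N h) m = (\<Sum>w\<in>Wgrp t N. msmult (lbar (h w)) (opw M.Tinv (redword t N w) m))"
proof -
  have "M.act (Hbar t N h) m = (\<Sum>w\<in>Wgrp t N. M.act (msmult (lbar (h w)) (Hu w)) m)"
    unfolding Hbar_Hu by (rule slin_sum[OF M.act_lin[OF m]]) (use Hu_V in blast)
  also have "\<dots> = (\<Sum>w\<in>Wgrp t N. msmult (lbar (h w)) (opw M.Tinv (redword t N w) m))"
    using slin_msmult[OF M.act_lin[OF m] Hu_V] act_Hu[OF _ m]
    by (intro sum.cong refl) (simp add: id_apply)
  finally show ?thesis .
qed

lemma bar_opw:
  assumes "slin lbar X X \<phi>" "\<And>s m. s \<in> gens t N \<Longrightarrow> m \<in> V X \<Longrightarrow> \<phi> (T s m) = M.Tinv s (\<phi> m)"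
    and "set ws \<subseteq> gens t N" "m \<in> V X"
  shows "\<phi> (opw T ws m) = opw M.Tinv ws (\<phi> m)"
  using assms(3) by (induction ws) (simp_all add: assms)

lemma bar_act:
  assumes \<phi>: "slin lbar X X \<phi>" "\<And>s m. s \<in> gens t N \<Longrightarrow> m \<in> V X \<Longrightarrow> \<phi> (T s m) = M.Tinv s (\<phi> m)"
    and m: "m \<in> V X"
  shows "\<phi> (M.act h m) = M.act (Hbar t N h) (\<phi> m)"
proof -
  have "\<phi> (M.act h m) = (\<Sum>w\<in>Wgrp t N. \<phi> (msmult (h w) (M.Tw w m)))"
    unfolding M.act_def by (rule slin_sum[OF \<phi>(1)]) (use m in \<open>simp add: V_msmult\<close>)
  also have "\<dots> = (\<Sum>w\<in>Wgrp t N. msmult (lbar (h w)) (opw M.Tinv (redword t N w) (\<phi> m)))"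
    using m slin_msmult[OF \<phi>(1) M.Tw_V] bar_opw[OF \<phi> M.redword_gens m]
    by (intro sum.cong refl) (simp add: M.Tw_def)
  also have "\<dots> = M.act (Hbar t N h) (\<phi> m)" using act_Hbar[OF slin_V[OF \<phi>(1) m]] by simp
  finally show ?thesis .
qed

lemma gen_red: "s \<in> gens t N \<Longrightarrow> is_red t N [s] s"
proof -
  assume s: "s \<in> gens t N"
  have w: "is_word t N [s] s" using s by (simp add: is_word_def)
  obtain a b where r: "sroot s a b" using gens_sroot[OF s] by blast
  have "s \<noteq> id" using sroot_app(1)[OF r] sroot_less[OF r] by (auto simp: id_apply)
  moreover obtain us where us: "is_red t N us s" using red_exists[OF gens_Wgrp[OF s N2] N2] by blast
  ultimately have "len t N s \<noteq> 0" by (auto simp: is_red_def is_word_def)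
  then show ?thesis using len_le[OF w] w by (simp add: is_red_def)
qed

lemma act_gen: "s \<in> gens t N \<Longrightarrow> m \<in> V X \<Longrightarrow> M.act (delta s) m = T s m"
  using M.act_delta[OF gens_Wgrp[OF _ N2]] M.Tw_red[OF gen_red] by fastforce

lemma act_Hbar_gen: 
  assumes s: "s \<in> gens t N" and m: "m \<in> V X"
  shows "M.act (Hbar t N (delta s)) m = M.Tinv s m"
proof -
  have sW: "s \<in> Wgrp t N" using gens_Wgrp[OF s N2] .
  have "Hbar t N (delta s) = lext lbar (Wgrp t N) Hu (delta s)" by (simp add: Hbar_Hu lext_def)
  also have "\<dots> = Hu s" using lext_delta[OF ring_map_lbar finite_Wgrp[OF N2] sW] .
  finally show ?thesis
    using act_Hu[OF sW m] M.opw_Tinv_red[OF redword_red[OF sW N2] gen_red[OF s] m] by simp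
qed

end

section \<open>Fixed-point-free involutions and their Hecke module\<close>

text \<open>The condition \<open>z i < - i\<close> counts each pair i < j with z i = -j once. Its
  parity is invariant under conjugation in type D, and requiring it to be even leaves a single
  minimal element.\<close>

definition FX :: "ctype \<Rightarrow> nat \<Rightarrow> perm set" where
  "FX t N = {z \<in> Wgrp t N. z \<circ> z = id \<and> (\<forall>i\<in>{1..int N}. \<bar>z i\<bar> \<noteq> i)
     \<and> (t = TD \<longrightarrow> even (card {i\<in>{1..int N}. z i < - i}))}"

lemma FX_Wgrp: "z \<in> FX t N \<Longrightarrow> z \<in> Wgrp t N" by (simp add: FX_def)

lemma FX_zz [simp]: "z \<in> FX t N \<Longrightarrow> z (z i) = i"
  unfolding FX_def by (metis (mono_tags, lifting) mem_Collect_eq o_apply id_apply)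

lemma FX_inv: "z \<in> FX t N \<Longrightarrow> inv z = z"
  by (intro inv_unique_comp) (simp_all add: FX_def)

lemma finite_FX: "N \<ge> 2 \<Longrightarrow> finite (FX t N)"
  using finite_Wgrp[of N t] by (simp add: FX_def)

lemma FX_odd: "z \<in> FX t N \<Longrightarrow> N \<ge> 2 \<Longrightarrow> z (- i) = - z i"
  using Wgrp_oddbij[of z t N] by (simp add: FX_def oddbij_odd)

lemma FX_oddbij: "z \<in> FX t N \<Longrightarrow> N \<ge> 2 \<Longrightarrow> oddbij z"
  using Wgrp_oddbij[of z t N] by (simp add: FX_def)

lemma FX_fpf: 
  assumes "z \<in> FX t N" "N \<ge> 2" "i \<in> supp_set N"
  shows "\<bar>z i\<bar> \<noteq> \<bar>i\<bar>"
proof -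
  have "\<bar>z \<bar>i\<bar>\<bar> \<noteq> \<bar>i\<bar>" using assms by (auto simp: FX_def supp_set_def)
  then show ?thesis using FX_odd[OF assms(1,2), of i] by (auto simp: abs_if split: if_splits)
qed

lemma FX_supp: "z \<in> FX t N \<Longrightarrow> N \<ge> 2 \<Longrightarrow> z i \<in> supp_set N \<longleftrightarrow> i \<in> supp_set N"
  using W_BC_supp Wgrp_W_BC FX_Wgrp by metis

lemma gens_root_supp:
  assumes "s \<in> gens t N" "N \<ge> 2" "sroot s a b"
  shows "a \<in> supp_set N" "b \<in> supp_set N"
proof -
  obtain i where i: "s = sgen i" "i \<in> inds t N" using assms by (auto simp: gens_inds)
  have "ra i \<in> supp_set N" "rb i \<in> supp_set N"
    using i(2) assms(2) by (cases t; auto simp: inds_def ra_def rb_def supp_set_def)+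
  moreover have "(a, b) = (ra i, rb i) \<or> (a, b) = (- rb i, - ra i)"
    using sroot_unique[OF sroot_ra] assms i by blast
  ultimately show "a \<in> supp_set N" "b \<in> supp_set N" by auto
qed

lemma rfl_sym: "a \<noteq> b \<Longrightarrow> rfl b a = rfl a b"
  by (intro ext) (simp add: rfl_def)

text \<open>Commuting gives \<open>s (z a) = z b\<close>. If \<open>z a\<close> were none of the
  coordinates moved by \<open>s\<close>, this would force \<open>z a = z b\<close>; the values
  \<open>a\<close> and \<open>- a\<close> are excluded by fixed-point freeness. Conversely
  \<open>z\<close> preserves the root up to sign.\<close>

lemma commutes_iff:
  assumes z: "z \<in> FX t N" and N: "N \<ge> 2" and s: "s \<in> gens t N" and r: "sroot s a b"
  shows "s \<circ> z = z \<circ> s \<longleftrightarrow> z a = b \<or> z a = - b"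
proof
  assume c: "s \<circ> z = z \<circ> s"
  have "s (z a) = z b" using fun_cong[OF c, of a] sroot_app[OF r] by (simp add: o_apply)
  moreover have "z a \<noteq> z b" using oddbij_inj[OF FX_oddbij[OF z N]] sroot_less[OF r] by auto
  ultimately have "\<not> (\<bar>z a\<bar> \<noteq> \<bar>a\<bar> \<and> \<bar>z a\<bar> \<noteq> \<bar>b\<bar>)" using sroot_fix[OF r, of "z a"] by auto
  then have "\<bar>z a\<bar> = \<bar>b\<bar>" using FX_fpf[OF z N gens_root_supp(1)[OF s N r]] by auto
  then show "z a = b \<or> z a = - b" by linarith
next
  assume "z a = b \<or> z a = - b"
  then have "z a = b \<and> z b = a \<or> z a = - b \<and> z b = - a"
  proof
    assume h: "z a = b" then have "z b = a" using FX_zz[OF z, of a] by simp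
    then show ?thesis using h by simp
  next
    assume h: "z a = - b"
    then have "z (- b) = a" using FX_zz[OF z, of a] by simp
    then show ?thesis using h FX_odd[OF z N, of b] by simp
  qed
  then have "rfl (z a) (z b) = s"
    using sroot_rfl[OF r] rfl_sym[of a b] rfl_neg[of a b] sroot_nz[OF r] sroot_less[OF r] by auto
  then show "s \<circ> z = z \<circ> s" using oddbij_rfl[OF FX_oddbij[OF z N], of a b] sroot_rfl[OF r] by simp
qed

lemma gen_mono_image:
  assumes z: "z \<in> FX t N" and N: "N \<ge> 2" and s: "s \<in> gens t N" and r: "sroot s a b"
    and "z p < z q" "p \<noteq> 0" "q \<noteq> 0" "p \<noteq> - q" "(z p, z q) \<noteq> (a, b)" "(z p, z q) \<noteq> (- b, - a)"
  shows "s (z p) < s (z q)"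
proof (rule gens_mono_pair[OF s r assms(5)])
  note o = FX_oddbij[OF z N]
  show "z p \<noteq> 0" "z q \<noteq> 0" using oddbij_eq_0[OF o] assms by auto
  show "z p \<noteq> - z q" using oddbij_inj[OF o, of p "- q"] oddbij_odd[OF o, of q] assms by auto
qed (use assms in auto)

text \<open>Since \<open>s\<close> and \<open>z\<close> do not commute, the pair of
  \<open>z k\<close> and \<open>- k\<close> is not the root of \<open>s\<close> in either order, so
  \<open>s\<close> preserves its order.\<close>

lemma neg_condition_conj:
  assumes z: "z \<in> FX t N" and N: "N \<ge> 2" and s: "s \<in> gens t N" and nc: "s \<circ> z \<noteq> z \<circ> s"
    and k: "k \<in> supp_set N"
  shows "s (z k) < - s k \<longleftrightarrow> z k < - k"
proof -
  obtain a b where r: "sroot s a b" using gens_sroot[OF s] by blast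
  have nr: "z a \<noteq> b" "z a \<noteq> - b" using nc commutes_iff[OF z N s r] by auto
  have f: "\<bar>z k\<bar> \<noteq> \<bar>k\<bar>" using FX_fpf[OF z N k] .
  have k0: "k \<noteq> 0" "z k \<noteq> 0" using k FX_supp[OF z N, of k] by (auto simp: supp_set_def)
  note od = FX_odd[OF z N]
  have i1: "(z k, - k) \<noteq> (a, b)" "(z k, - k) \<noteq> (- b, - a)" "(- k, z k) \<noteq> (a, b)" "(- k, z k) \<noteq> (- b, - a)"
    using nr od[of k] od[of b] od[of a] FX_zz[OF z, of k] FX_zz[OF z, of a] by auto
  have ok: "s (- k) = - s k" using sroot_odd[OF r] .
  have "z k < - k \<Longrightarrow> s (z k) < s (- k)"
    using k0 f i1 by (intro gens_mono_pair[OF s r]) auto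
  moreover have "- k < z k \<Longrightarrow> s (- k) < s (z k)"
    using k0 f i1 by (intro gens_mono_pair[OF s r]) auto
  ultimately show ?thesis using ok f by fastforce
qed

text \<open>Generators with positive index move the counted positions around. For
  \<open>sgen (-1)\<close> not commuting with \<open>z\<close>, 1 and 2 lie in different pairs, and
  conjugation changes the sign of both pairs.\<close>

lemma conj_parity:
  assumes z: "z \<in> FX TD N" and N: "N \<ge> 2" and s: "s \<in> gens TD N"
  shows "even (card {i\<in>{1..int N}. (s \<circ> z \<circ> s) i < - i})"
proof (cases "s \<circ> z = z \<circ> s")
  case True
  then have "s \<circ> z \<circ> s = z" using s by (simp add: comp_assoc gens_inv)
  then show ?thesis using z by (simp add: FX_def)
next
  case nc: False
  let ?neg = "\<lambda>z::perm. {j\<in>{1..int N}. z j < - j}"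
  have ev: "even (card (?neg z))" using z by (simp add: FX_def)
  obtain i where i: "s = sgen i" "i \<in> inds TD N" using s by (auto simp: gens_inds)
  note nk = neg_condition_conj[OF z N s nc]
  show ?thesis
  proof (cases "i > 0")
    case True
    have rng: "sgen i j \<in> {1..int N} \<longleftrightarrow> j \<in> {1..int N}" for j
      using True i by (auto simp: sgen_def inds_def)
    have iff: "(s \<circ> z \<circ> s) j < - j \<longleftrightarrow> z (s j) < - s j" if "j \<in> {1..int N}" for j
      using nk[of "s j"] rng[of j] that by (auto simp: o_apply i supp_set_def)
    have "?neg (s \<circ> z \<circ> s) = s ` ?neg z"
    proof
      show "?neg (s \<circ> z \<circ> s) \<subseteq> s ` ?neg z"
      proof
        fix j assume "j \<in> ?neg (s \<circ> z \<circ> s)"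
        then have "s j \<in> ?neg z" using iff rng[of j] i by auto
        then show "j \<in> s ` ?neg z" by (metis imageI i(1) sgen_sgen)
      qed
      show "s ` ?neg z \<subseteq> ?neg (s \<circ> z \<circ> s)"
      proof
        fix j assume "j \<in> s ` ?neg z"
        then obtain k where k: "j = s k" "k \<in> ?neg z" by blast
        then have "j \<in> {1..int N}" "s j = k" using rng[of k] i by auto
        then show "j \<in> ?neg (s \<circ> z \<circ> s)" using iff[of j] k by auto
      qed
    qed
    then show ?thesis using ev i by (simp add: card_image inj_on_def)
  next
    case False
    then have i1: "i = -1" using i by (auto simp: inds_def)
    have r: "sroot s (-1) 2" using sroot_ra[of i] i1 i by (simp add: ra_def rb_def)
    have v: "s 1 = -2" "s 2 = -1" "j \<ge> 3 \<Longrightarrow> s j = j" for j using i i1 by (simp_all add: sgen_def)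
    note od = FX_odd[OF z N]
    have "z (-1) \<noteq> 2" "z (-1) \<noteq> - 2" using nc commutes_iff[OF z N s r] by auto
    then have z12: "z 1 \<noteq> -2" "z 1 \<noteq> 2" using od[of 1] by auto
    then have z2: "z 2 \<noteq> 1" "z 2 \<noteq> - 1"
      using FX_zz[OF z, of 2] od[of 1] by auto
    have a: "\<bar>z 1\<bar> \<noteq> 1" "\<bar>z 2\<bar> \<noteq> 2" using FX_fpf[OF z N, of 1] FX_fpf[OF z N, of 2] N by (auto simp: supp_set_def)
    have nz: "z 1 \<noteq> 0" "z 2 \<noteq> 0" using oddbij_eq_0[OF FX_oddbij[OF z N]] by auto
    have big: "\<bar>z 1\<bar> \<ge> 3" "\<bar>z 2\<bar> \<ge> 3" using a nz z12 z2 by linarith+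
    have fix': "s j = j" if "\<bar>j\<bar> \<ge> 3" for j using that sroot_fix[OF r, of j] by simp
    have split: "{1..int N} = {1} \<union> {2} \<union> {3..int N}" using N by auto
    have c: "card (?neg u) = (if u 1 < -1 then 1 else 0) + (if u 2 < -2 then 1 else 0) + card {j\<in>{3..int N}. u j < - j}"
      for u :: perm
    proof -
      have e: "?neg u = ((if u 1 < -1 then {1} else {}) \<union> (if u 2 < -2 then {2} else {})) \<union> {j\<in>{3..int N}. u j < - j}"
        unfolding split by auto
      have "finite {j\<in>{3..int N}. u j < - j}"
        by (rule finite_subset[of _ "{3..int N}"]) auto
      then show ?thesis unfolding e by (subst card_Un_disjoint) auto
    qed
    have v12: "(s \<circ> z \<circ> s) 1 = - z 2" "(s \<circ> z \<circ> s) 2 = - z 1"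
      using od[of 1] od[of 2] fix'[of "- z 1"] fix'[of "- z 2"] big by (simp_all add: o_apply v)
    have sw: "(s \<circ> z \<circ> s) 1 < -1 \<longleftrightarrow> \<not> z 2 < -2" "(s \<circ> z \<circ> s) 2 < -2 \<longleftrightarrow> \<not> z 1 < -1"
      unfolding v12 using big by linarith+
    have e3: "{j\<in>{3..int N}. (s \<circ> z \<circ> s) j < - j} = {j\<in>{3..int N}. z j < - j}"
    proof -
      have "(s \<circ> z \<circ> s) j < - j \<longleftrightarrow> z j < - j" if "j \<in> {3..int N}" for j
        using nk[of j] v(3)[of j] that by (auto simp: o_apply supp_set_def)
      then show ?thesis by auto
    qed
    show ?thesis using ev unfolding c[of z] c[of "s \<circ> z \<circ> s"] sw e3
      by (cases "z 1 < -1"; cases "z 2 < -2") simp_all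
  qed
qed

lemma conj_FX:
  assumes z: "z \<in> FX t N" and N: "N \<ge> 2" and s: "s \<in> gens t N"
  shows "s \<circ> z \<circ> s \<in> FX t N"
proof -
  have W: "s \<circ> z \<circ> s \<in> Wgrp t N"
    using Wgrp_comp[OF Wgrp_comp[OF gens_Wgrp[OF s N] FX_Wgrp[OF z] N] gens_Wgrp[OF s N] N] .
  have inv: "(s \<circ> z \<circ> s) \<circ> (s \<circ> z \<circ> s) = id"
    using z s by (simp add: fun_eq_iff o_apply id_apply)
  have fpf: "\<bar>(s \<circ> z \<circ> s) i\<bar> \<noteq> i" if i: "i \<in> {1..int N}" for i
  proof
    assume "\<bar>(s \<circ> z \<circ> s) i\<bar> = i"
    then have "s (z (s i)) = i \<or> s (z (s i)) = - i" by (auto simp: o_apply)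
    then have "z (s i) = s i \<or> z (s i) = s (- i)" using s by (metis gens_inv_app)
    then have "\<bar>z (s i)\<bar> = \<bar>s i\<bar>" using oddbij_odd[OF gens_oddbij[OF s], of i] by auto
    moreover have "s i \<in> supp_set N"
      using W_BC_supp[OF Wgrp_W_BC[OF gens_Wgrp[OF s N] N], of i] i by (auto simp: supp_set_def)
    ultimately show False using FX_fpf[OF z N] by blast
  qed
  show ?thesis unfolding FX_def using W inv fpf conj_parity[of z N s] z N s by auto
qed

section \<open>The conjugation module and its quadratic relation\<close>

definition Tb :: "ctype \<Rightarrow> nat \<Rightarrow> lpoly \<Rightarrow> perm \<Rightarrow> perm \<Rightarrow> vec" where
  "Tb t N \<alpha> s z = (if s \<circ> z = z \<circ> s then msmult \<alpha> (delta z)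
     else if desc z s then delta (s \<circ> z \<circ> s) + msmult lq (delta z) else delta (s \<circ> z \<circ> s))"

definition TB :: "ctype \<Rightarrow> nat \<Rightarrow> lpoly \<Rightarrow> perm \<Rightarrow> vec \<Rightarrow> vec" where
  "TB t N \<alpha> s = lext id (FX t N) (Tb t N \<alpha> s)"

text \<open>Both x and -x^-1 qualify. The first clause is the quadratic relation for a scalar, the
  second makes the bar invert it.\<close>

definition hecke_root :: "lpoly \<Rightarrow> bool" where
  "hecke_root \<alpha> \<longleftrightarrow> \<alpha> * \<alpha> = 1 + lq * \<alpha> \<and> lbar \<alpha> * \<alpha> = 1"

lemma TB_delta: "z \<in> FX t N \<Longrightarrow> N \<ge> 2 \<Longrightarrow> TB t N \<alpha> s (delta z) = Tb t N \<alpha> s z"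
  unfolding TB_def using lext_delta[OF ring_map_id finite_FX] by blast

lemma TB_lin: "N \<ge> 2 \<Longrightarrow> s \<in> gens t N \<Longrightarrow> lin (FX t N) (FX t N) (TB t N \<alpha> s)"
  unfolding TB_def
  by (rule slin_lext[OF ring_map_id]) (auto simp: Tb_def conj_FX intro!: V_add V_msmult V_delta)

lemma conj_conj: "s \<in> gens t N \<Longrightarrow> s \<circ> (s \<circ> z \<circ> s) \<circ> s = z"
  by (simp add: fun_eq_iff o_apply)

lemma conj_commutes_iff: "s \<in> gens t N \<Longrightarrow> s \<circ> (s \<circ> z \<circ> s) = (s \<circ> z \<circ> s) \<circ> s \<longleftrightarrow> s \<circ> z = z \<circ> s"
proof -
  assume s: "s \<in> gens t N"
  have "s \<circ> (s \<circ> z \<circ> s) = z \<circ> s" "(s \<circ> z \<circ> s) \<circ> s = s \<circ> z"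
    using s by (simp_all add: fun_eq_iff o_apply)
  then show ?thesis by auto
qed

text \<open>Without commutation the image of the root of \<open>s\<close> under \<open>z\<close> is
  not that root up to sign, so \<open>s\<close> keeps its order. The root of \<open>sgen 0\<close>
  is treated apart: there \<open>s\<close> simply fixes both images.\<close>

lemma conj_mono:
  assumes z: "z \<in> FX t N" and N: "N \<ge> 2" and s: "s \<in> gens t N" and r: "sroot s a b"
    and nc: "s \<circ> z \<noteq> z \<circ> s" and pq: "(p, q) \<in> {(a, b), (b, a)}" and lt: "z p < z q"
  shows "s (z p) < s (z q)"
proof (cases "a = - b")
  case True
  obtain i where i: "s = sgen i" "i \<in> inds t N" using s by (auto simp: gens_inds)
  have "(a, b) = (ra i, rb i) \<or> (a, b) = (- rb i, - ra i)" using sroot_unique[OF sroot_ra] r i by blast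
  then have ab: "a = -1" "b = 1" using True by (auto simp: ra_def rb_def split: if_splits)
  have z1: "z (- 1) = - z 1" using FX_odd[OF z N, of 1] by simp
  have "\<bar>z 1\<bar> \<noteq> 1" using FX_fpf[OF z N, of 1] N by (auto simp: supp_set_def)
  then have "s (z 1) = z 1" "s (z (-1)) = z (-1)"
    using sroot_fix[OF r, of "z 1"] sroot_fix[OF r, of "z (-1)"] ab z1 by auto
  then show ?thesis using lt ab pq by auto
next
  case False
  have nr: "z a \<noteq> b" "z a \<noteq> - b" using nc commutes_iff[OF z N s r] by auto
  have "z b \<noteq> a" "z b \<noteq> - b" "z a \<noteq> - a" "z a \<noteq> a"
    using nr FX_zz[OF z, of b] FX_fpf[OF z N gens_root_supp(1)[OF s N r]]
      FX_fpf[OF z N gens_root_supp(2)[OF s N r]] by auto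
  then show ?thesis
    using nr False sroot_nz[OF r] pq by (intro gen_mono_image[OF z N s r lt]) auto
qed

text \<open>The factor on the right lengthens \<open>z\<close> because \<open>s\<close> is an
  ascent, and by \<open>conj_mono\<close> the factor on the left lengthens the result again.\<close>

lemma conj_desc:
  assumes z: "z \<in> FX t N" and N: "N \<ge> 2" and s: "s \<in> gens t N" and nc: "s \<circ> z \<noteq> z \<circ> s" and nd: "\<not> desc z s"
  shows "desc (s \<circ> z \<circ> s) s" "len t N (s \<circ> z \<circ> s) = len t N z + 2"
proof -
  obtain a b where r: "sroot s a b" using gens_sroot[OF s] by blast
  have lt: "z a < z b" using not_desc_iff[OF FX_oddbij[OF z N] r] nd by simp
  have m: "s (z a) < s (z b)" using conj_mono[OF z N s r nc _ lt] by simp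
  have "(s \<circ> z \<circ> s) b < (s \<circ> z \<circ> s) a" using m sroot_app[OF r] by (simp add: o_apply)
  then show "desc (s \<circ> z \<circ> s) s" using desc_iff[OF FX_oddbij[OF conj_FX[OF z N s] N] r] by simp
  have zs: "z \<circ> s \<in> Wgrp t N" using Wgrp_comp[OF FX_Wgrp[OF z] gens_Wgrp[OF s N] N] .
  have "inv (z \<circ> s) = s \<circ> z"
    using z s by (intro inv_unique_comp) (simp_all add: fun_eq_iff o_apply id_apply)
  then have "len t N (s \<circ> (z \<circ> s)) = Suc (len t N (z \<circ> s))"
    using left_descent(2)[OF zs N s r] m by (simp add: o_apply)
  then show "len t N (s \<circ> z \<circ> s) = len t N z + 2"
    using right_descent(2)[OF FX_Wgrp[OF z] N s r lt] by (simp add: comp_assoc)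
qed

lemma conj_nodesc:
  assumes z: "z \<in> FX t N" and N: "N \<ge> 2" and s: "s \<in> gens t N" and nc: "s \<circ> z \<noteq> z \<circ> s" and d: "desc z s"
  shows "\<not> desc (s \<circ> z \<circ> s) s" "len t N z = len t N (s \<circ> z \<circ> s) + 2"
proof -
  let ?y = "s \<circ> z \<circ> s"
  have y: "?y \<in> FX t N" using conj_FX[OF z N s] .
  obtain a b where r: "sroot s a b" using gens_sroot[OF s] by blast
  have lt: "z b < z a" using d r by (simp add: desc_def)
  have "s (z b) < s (z a)" using conj_mono[OF z N s r nc _ lt] by simp
  then have "?y a < ?y b" using sroot_app[OF r] by (simp add: o_apply)
  then show nd: "\<not> desc ?y s" using not_desc_iff[OF FX_oddbij[OF y N] r] by simp
  have "s \<circ> ?y \<noteq> ?y \<circ> s" using nc conj_commutes_iff[OF s] by simp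
  from conj_desc(2)[OF y N s this nd] show "len t N z = len t N ?y + 2"
    using conj_conj[OF s, of z] by simp
qed

lemma TB_eq:
  assumes "z \<in> FX t N" "N \<ge> 2" "s \<circ> z = z \<circ> s"
  shows "TB t N \<alpha> s (delta z) = msmult \<alpha> (delta z)"
  using TB_delta[OF assms(1,2)] assms(3) by (simp add: Tb_def)

lemma TB_up:
  assumes "z \<in> FX t N" "N \<ge> 2" "s \<circ> z \<noteq> z \<circ> s" "\<not> desc z s"
  shows "TB t N \<alpha> s (delta z) = delta (s \<circ> z \<circ> s)"
  using TB_delta[OF assms(1,2)] assms(3,4) by (simp add: Tb_def)

lemma TB_down:
  assumes "z \<in> FX t N" "N \<ge> 2" "s \<circ> z \<noteq> z \<circ> s" "desc z s"
  shows "TB t N \<alpha> s (delta z) = delta (s \<circ> z \<circ> s) + msmult lq (delta z)"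
  using TB_delta[OF assms(1,2)] assms(3,4) by (simp add: Tb_def)

lemma hecke_pre_FX:
  assumes N: "N \<ge> 2" and \<alpha>: "hecke_root \<alpha>"
  shows "hecke_pre t N (FX t N) (TB t N \<alpha>)"
proof
  show "N \<ge> 2" "finite (FX t N)" using N finite_FX by auto
  fix s assume s: "s \<in> gens t N"
  show lin: "lin (FX t N) (FX t N) (TB t N \<alpha> s)" using TB_lin[OF N s] .
  let ?T = "TB t N \<alpha> s"
  fix m assume m: "m \<in> V (FX t N)"
  have l2: "lin (FX t N) (FX t N) (\<lambda>m. ?T (?T m))" using slin_comp[OF lin lin] by simp
  have l3: "lin (FX t N) (FX t N) (\<lambda>m. m + msmult lq (?T m))"
    unfolding slin_def using lin
    by (auto simp: slin_add[OF lin] slin_msmult[OF lin] slin_V[OF lin] id_apply fun_eq_iff vec_apply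
        algebra_simps intro!: V_add V_msmult)
  show "?T (?T m) = m + msmult lq (?T m)"
  proof (rule slin_eqI[OF finite_FX[OF N] l2 l3 _ m])
    fix z assume z: "z \<in> FX t N"
    let ?y = "s \<circ> z \<circ> s"
    have y: "?y \<in> FX t N" using conj_FX[OF z N s] .
    note dz = V_delta[OF z] and dy = V_delta[OF y]
    have yc: "s \<circ> ?y = ?y \<circ> s \<longleftrightarrow> s \<circ> z = z \<circ> s" using conj_commutes_iff[OF s] .
    have yy: "s \<circ> ?y \<circ> s = z" using conj_conj[OF s] .
    consider "s \<circ> z = z \<circ> s" | "s \<circ> z \<noteq> z \<circ> s" "desc z s" | "s \<circ> z \<noteq> z \<circ> s" "\<not> desc z s" by blast
    then show "?T (?T (delta z)) = delta z + msmult lq (?T (delta z))"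
    proof cases
      case 1
      have "?T (?T (delta z)) = msmult (\<alpha> * \<alpha>) (delta z)"
        using TB_eq[OF z N 1] slin_msmult[OF lin dz] by (simp add: id_apply)
      also have "\<dots> = delta z + msmult lq (?T (delta z))"
        using \<alpha> TB_eq[OF z N 1] by (simp add: hecke_root_def msmult_add_left)
      finally show ?thesis .
    next
      case 2
      have d: "?T (delta z) = delta ?y + msmult lq (delta z)" using TB_down[OF z N 2] .
      have "?T (delta ?y + msmult lq (delta z)) = ?T (delta ?y) + msmult lq (?T (delta z))"
        using slin_add[OF lin dy V_msmult[OF dz]] slin_msmult[OF lin dz] by (simp add: id_apply)
      moreover have "?T (delta ?y) = delta z"
        using TB_up[OF y N] conj_nodesc(1)[OF z N s 2] yc yy 2 by simp
      ultimately show ?thesis using d by simp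
    next
      case 3
      have "?T (delta z) = delta ?y" using TB_up[OF z N 3] .
      moreover have "?T (delta ?y) = delta z + msmult lq (delta ?y)"
        using TB_down[OF y N] conj_desc(1)[OF z N s 3] yc yy 3 by simp
      ultimately show ?thesis by simp
    qed
  qed
qed

section \<open>Braid relations in the conjugation module\<close>

locale fpf_module =
  fixes t :: ctype and N :: nat and \<alpha> :: lpoly
  assumes N2: "N \<ge> 2" and \<alpha>: "hecke_root \<alpha>"

sublocale fpf_module \<subseteq> B: hecke_pre t N "FX t N" "TB t N \<alpha>"
  by (rule hecke_pre_FX[OF N2 \<alpha>])

context fpf_module
begin

abbreviation "T \<equiv> TB t N \<alpha>"

definition up :: "perm \<Rightarrow> perm \<Rightarrow> bool" where
  "up s z \<longleftrightarrow> s \<circ> z \<noteq> z \<circ> s \<and> \<not> desc z s"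

lemma up_iff:
  assumes "z \<in> FX t N" "s \<in> gens t N" "sroot s a b"
  shows "up s z \<longleftrightarrow> z a \<noteq> b \<and> z a \<noteq> - b \<and> z a < z b"
  unfolding up_def using commutes_iff[OF assms(1) N2 assms(2,3)] not_desc_iff[OF FX_oddbij[OF assms(1) N2] assms(3)]
  by auto

lemma T_up: "z \<in> FX t N \<Longrightarrow> up s z \<Longrightarrow> T s (delta z) = delta (s \<circ> z \<circ> s)"
  unfolding up_def using TB_up[OF _ N2] by blast

lemma conj_X: "z \<in> FX t N \<Longrightarrow> s \<in> gens t N \<Longrightarrow> s \<circ> z \<circ> s \<in> FX t N"
  using conj_FX[OF _ N2] by blast

lemma T_eq: "z \<in> FX t N \<Longrightarrow> s \<circ> z = z \<circ> s \<Longrightarrow> T s (delta z) = msmult \<alpha> (delta z)"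
  using TB_eq[OF _ N2] by blast

lemma T_after_eq:
  "z \<in> FX t N \<Longrightarrow> s \<circ> z = z \<circ> s \<Longrightarrow> u \<in> gens t N \<Longrightarrow> T u (T s (delta z)) = msmult \<alpha> (T u (delta z))"
  using T_eq B.T_msmult[of u "delta z" \<alpha>] by (simp add: V_delta)

text \<open>Only elements on which both generators act upward or as scalars have to be treated; the
  others are reached through \<open>braid_at_step\<close>. Two upward moves need care, because the
  first can change what the second does.\<close>

lemma braid_commuting:
  assumes z: "z \<in> FX t N" and s: "s \<in> gens t N" "u \<in> gens t N" and c: "commuting s u" "commuting u s"
    and su: "s \<circ> z = z \<circ> s \<or> up s z" "u \<circ> z = z \<circ> u \<or> up u z"
  shows "B.braid_at s u (delta z)"
proof -
  have com: "s \<circ> u = u \<circ> s" using c by (simp add: commuting_def)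
  have com': "s (u j) = u (s j)" for j using fun_cong[OF com, of j] by (simp add: o_apply)
  have bws: "bw s u = [s, u]" "bw u s = [u, s]" using bw_commuting c by auto
  have half: "T s (T u (delta z)) = T u (T s (delta z))"
    if s: "s \<in> gens t N" "u \<in> gens t N" and com: "\<And>j. s (u j) = u (s j)"
      and eq: "s \<circ> z = z \<circ> s" and u: "up u z" for s u
  proof -
    let ?y = "u \<circ> z \<circ> u"
    have y: "?y \<in> FX t N" using conj_X[OF z s(2)] .
    have e: "s (z j) = z (s j)" for j using fun_cong[OF eq, of j] by (simp add: o_apply)
    have "s \<circ> ?y = ?y \<circ> s" using com e by (simp add: fun_eq_iff o_apply)
    then have "T s (T u (delta z)) = msmult \<alpha> (delta ?y)" using T_up[OF z u] T_eq[OF y] by simp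
    also have "\<dots> = T u (T s (delta z))" using T_after_eq[OF z eq s(2)] T_up[OF z u] by simp
    finally show ?thesis .
  qed
  have "T s (T u (delta z)) = T u (T s (delta z))"
  proof -
    consider "s \<circ> z = z \<circ> s" "u \<circ> z = z \<circ> u" | "s \<circ> z = z \<circ> s" "up u z" | "up s z" "u \<circ> z = z \<circ> u" | "up s z" "up u z"
      using su by blast
    then show ?thesis
    proof cases
      case 1 then show ?thesis using T_after_eq[OF z] T_eq[OF z] s by simp
    next
      case 2 then show ?thesis using half[OF s com'] by blast
    next
      case 3 then show ?thesis using half[OF s(2,1) com'[symmetric]] by simp
    next
      case 4
      have ysu: "s \<circ> (u \<circ> z \<circ> u) \<circ> s = u \<circ> (s \<circ> z \<circ> s) \<circ> u" using com' by (simp add: fun_eq_iff o_apply)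
      show ?thesis
      \<comment> \<open>Here \<open>z\<close> exchanges the two roots up to sign. Both conjugations
        then give the same element, on which both generators act by the same formula.\<close>
      proof (cases "u \<circ> z = z \<circ> s")
        case True
        have e: "u (z j) = z (s j)" for j using fun_cong[OF True, of j] by (simp add: o_apply)
        have e': "s (z j) = z (u j)" for j using e[of "z j"] z FX_zz[OF z] e by metis
        let ?y = "s \<circ> z \<circ> s"
        have yu: "u \<circ> z \<circ> u = ?y" using e e' com' by (simp add: fun_eq_iff o_apply)
        have y: "?y \<in> FX t N" using conj_X[OF z s(1)] .
        have 1: "T v (delta ?y) = delta z + msmult lq (delta ?y)" if v: "v \<in> gens t N" "up v z" "v \<circ> z \<circ> v = ?y" for v
        proof -
          have "desc ?y v" "v \<circ> ?y \<noteq> ?y \<circ> v" "v \<circ> ?y \<circ> v = z"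
            using conj_desc(1)[OF z N2 v(1)] conj_commutes_iff[OF v(1), of z] conj_conj[OF v(1), of z] v by (auto simp: up_def)
          then show ?thesis using TB_down[OF y N2] by simp
        qed
        have "T s (T u (delta z)) = T s (delta ?y)" using T_up[OF z 4(2)] yu by simp
        also have "\<dots> = T u (delta ?y)" using 1[OF s(1) 4(1)] 1[OF s(2) 4(2)] yu by simp
        also have "\<dots> = T u (T s (delta z))" using T_up[OF z 4(1)] by simp
        finally show ?thesis .
      next
        case False
        \<comment> \<open>Commuting makes \<open>w\<close> preserve the root of \<open>v\<close>.
          Conjugation by \<open>w\<close> could only reverse the order of its images under
          \<open>z\<close> if these formed the root of \<open>w\<close>, which would mean
          \<open>w z = z v\<close>.\<close>
        have stay: "up v (w \<circ> z \<circ> w)"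
          if v: "v \<in> gens t N" "w \<in> gens t N" "up v z" "commuting v w" "w \<circ> z \<noteq> z \<circ> v" for v w
        proof -
          let ?y = "w \<circ> z \<circ> w"
          obtain a b where r: "sroot v a b" using gens_sroot[OF v(1)] by blast
          obtain c d where rw: "sroot w c d" using gens_sroot[OF v(2)] by blast
          have y: "?y \<in> FX t N" using conj_X[OF z v(2)] .
          have cw: "v \<circ> w = w \<circ> v" using v(4) by (simp add: commuting_def)
          have co: "v (w j) = w (v j)" for j using fun_cong[OF cw, of j] by (simp add: o_apply)
          have "v \<circ> ?y \<noteq> ?y \<circ> v"
          proof
            assume h: "v \<circ> ?y = ?y \<circ> v"
            have "v (w (z (w j))) = w (z (w (v j)))" for j using fun_cong[OF h, of j] by (simp add: o_apply)
            then have "w (v (z (w (w j)))) = w (z (w (v (w j))))" for j using co by metis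
            then have "v (z j) = z (v j)" for j using v(2) co by (metis gens_inv_app)
            then show False using v(3) by (auto simp: up_def fun_eq_iff o_apply)
          qed
          moreover have "\<not> desc ?y v"
          proof -
            have r': "sroot v (w a) (w b)" using v(4) r by (auto simp: commuting_def)
            have lt: "z a < z b" using v(3) up_iff[OF z v(1) r] by simp
            have ab: "a = - b \<Longrightarrow> w (z a) < w (z b)"
            proof -
              assume ab: "a = - b"
              obtain i where i: "v = sgen i" "i \<in> inds t N" using v(1) by (auto simp: gens_inds)
              obtain j where j: "w = sgen j" "j \<in> inds t N" using v(2) by (auto simp: gens_inds)
              have "(a, b) = (ra i, rb i) \<or> (a, b) = (- rb i, - ra i)" using sroot_unique[OF sroot_ra] r i by blast
              then have "i = 0" using ab by (auto simp: ra_def rb_def split: if_splits)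
              then have "t = TBC" using i by (cases t) (auto simp: inds_def)
              then have "j \<ge> 0" using j by (auto simp: inds_def)
              have nz: "z a \<noteq> 0" "z b \<noteq> 0" using oddbij_eq_0[OF FX_oddbij[OF z N2]] sroot_nz[OF r] by auto
              have nroot: "(z a, z b) \<noteq> (c, d)" "(z a, z b) \<noteq> (- d, - c)"
              proof -
                show "(z a, z b) \<noteq> (c, d)" "(z a, z b) \<noteq> (- d, - c)"
                  using v(5) oddbij_rfl[OF FX_oddbij[OF z N2], of a b] sroot_rfl[OF r] sroot_rfl[OF rw] 
                    sroot_rfl[OF sroot_neg[OF rw]] by auto
              qed
              show "w (z a) < w (z b)"
                by (rule gens_mono_pair[OF v(2) rw lt nz _ nroot]) (use \<open>t = TBC\<close> in simp)
            qed
            have "w (z a) < w (z b)"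
            proof (cases "a = - b")
              case True then show ?thesis using ab by blast
            next
              case False
              show ?thesis
              proof (rule gen_mono_image[OF z N2 v(2) rw lt _ _ False])
                show "(z a, z b) \<noteq> (c, d)" "(z a, z b) \<noteq> (- d, - c)"
                  using v(5) oddbij_rfl[OF FX_oddbij[OF z N2], of a b] sroot_rfl[OF r] sroot_rfl[OF rw] 
                    sroot_rfl[OF sroot_neg[OF rw]] by auto
              qed (use sroot_nz[OF r] in auto)
            qed
            then have "?y (w a) < ?y (w b)" using v(2) by (simp add: o_apply)
            then show ?thesis using not_desc_iff[OF FX_oddbij[OF y N2] r'] by simp
          qed
          ultimately show ?thesis by (simp add: up_def)
        qed
        have F2: "s \<circ> z \<noteq> z \<circ> u"
        proof
          assume h: "s \<circ> z = z \<circ> u"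
          have e: "s (z j) = z (u j)" for j using fun_cong[OF h, of j] by (simp add: o_apply)
          have "u (z j) = z (s j)" for j using e[of "z j"] z FX_zz[OF z] e by metis
          then show False using False by (simp add: fun_eq_iff o_apply)
        qed
        have "T s (T u (delta z)) = delta (s \<circ> (u \<circ> z \<circ> u) \<circ> s)"
          using T_up[OF z 4(2)] T_up[OF conj_X[OF z s(2)] stay[OF s 4(1) c(1) False]] by simp
        moreover have "T u (T s (delta z)) = delta (u \<circ> (s \<circ> z \<circ> s) \<circ> u)"
          using T_up[OF z 4(1)] T_up[OF conj_X[OF z s(1)] stay[OF s(2,1) 4(2) c(2) F2]] by simp
        ultimately show ?thesis using ysu by simp
      qed
    qed
  qed
  then show ?thesis by (simp add: B.braid_at_def bws)
qed

text \<open>Here \<open>z\<close> pairs \<open>a\<close> with \<open>b\<close> up to sign.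
  Conjugating by \<open>u\<close> and then by \<open>s\<close> goes upward twice and moves this
  pairing to \<open>b\<close> and \<open>c\<close>, so that \<open>u\<close> becomes the commuting
  generator. Both sides are \<open>\<alpha>\<close> times the same basis element.\<close>

lemma braid3_eq_up:
  assumes z: "z \<in> FX t N" and s: "s \<in> gens t N" "u \<in> gens t N" and b3: "braid3 s u a b c"
    and eq: "s \<circ> z = z \<circ> s" and up: "up u z"
  shows "T s (T u (T s (delta z))) = T u (T s (T u (delta z)))"
proof -
  have r: "sroot s a b" "sroot u b c" and d: "\<bar>a\<bar> \<noteq> \<bar>b\<bar>" "\<bar>b\<bar> \<noteq> \<bar>c\<bar>" "\<bar>a\<bar> \<noteq> \<bar>c\<bar>"
    using b3 by (auto simp: braid3_def)
  note app = braid3_app[OF b3] and od = FX_odd[OF z N2]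
  note so = sroot_odd[OF r(1)] sroot_odd[OF r(2)]
  have nz: "a \<noteq> 0" "b \<noteq> 0" "c \<noteq> 0" using sroot_nz r by auto
  have lts: "a < b" "b < c" using sroot_less r by auto
  have A: "z a = b \<or> z a = - b" using commutes_iff[OF z N2 s(1) r(1)] eq by simp
  then have B: "z a = b \<and> z b = a \<or> z a = - b \<and> z b = - a"
    using FX_zz[OF z, of a] od[of b] by auto
  have BC: "z b < z c" using up_iff[OF z s(2) r(2)] up by simp
  have C: "\<bar>z c\<bar> \<noteq> \<bar>a\<bar>" "\<bar>z c\<bar> \<noteq> \<bar>b\<bar>" "\<bar>z c\<bar> \<noteq> \<bar>c\<bar>"
  proof -
    show "\<bar>z c\<bar> \<noteq> \<bar>c\<bar>" using FX_fpf[OF z N2 gens_root_supp(2)[OF s(2) N2 r(2)]] .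
    have h: "\<bar>c\<bar> = \<bar>z e\<bar>" if "\<bar>z c\<bar> = \<bar>e\<bar>" for e
    proof -
      have "z c = e \<or> z c = - e" using that by linarith
      then have "z e = c \<or> z (- e) = c" using FX_zz[OF z, of c] by auto
      then show ?thesis using od[of e] by auto
    qed
    have "\<bar>z a\<bar> = \<bar>b\<bar>" "\<bar>z b\<bar> = \<bar>a\<bar>" using B by auto
    then show "\<bar>z c\<bar> \<noteq> \<bar>a\<bar>" "\<bar>z c\<bar> \<noteq> \<bar>b\<bar>" using h[of a] h[of b] d by auto
  qed
  have fixC: "s (z c) = z c" "u (z c) = z c" using sroot_fix[OF r(1), of "z c"] sroot_fix[OF r(2), of "z c"] C by auto
  have C0: "z c \<noteq> 0" using oddbij_eq_0[OF FX_oddbij[OF z N2]] nz by simp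
  let ?y = "u \<circ> z \<circ> u"
  have y: "?y \<in> FX t N" using conj_X[OF z s(2)] .
  have ya: "?y a = u (z a)" "?y b = z c" by (simp_all add: o_apply app fixC)
  have ya': "?y a = c \<or> ?y a = - c" unfolding ya(1) using A by (elim disjE) (simp_all add: app so)
  have lt: "?y a < ?y b"
  proof (cases "z a = b")
    case True
    then have "z b = a" using B nz by auto
    then have "a < z c" using BC by simp
    have "s a < s (z c)"
      using \<open>a < z c\<close> nz C0 C by (intro gens_mono_pair[OF s(1) r(1)]) auto
    then have "b < z c" by (simp add: app fixC)
    then have "u b < u (z c)"
      using nz C0 C by (intro gens_mono_pair[OF s(2) r(2)]) auto
    then show ?thesis using True by (simp add: ya app fixC)
  next
    case False
    then have "z a = - b" "z b = - a" using B by auto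
    then show ?thesis using BC lts by (simp add: ya so app)
  qed
  have up_s: "up s ?y" using up_iff[OF y s(1) r(1)] ya' lt d by auto
  let ?w = "s \<circ> ?y \<circ> s"
  have w: "?w \<in> FX t N" using conj_X[OF y s(1)] .
  have "?w b = s (?y a)" by (simp add: o_apply app)
  then have "?w b = c \<or> ?w b = - c" using ya' by (elim disjE) (simp_all add: app so)
  then have eq_u: "u \<circ> ?w = ?w \<circ> u" using commutes_iff[OF w N2 s(2) r(2)] by simp
  have "T s (T u (T s (delta z))) = msmult \<alpha> (T s (T u (delta z)))"
    using T_after_eq[OF z eq s(2)] B.T_msmult[OF s(1)] B.T_V[OF s(2) V_delta[OF z]] by simp
  also have "\<dots> = msmult \<alpha> (delta ?w)" using T_up[OF z up] T_up[OF y up_s] by simp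
  also have "\<dots> = T u (T s (T u (delta z)))" using T_up[OF z up] T_up[OF y up_s] T_eq[OF w eq_u] by simp
  finally show ?thesis .
qed

text \<open>All three moves go upward, once it is excluded that \<open>z\<close> pairs
  \<open>a\<close> with \<open>c\<close> up to sign. The element reached depends only on the braid
  product, hence is the same for the other braid word.\<close>

lemma braid3_up_up:
  assumes z: "z \<in> FX t N" and s: "s \<in> gens t N" "u \<in> gens t N" and b3: "braid3 s u a b c"
    and up: "up s z" "up u z"
  shows "T u (T s (T u (delta z))) = delta ((u \<circ> s \<circ> u) \<circ> z \<circ> (u \<circ> s \<circ> u))"
proof -
  have r: "sroot s a b" "sroot u b c" and d: "\<bar>a\<bar> \<noteq> \<bar>b\<bar>" "\<bar>b\<bar> \<noteq> \<bar>c\<bar>" "\<bar>a\<bar> \<noteq> \<bar>c\<bar>"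
    using b3 by (auto simp: braid3_def)
  note app = braid3_app[OF b3] and od = FX_odd[OF z N2]
  note so = sroot_odd[OF r(1)] sroot_odd[OF r(2)]
  have nz: "a \<noteq> 0" "b \<noteq> 0" "c \<noteq> 0" using sroot_nz r by auto
  have lts: "a < b" "b < c" using sroot_less r by auto
  have A: "z a \<noteq> b" "z a \<noteq> - b" "z a < z b" using up_iff[OF z s(1) r(1)] up by auto
  have B: "z b \<noteq> c" "z b \<noteq> - c" "z b < z c" using up_iff[OF z s(2) r(2)] up by auto
  have fpf: "\<bar>z a\<bar> \<noteq> \<bar>a\<bar>" "\<bar>z b\<bar> \<noteq> \<bar>b\<bar>" "\<bar>z c\<bar> \<noteq> \<bar>c\<bar>"
    using FX_fpf[OF z N2] gens_root_supp[OF s(1) N2 r(1)] gens_root_supp[OF s(2) N2 r(2)] by auto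
  have ba: "z b \<noteq> a" "z b \<noteq> - a"
    using A FX_zz[OF z, of b] od[of a] by auto
  have ac: "z a \<noteq> c" "z a \<noteq> - c"
  proof -
    show "z a \<noteq> c"
    proof
      assume h: "z a = c" then have "z c = a" using FX_zz[OF z, of a] by simp
      then show False using h A B lts by simp
    qed
    show "z a \<noteq> - c"
    proof
      \<comment> \<open>Now \<open>z b\<close> lies strictly between \<open>- c\<close> and
        \<open>- a\<close> and is fixed by both generators. Applying \<open>u\<close> to the lower
        and \<open>s\<close> to the upper inequality places it both above and below
        \<open>- b\<close>.\<close>
      assume h: "z a = - c"
      then have "z (- c) = a" using FX_zz[OF z, of a] by simp
      then have zc: "z c = - a" using od[of c] by simp
      have "\<bar>z b\<bar> \<noteq> \<bar>a\<bar>" "\<bar>z b\<bar> \<noteq> \<bar>c\<bar>" using ba B by linarith+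
      then have fb: "s (z b) = z b" "u (z b) = z b"
        using sroot_fix[OF r(1), of "z b"] sroot_fix[OF r(2), of "z b"] fpf by blast+
      have b0: "z b \<noteq> 0" using oddbij_eq_0[OF FX_oddbij[OF z N2]] nz by simp
      have "u (- c) < u (z b)"
        using A(3) h nz b0 B fpf d by (intro gens_mono_pair[OF s(2) r(2)]) auto
      moreover have "s (z b) < s (- a)"
        using B(3) zc nz b0 ba fpf d by (intro gens_mono_pair[OF s(1) r(1)]) auto
      ultimately show False by (simp add: fb so app)
    qed
  qed
  have uu: "u (u j) = j" "s (s j) = j" for j using s by auto
  have un: "u j = k \<longleftrightarrow> j = u k" "s j = k \<longleftrightarrow> j = s k" for j k using uu by metis+
  have ul: "u (z a) = b \<longleftrightarrow> z a = c" "u (z a) = - b \<longleftrightarrow> z a = - c"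
      "u (z a) = c \<longleftrightarrow> z a = b" "u (z a) = - c \<longleftrightarrow> z a = - b" "u (z a) = a \<longleftrightarrow> z a = a"
      "u (z b) = - a \<longleftrightarrow> z b = - a"
    by (simp_all only: un(1)[of _ b] un(1)[of _ "- b"] un(1)[of _ c] un(1)[of _ "- c"] un(1)[of _ a] un(1)[of _ "- a"] so app)
  have sl: "s x = c \<longleftrightarrow> x = c" "s x = - c \<longleftrightarrow> x = - c" for x
    by (simp_all only: un(2)[of _ c] un(2)[of _ "- c"] so app)
  let ?y = "u \<circ> z \<circ> u"
  have y: "?y \<in> FX t N" using conj_X[OF z s(2)] .
  have ne: "a \<noteq> - c" "a \<noteq> - b" using d by auto
  have "u (z a) < u (z c)"
    by (rule gen_mono_image[OF z N2 s(2) r(2) _ nz(1,3) ne(1)]) (use A B ac in simp_all)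
  then have up1: "up s ?y"
    using up_iff[OF y s(1) r(1)] ac ul by (simp add: o_apply app)
  let ?w = "s \<circ> ?y \<circ> s"
  have w: "?w \<in> FX t N" using conj_X[OF y s(1)] .
  have ab: "u (z a) < u (z b)"
    by (rule gen_mono_image[OF z N2 s(2) r(2) _ nz(1,2) ne(2)]) (use A B ac in simp_all)
  have "s (u (z a)) < s (u (z b))"
  proof (rule gens_mono_pair[OF s(1) r(1) ab])
    have o: "oddbij (u \<circ> z)" using oddbij_comp[OF gens_oddbij[OF s(2)] FX_oddbij[OF z N2]] .
    show "u (z a) \<noteq> 0" "u (z b) \<noteq> 0" using oddbij_eq_0[OF o] nz by (auto simp: o_apply)
    show "u (z a) \<noteq> - u (z b)"
      using oddbij_inj[OF o, of a "- b"] oddbij_odd[OF o, of b] d by (auto simp: o_apply)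
    show "(u (z a), u (z b)) \<noteq> (a, b)" using ul(5) fpf(1) by auto
    show "(u (z a), u (z b)) \<noteq> (- b, - a)" using ul(6) ba by auto
  qed
  then have "?w b < ?w c" by (simp add: o_apply app)
  moreover have "?w b \<noteq> c" "?w b \<noteq> - c"
    using A sl ul by (simp_all add: o_apply app)
  ultimately have up2: "up u ?w" using up_iff[OF w s(2) r(2)] by simp
  have "T u (T s (T u (delta z))) = delta (u \<circ> ?w \<circ> u)"
    using T_up[OF z up(2)] T_up[OF y up1] T_up[OF w up2] by simp
  then show ?thesis by (simp add: comp_assoc)
qed

text \<open>The negated coordinates represent the same two roots with the generators interchanged,
  so each configuration has to be treated in one order only.\<close>

lemma braid3_neg: "braid3 s u a b c \<Longrightarrow> braid3 u s (- c) (- b) (- a)"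
  using sroot_neg by (auto simp: braid3_def)

lemma braid_three:
  assumes z: "z \<in> FX t N" and s: "s \<in> gens t N" "u \<in> gens t N" and b3: "braid3 s u a b c"
    and su: "s \<circ> z = z \<circ> s \<or> up s z" "u \<circ> z = z \<circ> u \<or> up u z"
  shows "B.braid_at s u (delta z)"
proof -
  have bws: "bw s u = [s, u, s]" "bw u s = [u, s, u]" using bw_braid3[OF b3] by auto
  have ne: "\<not> (s \<circ> z = z \<circ> s \<and> u \<circ> z = z \<circ> u)"
  proof
    assume h: "s \<circ> z = z \<circ> s \<and> u \<circ> z = z \<circ> u"
    have r: "sroot s a b" "sroot u b c" using b3 by (auto simp: braid3_def)
    have "z a = b \<or> z a = - b" "z b = c \<or> z b = - c"
      using h commutes_iff[OF z N2 s(1) r(1)] commutes_iff[OF z N2 s(2) r(2)] by auto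
    then show False using b3 FX_zz[OF z, of a] FX_odd[OF z N2, of b] by (auto simp: braid3_def)
  qed
  have "T s (T u (T s (delta z))) = T u (T s (T u (delta z)))"
  proof -
    consider "s \<circ> z = z \<circ> s" "up u z" | "up s z" "u \<circ> z = z \<circ> u" | "up s z" "up u z" using su ne by blast
    then show ?thesis
    proof cases
      case 1 then show ?thesis using braid3_eq_up[OF z s b3] by blast
    next
      case 2 then show ?thesis using braid3_eq_up[OF z s(2,1) braid3_neg[OF b3]] by simp
    next
      case 3
      then show ?thesis
        using braid3_up_up[OF z s b3] braid3_up_up[OF z s(2,1) braid3_neg[OF b3]] braid3_relation(1)[OF b3]
        by simp
    qed
  qed
  then show ?thesis by (simp add: B.braid_at_def bws)
qed

text \<open>\<open>sgen 0\<close> never commutes with a fixed-point-free \<open>z\<close>, so ascent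
  means \<open>z 1 > 0\<close>. If \<open>sgen 1\<close> commutes, then \<open>z 1 = 2\<close>, and
  both words give \<open>\<alpha>\<close> squared times the same vector; otherwise 1 and 2 have
  partners beyond 2, and every step of both words goes upward.\<close>

lemma braid_four:
  assumes z: "z \<in> FX t N" and s: "sgen 0 \<in> gens t N" "sgen 1 \<in> gens t N"
    and su: "sgen 0 \<circ> z = z \<circ> sgen 0 \<or> up (sgen 0) z" "sgen 1 \<circ> z = z \<circ> sgen 1 \<or> up (sgen 1) z"
  shows "B.braid_at (sgen 0) (sgen 1) (delta z)"
proof -
  let ?s = "sgen 0" and ?u = "sgen 1"
  have r: "sroot ?s (-1) 1" "sroot ?u 1 2" using sroot_ra[of 0] sroot_ra[of 1] by (simp_all add: ra_def rb_def)
  have fix': "?s j = j" "?u j = j" if "\<bar>j\<bar> \<ge> 3" for j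
    using that sroot_fix[OF r(1), of j] sroot_fix[OF r(2), of j] by auto
  have f1: "\<bar>w 1\<bar> \<noteq> 1" "\<bar>w 2\<bar> \<noteq> 2" if "w \<in> FX t N" for w
    using FX_fpf[OF that N2, of 1] FX_fpf[OF that N2, of 2] N2 by (auto simp: supp_set_def)
  have nc: "?s \<circ> w \<noteq> w \<circ> ?s" if "w \<in> FX t N" for w
    using commutes_iff[OF that N2 s(1) r(1)] FX_odd[OF that N2, of 1] f1[OF that] by auto
  have ups: "up ?s w \<longleftrightarrow> w 1 > 0" if "w \<in> FX t N" for w
    using up_iff[OF that s(1) r(1)] FX_odd[OF that N2, of 1] f1[OF that] by auto
  have upu: "up ?u w \<longleftrightarrow> w 1 < w 2 \<and> \<bar>w 1\<bar> \<noteq> 2" if "w \<in> FX t N" for w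
    using up_iff[OF that s(2) r(2)] by auto
  have p: "z 1 > 0" using su(1) nc[OF z] ups[OF z] by simp
  have "T ?s (T ?u (T ?s (T ?u (delta z)))) = T ?u (T ?s (T ?u (T ?s (delta z))))"
    using su(2)
  proof
    assume eq: "?u \<circ> z = z \<circ> ?u"
    then have z1: "z 1 = 2" using commutes_iff[OF z N2 s(2) r(2)] p by auto
    let ?y = "?s \<circ> z \<circ> ?s"
    have y: "?y \<in> FX t N" using conj_X[OF z s(1)] .
    have "?y 1 = -2" using FX_odd[OF z N2, of 1] z1 by (simp add: o_apply sgen01)
    then have equ: "?u \<circ> ?y = ?y \<circ> ?u" using commutes_iff[OF y N2 s(2) r(2)] by simp
    have up_s: "up ?s z" using ups[OF z] p by simp
    have sy: "T ?s (delta ?y) = delta z + msmult lq (delta ?y)"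
      using TB_down[OF y N2 nc[OF y]] conj_desc(1)[OF z N2 s(1)] up_s conj_conj[OF s(1), of z] by (simp add: up_def)
    note dz = V_delta[OF z] and dy = V_delta[OF y]
    have "T ?s (T ?u (T ?s (T ?u (delta z)))) = msmult \<alpha> (T ?s (T ?u (T ?s (delta z))))"
      using T_after_eq[OF z eq s(1)] B.T_msmult s dz by simp
    also have "\<dots> = msmult \<alpha> (T ?s (T ?u (delta ?y)))" using T_up[OF z up_s] by simp
    also have "\<dots> = msmult \<alpha> (msmult \<alpha> (delta z + msmult lq (delta ?y)))"
      using T_after_eq[OF y equ s(1)] sy by simp
    finally have 1: "T ?s (T ?u (T ?s (T ?u (delta z)))) = msmult \<alpha> (msmult \<alpha> (delta z + msmult lq (delta ?y)))" .
    have "T ?u (T ?s (T ?u (T ?s (delta z)))) = T ?u (T ?s (T ?u (delta ?y)))" using T_up[OF z up_s] by simp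
    also have "\<dots> = msmult \<alpha> (T ?u (delta z + msmult lq (delta ?y)))"
      using T_after_eq[OF y equ s(1)] sy B.T_msmult[OF s(2)] dz dy by (simp add: V_add V_msmult)
    also have "T ?u (delta z + msmult lq (delta ?y)) = msmult \<alpha> (delta z + msmult lq (delta ?y))"
      using B.T_shift[OF s(2) dz dy] T_eq[OF z eq] T_eq[OF y equ]
      by (simp add: msmult_add_right mult.commute)
    finally show ?thesis using 1 by simp
  next
    assume u: "up ?u z"
    have q: "z 1 < z 2" "\<bar>z 1\<bar> \<noteq> 2" using upu[OF z] u by auto
    have nz: "z 1 \<noteq> 0" using p by simp
    have big: "\<bar>z 1\<bar> \<ge> 3" "\<bar>z 2\<bar> \<ge> 3"
    proof -
      show "\<bar>z 1\<bar> \<ge> 3" using q p f1[OF z] by linarith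
      have "z 2 \<noteq> 1" using FX_zz[OF z, of 2] q by auto
      then show "\<bar>z 2\<bar> \<ge> 3" using p q f1[OF z] by linarith
    qed
    have cs: "(?s \<circ> w \<circ> ?s) 1 = - w 1" "(?s \<circ> w \<circ> ?s) 2 = w 2" "?s \<circ> w \<circ> ?s \<in> FX t N"
      if "w \<in> FX t N" "\<bar>w 1\<bar> \<ge> 3" "\<bar>w 2\<bar> \<ge> 3" for w
      using that conj_X[OF that(1) s(1)] FX_odd[OF that(1) N2, of 1] fix'[of "- w 1"] fix'[of "w 2"]
      by (simp_all add: o_apply sgen01)
    have cu: "(?u \<circ> w \<circ> ?u) 1 = w 2" "(?u \<circ> w \<circ> ?u) 2 = w 1" "?u \<circ> w \<circ> ?u \<in> FX t N"
      if "w \<in> FX t N" "\<bar>w 1\<bar> \<ge> 3" "\<bar>w 2\<bar> \<ge> 3" for w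
      using that conj_X[OF that(1) s(2)] fix'[of "w 1"] fix'[of "w 2"] by (simp_all add: o_apply sgen01)
    have Ts: "T ?s (delta w) = delta (?s \<circ> w \<circ> ?s)" if "w \<in> FX t N" "w 1 > 0" for w
      using that T_up ups by blast
    have Tu: "T ?u (delta w) = delta (?u \<circ> w \<circ> ?u)" if "w \<in> FX t N" "w 1 < w 2" "\<bar>w 1\<bar> \<ge> 3" for w
      using that T_up upu by simp
    define a1 where "a1 = ?u \<circ> z \<circ> ?u"
    define a2 where "a2 = ?s \<circ> a1 \<circ> ?s"
    define a3 where "a3 = ?u \<circ> a2 \<circ> ?u"
    define a4 where "a4 = ?s \<circ> a3 \<circ> ?s"
    define b1 where "b1 = ?s \<circ> z \<circ> ?s"
    define b2 where "b2 = ?u \<circ> b1 \<circ> ?u"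
    define b3 where "b3 = ?s \<circ> b2 \<circ> ?s"
    define b4 where "b4 = ?u \<circ> b3 \<circ> ?u"
    have A1: "a1 \<in> FX t N" "a1 1 = z 2" "a1 2 = z 1" unfolding a1_def using cu[OF z big] by auto
    have A2: "a2 \<in> FX t N" "a2 1 = - z 2" "a2 2 = z 1" unfolding a2_def using cs[of a1] A1 big by auto
    have A3: "a3 \<in> FX t N" "a3 1 = z 1" "a3 2 = - z 2" unfolding a3_def using cu[of a2] A2 big by auto
    have B1: "b1 \<in> FX t N" "b1 1 = - z 1" "b1 2 = z 2" unfolding b1_def using cs[OF z big] by auto
    have B2: "b2 \<in> FX t N" "b2 1 = z 2" "b2 2 = - z 1" unfolding b2_def using cu[of b1] B1 big by auto
    have B3: "b3 \<in> FX t N" "b3 1 = - z 2" "b3 2 = - z 1" unfolding b3_def using cs[of b2] B2 big by auto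
    have 1: "T ?u (delta z) = delta a1" unfolding a1_def using Tu[OF z] q big by blast
    have 2: "T ?s (delta a1) = delta a2" unfolding a2_def using Ts[OF A1(1)] A1 p q by simp
    have 3: "T ?u (delta a2) = delta a3" unfolding a3_def using Tu[OF A2(1)] A2 p q big by simp
    have 4: "T ?s (delta a3) = delta a4" unfolding a4_def using Ts[OF A3(1)] A3 p by simp
    have 5: "T ?s (delta z) = delta b1" unfolding b1_def using Ts[OF z p] .
    have 6: "T ?u (delta b1) = delta b2" unfolding b2_def using Tu[OF B1(1)] B1 p q big by simp
    have 7: "T ?s (delta b2) = delta b3" unfolding b3_def using Ts[OF B2(1)] B2 p q by simp
    have 8: "T ?u (delta b3) = delta b4" unfolding b4_def using Tu[OF B3(1)] B3 p q big by simp
    have st: "?s (?u (?s (?u j))) = ?u (?s (?u (?s j)))" for j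
      using fun_cong[OF braid4_relation(3), of j] by (simp add: o_apply)
    have "a4 = b4"
      unfolding a4_def a3_def a2_def a1_def b4_def b3_def b2_def b1_def
      using st by (simp add: fun_eq_iff o_apply)
    then show ?thesis by (simp add: 1 2 3 4 5 6 7 8)
  qed
  then show ?thesis by (simp add: B.braid_at_def bw_braid4)
qed

text \<open>A descent of either generator passes the claim to an element shorter by 2; the cases
  without descent are the preceding lemmas.\<close>

lemma braid_FX:
  assumes s: "s \<in> gens t N" "u \<in> gens t N" "s \<noteq> u" and z: "z \<in> FX t N"
  shows "B.braid_at s u (delta z)"
  using z
proof (induction "len t N z" arbitrary: z rule: less_induct)
  case less
  have step: "B.braid_at v w (delta z)"
    if v: "v \<in> gens t N" "w \<in> gens t N" "v \<circ> z \<noteq> z \<circ> v" "desc z v" "{v, w} = {s, u}" for v w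
  proof -
    let ?y = "v \<circ> z \<circ> v"
    have y: "?y \<in> FX t N" using conj_X[OF less.prems v(1)] .
    have n: "\<not> desc ?y v" "len t N z = len t N ?y + 2" using conj_nodesc[OF less.prems N2 v(1,3,4)] by auto
    have "B.braid_at s u (delta ?y)" using less.hyps[OF _ y] n by simp
    then have "B.braid_at v w (delta ?y)" using v(5) B.braid_at_sym by (auto simp: doubleton_eq_iff)
    moreover have "T v (delta ?y) = delta z"
      using T_up[OF y] n v(3) conj_commutes_iff[OF v(1), of z] conj_conj[OF v(1), of z] by (simp add: up_def)
    ultimately show ?thesis using B.braid_at_step[OF v(1,2) V_delta[OF y]] by simp
  qed
  show ?case
  proof (cases "(s \<circ> z \<noteq> z \<circ> s \<and> desc z s) \<or> (u \<circ> z \<noteq> z \<circ> u \<and> desc z u)")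
    case True
    then show ?thesis using step[OF s(1,2)] step[OF s(2,1)] B.braid_at_sym by (metis insert_commute)
  next
    case False
    then have su: "s \<circ> z = z \<circ> s \<or> up s z" "u \<circ> z = z \<circ> u \<or> up u z" by (auto simp: up_def)
    show ?thesis using s
    proof (cases rule: gens_pair_cases)
      case 1 then show ?thesis using braid_commuting[OF less.prems s(1,2)] su by blast
    next
      case (2 a b c) then show ?thesis using braid_three[OF less.prems s(1,2)] su by blast
    next
      case (3 a b c) then show ?thesis using braid_three[OF less.prems s(2,1)] su B.braid_at_sym by blast
    next
      case 4 then show ?thesis using braid_four[OF less.prems] s su by simp
    next
      case 5 then show ?thesis using braid_four[OF less.prems] s su B.braid_at_sym by simp
    qed
  qed
qed

end

sublocale fpf_module \<subseteq> B: hecke_rep t N "FX t N" "TB t N \<alpha>"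
  by unfold_locales (use B.braid_at_all braid_FX in blast)

section \<open>Minimal elements and the bar operator on the full module\<close>

text \<open>Without visible descents between \<open>p\<close> and its partner
  \<open>q > p + 1\<close>, every value in between stays above \<open>p\<close>. The last step from
  \<open>q - 1\<close> to \<open>q\<close> then has to drop to \<open>p\<close>, which is itself a
  visible descent.\<close>

lemma no_nesting:
  fixes z :: "int \<Rightarrow> int"
  assumes zz: "\<And>i. z (z i) = i" and pq: "z p = q" "p + 1 < q"
    and vd: "\<And>r. p \<le> r \<Longrightarrow> r < q \<Longrightarrow> min r (z r) \<le> z (r + 1)"
  shows False
proof -
  have gt: "z r > p" if "p \<le> r" "r < q" for r
    using that
  proof (induction r rule: int_ge_induct)
    case base then show ?case using pq by simp
  next
    case (step r)
    have v: "min r (z r) \<le> z (r + 1)" using vd[of r] step by simp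
    show ?case
    proof (cases "r = p")
      case True
      have "z (p + 1) \<noteq> p" using zz[of "p + 1"] pq by auto
      then show ?thesis using v True pq by simp
    next
      case False
      then show ?thesis using v step by simp
    qed
  qed
  have "min (q - 1) (z (q - 1)) \<le> z q" using vd[of "q - 1"] pq by simp
  moreover have "z (q - 1) > p" using gt[of "q - 1"] pq by simp
  moreover have "z q = p" using zz[of p] pq by simp
  ultimately show False using pq by simp
qed

lemma Wgrp_TA_pos: "w \<in> Wgrp TA N \<Longrightarrow> i > 0 \<Longrightarrow> w i > 0"
proof -
  assume "w \<in> Wgrp TA N" and i: "i > 0"
  then obtain ws where ws: "set ws \<subseteq> gens TA N" "w = wprod ws" by (auto simp: Wgrp_def)
  have "wprod ws i > 0" using ws(1)
  proof (induction ws)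
    case Nil then show ?case using i by (simp add: id_apply)
  next
    case (Cons s ws)
    then obtain j where "s = sgen j" "j \<ge> 1" by (auto simp: gens_def)
    then show ?case using Cons by (simp add: o_apply sgen_def)
  qed
  then show ?thesis using ws by simp
qed

text \<open>Minimality under conjugation by the generators of rank \<open>K\<close> only:
  \<open>K = N\<close> serves the full module, \<open>K = n\<close> the elements of
  \<open>Gset\<close>.\<close>

definition lmin :: "ctype \<Rightarrow> nat \<Rightarrow> perm \<Rightarrow> bool" where
  "lmin t K z \<longleftrightarrow> (\<forall>s\<in>gens t K. s \<circ> z = z \<circ> s \<or> \<not> desc z s)"

lemma lmin_step:
  assumes z: "z \<in> FX t N" and N: "N \<ge> 2" and K: "K \<le> N" and lm: "lmin t K z" and i: "i \<in> inds t K"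
  shows "z (ra i) = rb i \<or> z (ra i) = - rb i \<or> z (ra i) < z (rb i)"
proof -
  have s: "sgen i \<in> gens t K" using i by (simp add: gens_inds)
  then have sN: "sgen i \<in> gens t N" using gens_mono[OF K] by blast
  show ?thesis
    using lm s commutes_iff[OF z N sN sroot_ra] not_desc_iff[OF FX_oddbij[OF z N] sroot_ra[of i]]
    unfolding lmin_def by blast
qed

text \<open>Once one value is positive, minimality keeps the later ones positive, so only
  \<open>z 1\<close> matters. In type D minimality still allows \<open>z 1 < -1\<close>, but then 1
  is the only index counted by the parity condition.\<close>

lemma lmin_pos:
  assumes z: "z \<in> FX t N" and N: "N \<ge> 2" and K: "2 \<le> K" "K \<le> N" and lm: "lmin t K z"
    and noneg: "\<And>i. int K < i \<Longrightarrow> i \<le> int N \<Longrightarrow> \<not> z i < - i"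
    and i: "1 \<le> i" "i \<le> int K"
  shows "z i > 0"
proof -
  note od = FX_odd[OF z N]
  note stp = lmin_step[OF z N K(2) lm]
  have st: "z r = r + 1 \<or> z r = - (r + 1) \<or> z r < z (r + 1)" if "1 \<le> r" "r < int K" for r
  proof -
    have "r \<in> inds t K" using that by (cases t) (auto simp: inds_def)
    from stp[OF this] show ?thesis using that by (simp add: ra_def rb_def)
  qed
  have nz: "z r \<noteq> 0" if "r \<noteq> 0" for r using oddbij_eq_0[OF FX_oddbij[OF z N]] that by simp
  have posup: "z r > 0" if p0: "z r0 > 0" "1 \<le> r0" "r0 \<le> r" "r \<le> int K" for r r0
    using p0(3,4)
  proof (induction r rule: int_ge_induct)
    case base then show ?case using p0 by simp
  next
    case (step r)
    then have pos: "z r > 0" by simp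
    have "1 \<le> r" "r < int K" using step p0 by auto
    then consider "z r = r + 1" | "z r = - (r + 1)" | "z r < z (r + 1)" using st by blast
    then show ?case
    proof cases
      case 1 then have "z (r + 1) = r" using FX_zz[OF z, of r] by simp
      then show ?thesis using \<open>1 \<le> r\<close> by simp
    next
      case 2 then show ?thesis using pos \<open>1 \<le> r\<close> by simp
    next
      case 3 then show ?thesis using pos by simp
    qed
  qed
  have fpf: "\<bar>z 1\<bar> \<noteq> 1" using FX_fpf[OF z N, of 1] N by (auto simp: supp_set_def)
  show ?thesis
  proof (cases t)
    case TA then show ?thesis using Wgrp_TA_pos FX_Wgrp[OF z] i by auto
  next
    case TBC
    have "0 \<in> inds t K" using TBC K by (simp add: inds_def)
    from stp[OF this] have "z 1 > 0" using od[of 1] fpf by (auto simp: ra_def rb_def)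
    then show ?thesis using posup i by simp
  next
    case TD
    have "-1 \<in> inds t K" using TD by (simp add: inds_def)
    from stp[OF this] have a: "\<bar>z 1\<bar> = 2 \<or> - z 1 < z 2" using od[of 1] by (auto simp: ra_def rb_def)
    have b: "\<bar>z 1\<bar> = 2 \<or> z 1 < z 2" using st[of 1] K by auto
    have z1: "z 1 > 0"
    proof (rule ccontr)
      assume "\<not> z 1 > 0"
      then have n1: "z 1 < -1" using nz[of 1] fpf by simp
      have rest: "\<not> z r < - r" if r: "2 \<le> r" "r \<le> int N" for r
      proof (cases "r \<le> int K")
        case False then show ?thesis using noneg r by simp
      next
        case rK: True
        show ?thesis
        proof (cases "\<bar>z 1\<bar> = 2")
          case True
          then have "z 1 = -2" using n1 by simp
          then have "z (-2) = 1" using FX_zz[OF z, of 1] by simp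
          then have z2: "z 2 = -1" using od[of 2] by simp
          show ?thesis
          proof (cases "r = 2")
            case True then show ?thesis using z2 by simp
          next
            case False
            then have "z 2 < z 3" using st[of 2] z2 rK r by auto
            then have "z 3 > 0" using z2 nz[of 3] by simp
            then show ?thesis using posup[of 3 r] False r rK by simp
          qed
        next
          case False
          then have "z 2 > 0" using a b by linarith
          then show ?thesis using posup[of 2 r] r rK by simp
        qed
      qed
      have "{i\<in>{1..int N}. z i < - i} = {1}" using n1 rest N by (auto, smt (verit))
      then show False using z TD by (simp add: FX_def)
    qed
    then show ?thesis using posup i by simp
  qed
qed

text \<open>Take the longest initial segment that is paired consecutively. If the next index had its
  partner within \<open>K\<close>, \<open>no_nesting\<close> would make the partner adjacent and
  lengthen the segment; so its partner lies beyond \<open>K\<close>, and monotonicity pushes all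
  later ones there too.\<close>

lemma lmin_structure:
  assumes z: "z \<in> FX t N" and N: "N \<ge> 2" and K: "2 \<le> K" "K \<le> N" and lm: "lmin t K z"
    and noneg: "\<And>i. int K < i \<Longrightarrow> i \<le> int N \<Longrightarrow> \<not> z i < - i"
  shows "\<exists>j. even j \<and> 0 \<le> j \<and> j \<le> int K \<and> (\<forall>i. 1 \<le> i \<and> i \<le> j \<longrightarrow> z i = (if odd i then i + 1 else i - 1))
     \<and> (\<forall>i. j < i \<and> i \<le> int K \<longrightarrow> z i > int K)"
proof -
  have pos: "z i > 0" if "1 \<le> i" "i \<le> int K" for i using lmin_pos[OF z N K lm _ that] noneg by blast
  have st: "z r = r + 1 \<or> z r < z (r + 1)" if "1 \<le> r" "r < int K" for r
  proof -
    have "r \<in> inds t K" using that by (cases t) (auto simp: inds_def)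
    from lmin_step[OF z N K(2) lm this] show ?thesis using that pos[of r] by (auto simp: ra_def rb_def)
  qed
  let ?P = "\<lambda>j. even j \<and> 0 \<le> j \<and> j \<le> int K \<and> (\<forall>i. 1 \<le> i \<and> i \<le> j \<longrightarrow> z i = (if odd i then i + 1 else i - 1))"
  have fin: "finite {j. ?P j}" by (rule finite_subset[of _ "{0..int K}"]) auto
  have ne: "0 \<in> {j. ?P j}" by simp
  define j where "j = Max {j. ?P j}"
  have j: "?P j" unfolding j_def using Max_in[OF fin] ne by blast
  have jmax: "j' \<le> j" if "?P j'" for j' unfolding j_def using Max_ge[OF fin] that by blast
  have "z i > int K" if i: "j < i" "i \<le> int K" for i
  proof -
    let ?p = "j + 1"
    have p: "1 \<le> ?p" "?p \<le> int K" "odd ?p" using j i by auto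
    have p1: "z ?p > ?p"
    proof -
      have "z ?p \<noteq> ?p" using FX_fpf[OF z N, of ?p] p K by (auto simp: supp_set_def)
      moreover have "\<not> (1 \<le> z ?p \<and> z ?p \<le> j)"
      proof
        assume h: "1 \<le> z ?p \<and> z ?p \<le> j"
        then have "z (z ?p) = (if odd (z ?p) then z ?p + 1 else z ?p - 1)" using j by blast
        then have "?p = (if odd (z ?p) then z ?p + 1 else z ?p - 1)" using FX_zz[OF z] by simp
        then show False using h j by (auto split: if_splits)
      qed
      ultimately show ?thesis using pos[OF p(1,2)] by linarith
    qed
    have start: "z ?p > int K"
    proof (rule ccontr)
      assume "\<not> z ?p > int K"
      then have le: "z ?p \<le> int K" by simp
      show False
      proof (cases "z ?p = ?p + 1")
        case True
        have "z (?p + 1) = ?p" using FX_zz[OF z, of ?p] True by simp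
        then have "z i = (if odd i then i + 1 else i - 1)" if "1 \<le> i \<and> i \<le> j + 2" for i
        proof -
          consider "i \<le> j" | "i = ?p" | "i = ?p + 1" using \<open>1 \<le> i \<and> i \<le> j + 2\<close> by linarith
          then show ?thesis using j True \<open>z (?p + 1) = ?p\<close> \<open>1 \<le> i \<and> i \<le> j + 2\<close> by cases auto
        qed
        then have "?P (j + 2)" using j le True by auto
        then show False using jmax[of "j + 2"] by simp
      next
        case False
        show False
        proof (rule no_nesting[of z ?p "z ?p"])
          show "z (z i) = i" for i using FX_zz[OF z] .
          show "?p + 1 < z ?p" using p1 False by simp
          fix r assume "?p \<le> r" "r < z ?p"
          then have r: "1 \<le> r" "r < int K" using p le by auto
          show "min r (z r) \<le> z (r + 1)"
          proof (cases "z r = r + 1")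
            case True then have "z (r + 1) = r" using FX_zz[OF z, of r] by simp
            then show ?thesis by simp
          next
            case False then show ?thesis using st[OF r] by simp
          qed
        qed simp
      qed
    qed
    have "z r > int K" if "?p \<le> r" "r \<le> int K" for r
      using that
    proof (induction r rule: int_ge_induct)
      case base then show ?case using start by simp
    next
      case (step r)
      then have "z r > int K" by simp
      then show ?case using st[of r] step p by auto
    qed
    then show ?thesis using i by simp
  qed
  then show ?thesis using j by blast
qed

text \<open>A reduced word for the minimal element that pairs 2i - 1 with 2i; its letters act on
  disjoint pairs.\<close>

primrec pw :: "nat \<Rightarrow> perm list" where
  "pw 0 = []"
| "pw (Suc k) = sgen (2 * int k + 1) # pw k"

lemma pw_fix: "\<bar>j\<bar> > 2 * int k \<Longrightarrow> wprod (pw k) j = j"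
  by (induction k) (auto simp: o_apply id_apply sgen_def)

lemma pw_pair: "1 \<le> i \<Longrightarrow> i \<le> 2 * int k \<Longrightarrow> wprod (pw k) i = (if odd i then i + 1 else i - 1)"
proof (induction k)
  case (Suc k)
  show ?case
  proof (cases "i \<le> 2 * int k")
    case True
    then have e: "wprod (pw k) i = (if odd i then i + 1 else i - 1)" using Suc by simp
    have "odd i \<Longrightarrow> i < 2 * int k" using True by (cases "i = 2 * int k") auto
    then have "(if odd i then i + 1 else i - 1) \<le> 2 * int k" "(if odd i then i + 1 else i - 1) \<ge> 0"
      using Suc.prems True by auto
    then have "sgen (2 * int k + 1) (if odd i then i + 1 else i - 1) = (if odd i then i + 1 else i - 1)"
      by (simp add: sgen_def)
    then show ?thesis by (simp add: o_apply e)
  next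
    case False
    then have "i = 2 * int k + 1 \<or> i = 2 * int k + 2" using Suc.prems by auto
    then show ?thesis using pw_fix[of k i] False by (auto simp: o_apply sgen_def)
  qed
qed simp

lemma pw_gens: "2 * k \<le> N \<Longrightarrow> set (pw k) \<subseteq> gens t N"
proof (induction k)
  case (Suc k)
  have "2 * int k + 1 \<in> inds t N" using Suc.prems by (cases t) (auto simp: inds_def)
  then show ?case using Suc by (auto simp: gens_inds)
qed simp

lemma pw_red: "2 * k \<le> N \<Longrightarrow> N \<ge> 2 \<Longrightarrow> is_red t N (pw k) (wprod (pw k))"
proof (induction k)
  case 0
  have "is_word t N [] id" by (simp add: is_word_def)
  then show ?case using len_le[of t N "[]" id] by (simp add: is_red_def)
next
  case (Suc k)
  let ?s = "sgen (2 * int k + 1)" and ?w = "wprod (pw k)"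
  have g: "?s \<in> gens t N" "set (pw k) \<subseteq> gens t N" using pw_gens[OF Suc.prems(1), of t] by auto
  have w: "?w \<in> Wgrp t N" using wprod_Wgrp g Suc.prems by blast
  have r: "sroot ?s (2 * int k + 1) (2 * int k + 2)"
    using sroot_ra[of "2 * int k + 1"] by (simp add: ra_def rb_def add.commute)
  have o: "oddbij ?w" using Wgrp_oddbij[OF w Suc.prems(2)] .
  have "inv ?w j = j" if "\<bar>j\<bar> > 2 * int k" for j
    using pw_fix[OF that] o by (metis bij_inv_eq_iff oddbij_def)
  then have "inv ?w (2 * int k + 1) < inv ?w (2 * int k + 2)" by simp
  then have "len t N (?s \<circ> ?w) = Suc (len t N ?w)"
    using left_descent(2)[OF w Suc.prems(2) g(1) r] by simp
  then show ?case using Suc g by (simp add: is_red_def is_word_def)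
qed

section \<open>The bar operator on the conjugation module\<close>

context fpf_module
begin

lemma lmin_pairing:
  assumes z: "z \<in> FX t N" and lm: "lmin t N z" and i: "1 \<le> i" "i \<le> int N"
  shows "z i = (if odd i then i + 1 else i - 1)"
proof -
  obtain j where j: "0 \<le> j" "j \<le> int N" "\<forall>i. 1 \<le> i \<and> i \<le> j \<longrightarrow> z i = (if odd i then i + 1 else i - 1)"
      "\<forall>i. j < i \<and> i \<le> int N \<longrightarrow> z i > int N"
    using lmin_structure[OF z N2 N2 order_refl lm] by auto
  have "\<not> j < int N"
  proof
    assume "j < int N"
    then have "z (int N) > int N" using j by blast
    moreover have "z (int N) \<in> supp_set N" using FX_supp[OF z N2, of "int N"] N2 by (auto simp: supp_set_def)
    ultimately show False by (simp add: supp_set_def)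
  qed
  then show ?thesis using j i by auto
qed

lemma alpha_inv: "\<alpha> - lq = lbar \<alpha>" "\<alpha> * lbar \<alpha> = 1"
proof -
  have a: "\<alpha> * \<alpha> = 1 + lq * \<alpha>" "lbar \<alpha> * \<alpha> = 1" using \<alpha> by (auto simp: hecke_root_def)
  show "\<alpha> * lbar \<alpha> = 1" using a by (simp add: mult.commute)
  have "(\<alpha> - lq) * \<alpha> = 1" using a by (simp add: algebra_simps)
  then have "(\<alpha> - lq) * \<alpha> * lbar \<alpha> = lbar \<alpha>" by simp
  then show "\<alpha> - lq = lbar \<alpha>" using \<open>\<alpha> * lbar \<alpha> = 1\<close> by (simp only: mult.assoc mult_1_right)
qed

lemma Tinv_eq: "z \<in> FX t N \<Longrightarrow> s \<circ> z = z \<circ> s \<Longrightarrow> B.Tinv s (delta z) = msmult (lbar \<alpha>) (delta z)"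
  unfolding B.Tinv_def using T_eq alpha_inv(1)[symmetric]
  by (simp add: fun_eq_iff vec_apply left_diff_distrib)

text \<open>The action of the bar image of \<open>H_y\<close>; for an involution \<open>y\<close>
  this is the inverse of \<open>H_y\<close>.\<close>

definition Bw :: "perm \<Rightarrow> vec \<Rightarrow> vec" where "Bw y m = opw B.Tinv (redword t N y) m"

lemma Bw_red: "is_red t N ws y \<Longrightarrow> m \<in> V (FX t N) \<Longrightarrow> opw B.Tinv ws m = Bw y m"
proof -
  assume r: "is_red t N ws y" and m: "m \<in> V (FX t N)"
  have "y \<in> Wgrp t N" using r wprod_Wgrp N2 by (auto simp: is_red_def is_word_def)
  then show ?thesis unfolding Bw_def using B.opw_Tinv_red[OF r redword_red[OF _ N2] m] by blast
qed

lemma Bw_V: "y \<in> Wgrp t N \<Longrightarrow> m \<in> V (FX t N) \<Longrightarrow> Bw y m \<in> V (FX t N)"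
  unfolding Bw_def using B.redword_gens by simp

lemma Bw_left:
  assumes y: "y \<in> Wgrp t N" and s: "s \<in> gens t N" and m: "m \<in> V (FX t N)" and l: "len t N (s \<circ> y) = Suc (len t N y)"
  shows "B.Tinv s (Bw y m) = Bw (s \<circ> y) m"
proof -
  have "is_red t N (s # redword t N y) (s \<circ> y)"
    using redword_red[OF y N2] s l by (auto simp: is_red_def is_word_def)
  from Bw_red[OF this m] show ?thesis by (simp add: Bw_def)
qed

lemma Bw_right:
  assumes y: "y \<in> Wgrp t N" and s: "s \<in> gens t N" and m: "m \<in> V (FX t N)" and l: "len t N (y \<circ> s) = Suc (len t N y)"
  shows "Bw y (B.Tinv s m) = Bw (y \<circ> s) m"
proof -
  have "is_red t N (redword t N y @ [s]) (y \<circ> s)"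
    using redword_red[OF y N2] s l by (auto simp: is_red_def is_word_def)
  from Bw_red[OF this m] show ?thesis by (simp add: Bw_def opw_append)
qed

lemma Bw_pair:
  assumes z: "z \<in> FX t N" and e: "\<And>i. 1 \<le> i \<Longrightarrow> i \<le> int N \<Longrightarrow> z i = (if odd i then i + 1 else i - 1)" and N: "even N"
  shows "Bw z (delta z) = msmult (lbar \<alpha> ^ (N div 2)) (delta z)"
proof -
  let ?n = "N div 2"
  have N': "2 * ?n = N" "2 * int ?n = int N" using N by auto
  have r: "is_red t N (pw ?n) (wprod (pw ?n))" using pw_red[of ?n N t] N2 N' by simp
  have o: "oddbij (wprod (pw ?n))" using oddbij_wprod[OF pw_gens[of ?n N t]] N' by simp
  have pos: "wprod (pw ?n) i = z i" if "i \<ge> 0" for i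
  proof (cases "i = 0")
    case True then show ?thesis using oddbij_0[OF o] oddbij_0[OF FX_oddbij[OF z N2]] by simp
  next
    case False
    show ?thesis
    proof (cases "i \<le> int N")
      case True then show ?thesis using pw_pair[of i ?n] e[of i] N' False that by simp
    next
      case out: False
      have "z i = i" using Wgrp_W_BC[OF FX_Wgrp[OF z] N2] out by (auto simp: W_BC_iff supp_set_def)
      then show ?thesis using pw_fix[of ?n i] N' out by simp
    qed
  qed
  have "wprod (pw ?n) i = z i" for i
  proof (cases "i \<ge> 0")
    case False
    then show ?thesis using pos[of "- i"] oddbij_odd[OF o, of i] FX_odd[OF z N2, of i] by simp
  qed (rule pos)
  then have wz: "wprod (pw ?n) = z" by auto
  have "opw B.Tinv (pw k) (delta z) = msmult (lbar \<alpha> ^ k) (delta z)" if "2 * k \<le> N" for k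
    using that
  proof (induction k)
    case (Suc k)
    let ?s = "sgen (2 * int k + 1)"
    have g: "?s \<in> gens t N" using pw_gens[OF Suc.prems, of t] by simp
    have rt: "sroot ?s (2 * int k + 1) (2 * int k + 2)"
      using sroot_ra[of "2 * int k + 1"] by (simp add: ra_def rb_def add.commute)
    have "z (2 * int k + 1) = 2 * int k + 2" using e[of "2 * int k + 1"] Suc.prems by simp
    then have c: "?s \<circ> z = z \<circ> ?s" using commutes_iff[OF z N2 g rt] by simp
    have "B.Tinv ?s (msmult (lbar \<alpha> ^ k) (delta z)) = msmult (lbar \<alpha> ^ k) (B.Tinv ?s (delta z))"
      using slin_msmult[OF B.Tinv_lin[OF g] V_delta[OF z]] by (simp add: id_apply)
    then show ?case using Suc Tinv_eq[OF z c] by (simp add: mult.commute)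
  qed simp
  then show ?thesis using Bw_red[OF r V_delta[OF z]] wz N' by simp
qed

text \<open>The power of \<open>\<alpha>\<close> cancels the scalar of \<open>Bw_pair\<close>, so
  that the minimal element is fixed.\<close>

definition barB :: "vec \<Rightarrow> vec" where
  "barB = lext lbar (FX t N) (\<lambda>y. msmult (\<alpha> ^ (N div 2)) (Bw y (delta y)))"

lemma barB_slin: "slin lbar (FX t N) (FX t N) barB"
  unfolding barB_def by (rule slin_lext[OF ring_map_lbar]) (intro V_msmult Bw_V FX_Wgrp V_delta)

lemma barB_delta: "y \<in> FX t N \<Longrightarrow> barB (delta y) = msmult (\<alpha> ^ (N div 2)) (Bw y (delta y))"
  unfolding barB_def using lext_delta[OF ring_map_lbar finite_FX[OF N2]] by blast

lemma Tinv_msmult: "s \<in> gens t N \<Longrightarrow> m \<in> V (FX t N) \<Longrightarrow> B.Tinv s (msmult p m) = msmult p (B.Tinv s m)"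
  using slin_msmult[OF B.Tinv_lin] by (simp add: id_apply)

lemma Bw_msmult: "y \<in> Wgrp t N \<Longrightarrow> m \<in> V (FX t N) \<Longrightarrow> Bw y (msmult p m) = msmult p (Bw y m)"
  unfolding Bw_def using slin_msmult[OF B.opw_Tinv_lin[OF B.redword_gens]] by (simp add: id_apply)

text \<open>The formula \<open>M\<^sub>z \<mapsto> H\<^sub>z\<^sup>-\<^sup>1 M\<^sub>z\<close> (up to a unit) is compatible with the action because
  \<open>H\<^sub>s\<^sub>z\<^sub>s = H\<^sub>s H\<^sub>z H\<^sub>s\<close> when the length goes up, and \<open>H\<^sub>s\<close> commutes with \<open>H\<^sub>z\<close> when \<open>s\<close> commutes with \<open>z\<close>.\<close>

lemma barB_up:
  assumes z: "z \<in> FX t N" and s: "s \<in> gens t N" and u: "up s z"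
  shows "barB (delta (s \<circ> z \<circ> s)) = B.Tinv s (barB (delta z))"
proof -
  let ?y = "s \<circ> z \<circ> s" and ?c = "\<alpha> ^ (N div 2)"
  have y: "?y \<in> FX t N" using conj_X[OF z s] .
  have zW: "z \<in> Wgrp t N" using FX_Wgrp[OF z] .
  obtain a b where r: "sroot s a b" using gens_sroot[OF s] by blast
  have lt: "z a < z b" using u up_iff[OF z s r] by simp
  have zs: "z \<circ> s \<in> Wgrp t N" using Wgrp_comp[OF zW gens_Wgrp[OF s N2] N2] .
  have l1: "len t N (z \<circ> s) = Suc (len t N z)" using right_descent(2)[OF zW N2 s r lt] .
  have l2: "len t N (s \<circ> (z \<circ> s)) = Suc (len t N (z \<circ> s))"
    using conj_desc(2)[OF z N2 s] u l1 by (simp add: up_def comp_assoc)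
  note dy = V_delta[OF y] and dz = V_delta[OF z]
  have Td: "B.Tinv s (delta ?y) = delta z" using B.Tinv_T[OF s dz] T_up[OF z u] by simp
  have "Bw ?y (delta ?y) = B.Tinv s (Bw (z \<circ> s) (delta ?y))"
    using Bw_left[OF zs s dy l2] by (simp add: comp_assoc)
  also have "\<dots> = B.Tinv s (Bw z (delta z))" using Bw_right[OF zW s dy l1] Td by simp
  finally show ?thesis
    using barB_delta[OF y] barB_delta[OF z] Tinv_msmult[OF s Bw_V[OF zW dz]] by simp
qed

lemma barB_commute:
  assumes z: "z \<in> FX t N" and s: "s \<in> gens t N" and c: "s \<circ> z = z \<circ> s"
  shows "B.Tinv s (barB (delta z)) = msmult (lbar \<alpha>) (barB (delta z))"
proof -
  have zW: "z \<in> Wgrp t N" using FX_Wgrp[OF z] .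
  note dz = V_delta[OF z]
  have "B.Tinv s (Bw z m) = Bw z (B.Tinv s m)" if m: "m \<in> V (FX t N)" for m
  proof (cases "desc (inv z) s")
    case False
    have l: "len t N (s \<circ> z) = Suc (len t N z)" using left_desc(2)[OF zW N2 s False] .
    show ?thesis using Bw_left[OF zW s m l] Bw_right[OF zW s m] l c by simp
  next
    case True
    have l: "len t N z = Suc (len t N (s \<circ> z))" using left_desc(1)[OF zW N2 s True] .
    have sz: "s \<circ> z \<in> Wgrp t N" using Wgrp_comp[OF gens_Wgrp[OF s N2] zW N2] .
    \<comment> \<open>Since \<open>s\<close> commutes with \<open>z\<close>, it can be split off
      from \<open>z\<close> on either side; both splittings express \<open>Bw z\<close> through the
      same shorter element.\<close>
    have e: "s \<circ> (s \<circ> z) = z" "(s \<circ> z) \<circ> s = z" using s c by (simp_all add: fun_eq_iff o_apply)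
    have 1: "B.Tinv s (Bw (s \<circ> z) m) = Bw z m" if "m \<in> V (FX t N)" for m
      using Bw_left[OF sz s that] l e by simp
    have 2: "Bw (s \<circ> z) (B.Tinv s m) = Bw z m" if "m \<in> V (FX t N)" for m
      using Bw_right[OF sz s that] l e by simp
    have "B.Tinv s (Bw z m) = B.Tinv s (Bw (s \<circ> z) (B.Tinv s m))" using 2[OF m] by simp
    also have "\<dots> = Bw z (B.Tinv s m)" using 1 B.Tinv_V[OF s m] by simp
    finally show ?thesis .
  qed
  from this[OF dz] have "B.Tinv s (Bw z (delta z)) = msmult (lbar \<alpha>) (Bw z (delta z))"
    using Tinv_eq[OF z c] Bw_msmult[OF zW dz] by simp
  then show ?thesis
    using barB_delta[OF z] Tinv_msmult[OF s Bw_V[OF zW dz]] by (simp add: mult.commute)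
qed

lemma barB_T:
  assumes s: "s \<in> gens t N" and m: "m \<in> V (FX t N)"
  shows "barB (T s m) = B.Tinv s (barB m)"
proof (rule slin_eqI[OF finite_FX[OF N2] _ _ _ m, where \<sigma> = lbar and F = "\<lambda>m. barB (T s m)" and G = "\<lambda>m. B.Tinv s (barB m)"])
  show "slin lbar (FX t N) (FX t N) (\<lambda>m. barB (T s m))"
    using slin_comp[OF B.linT[OF s] barB_slin] by (simp add: o_def id_def)
  show "slin lbar (FX t N) (FX t N) (\<lambda>m. B.Tinv s (barB m))"
    using slin_comp[OF barB_slin B.Tinv_lin[OF s]] by (simp add: o_def id_def)
  fix z assume z: "z \<in> FX t N"
  note dz = V_delta[OF z]
  consider "s \<circ> z = z \<circ> s" | "up s z" | "s \<circ> z \<noteq> z \<circ> s" "desc z s" by (auto simp: up_def)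
  then show "barB (T s (delta z)) = B.Tinv s (barB (delta z))"
  proof cases
    case 1
    then show ?thesis using T_eq[OF z 1] slin_msmult[OF barB_slin dz] barB_commute[OF z s 1] by simp
  next
    case 2
    then show ?thesis using T_up[OF z 2] barB_up[OF z s 2] by simp
  next
    case 3
    let ?y = "s \<circ> z \<circ> s"
    have y: "?y \<in> FX t N" using conj_X[OF z s] .
    have uy: "up s ?y" using conj_nodesc(1)[OF z N2 s 3] conj_commutes_iff[OF s, of z] 3 by (simp add: up_def)
    have bz: "barB (delta z) = B.Tinv s (barB (delta ?y))"
      using barB_up[OF y s uy] conj_conj[OF s, of z] by simp
    have bV: "barB (delta z) \<in> V (FX t N)" "barB (delta ?y) \<in> V (FX t N)"
      using slin_V[OF barB_slin] dz V_delta[OF y] by auto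
    have bdy: "barB (delta ?y) = T s (barB (delta z))" using bz B.T_Tinv[OF s bV(2)] by simp
    have "barB (T s (delta z)) = barB (delta ?y) + msmult (lbar lq) (barB (delta z))"
      using TB_down[OF z N2 3] slin_add[OF barB_slin V_delta[OF y] V_msmult[OF dz]] slin_msmult[OF barB_slin dz] by simp
    also have "\<dots> = T s (barB (delta z)) + msmult (- lq) (barB (delta z))"
      unfolding bdy lbar_lq ..
    also have "\<dots> = B.Tinv s (barB (delta z))"
      by (simp add: B.Tinv_def fun_eq_iff vec_apply algebra_simps)
    finally show ?thesis .
  qed
qed

text \<open>Conjugation by a generator changes the length by at most 2.\<close>

lemma Tinv_height:
  assumes s: "s \<in> gens t N" and r: "r \<in> V {u\<in>FX t N. len t N u < L}"
  shows "B.Tinv s r \<in> V {u\<in>FX t N. len t N u < L + 2}"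
proof -
  let ?Y = "{u\<in>FX t N. len t N u < L + 2}"
  have rV: "r \<in> V (FX t N)" using r by (auto simp: V_def)
  have d: "T s (delta u) \<in> V ?Y" if u: "u \<in> FX t N" "len t N u < L" for u
  proof -
    have uY: "delta u \<in> V ?Y" using u by (intro V_delta) simp
    have "delta (s \<circ> u \<circ> s) \<in> V ?Y" if "s \<circ> u \<noteq> u \<circ> s"
    proof -
      have "len t N (s \<circ> u \<circ> s) < L + 2"
        using conj_desc(2)[OF u(1) N2 s that] conj_nodesc(2)[OF u(1) N2 s that] u(2) by (cases "desc u s") auto
      then show ?thesis using conj_X[OF u(1) s] by (intro V_delta) simp
    qed
    then show ?thesis unfolding TB_delta[OF u(1) N2] Tb_def using uY by (auto intro!: V_add V_msmult)
  qed
  have "T s r = (\<Sum>u\<in>FX t N. msmult (r u) (T s (delta u)))"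
    using slin_expand[OF finite_FX[OF N2] B.linT[OF s] rV] by (simp add: id_apply)
  also have "\<dots> \<in> V ?Y"
  proof (rule V_sum)
    fix u assume u: "u \<in> FX t N"
    show "msmult (r u) (T s (delta u)) \<in> V ?Y"
    proof (cases "len t N u < L")
      case True then show ?thesis using d[OF u] by blast
    next
      case False
      then have "r u = 0" using r by (auto simp: V_def)
      then show ?thesis by simp
    qed
  qed
  finally have "T s r \<in> V ?Y" .
  moreover have "r \<in> V ?Y" using r by (auto simp: V_def)
  ultimately show ?thesis unfolding B.Tinv_def by (intro V_diff V_msmult)
qed

text \<open>A non-minimal \<open>z\<close> is reached upward from \<open>y = s z s\<close>, which is
  shorter by 2. The inverse operator sends \<open>delta y\<close> to
  \<open>delta z - lq delta y\<close>, and raises the error terms, which lie below \<open>y\<close>,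
  by at most 2.\<close>

lemma barB_triangular:
  assumes N: "even N" and z: "z \<in> FX t N"
  shows "barB (delta z) - delta z \<in> V {u\<in>FX t N. len t N u < len t N z}"
  using z
proof (induction "len t N z" arbitrary: z rule: less_induct)
  case less
  note dz = V_delta[OF less.prems]
  show ?case
  proof (cases "lmin t N z")
    case True
    have "barB (delta z) = msmult (\<alpha> ^ (N div 2) * lbar \<alpha> ^ (N div 2)) (delta z)"
      using barB_delta[OF less.prems] Bw_pair[OF less.prems lmin_pairing[OF less.prems True] N] by simp
    also have "\<alpha> ^ (N div 2) * lbar \<alpha> ^ (N div 2) = 1"
      using alpha_inv(2) by (simp add: power_mult_distrib[symmetric])
    finally show ?thesis by simp
  next
    case False
    then obtain s where s: "s \<in> gens t N" "s \<circ> z \<noteq> z \<circ> s" "desc z s" by (auto simp: lmin_def)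
    let ?y = "s \<circ> z \<circ> s"
    have y: "?y \<in> FX t N" using conj_X[OF less.prems s(1)] .
    have l: "len t N z = len t N ?y + 2" using conj_nodesc(2)[OF less.prems N2 s] .
    have uy: "up s ?y"
      using conj_nodesc(1)[OF less.prems N2 s] conj_commutes_iff[OF s(1), of z] s by (simp add: up_def)
    note dy = V_delta[OF y]
    define r where "r = barB (delta ?y) - delta ?y"
    have r: "r \<in> V {u\<in>FX t N. len t N u < len t N ?y}" unfolding r_def using less.hyps[OF _ y] l by simp
    then have rV: "r \<in> V (FX t N)" by (auto simp: V_def)
    have zy: "T s (delta ?y) = delta z" using T_up[OF y uy] conj_conj[OF s(1), of z] by simp
    have "barB (delta z) = B.Tinv s (delta ?y + r)" using barB_T[OF s(1) dy] zy by (simp add: r_def)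
    also have "\<dots> = B.Tinv s (delta ?y) + B.Tinv s r" using slin_add[OF B.Tinv_lin[OF s(1)] dy rV] .
    also have "B.Tinv s (delta ?y) = delta z - msmult lq (delta ?y)" using zy by (simp add: B.Tinv_def)
    finally have "barB (delta z) - delta z = B.Tinv s r - msmult lq (delta ?y)"
      by (simp add: algebra_simps)
    moreover have "B.Tinv s r \<in> V {u\<in>FX t N. len t N u < len t N z}" using Tinv_height[OF s(1) r] l by simp
    moreover have "msmult lq (delta ?y) \<in> V {u\<in>FX t N. len t N u < len t N z}"
      using y l by (intro V_msmult V_delta) simp
    ultimately show ?thesis using V_diff by metis
  qed
qed

end

section \<open>Structure of the index set\<close>

text \<open>The map \<open>i\<close> to \<open>- z i\<close> matches the two members of each pair
  with negative sign. Membership in the group of type D, which \<open>F_D\<close> does not demand,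
  is therefore automatic.\<close>

lemma even_card_negative:
  fixes z :: perm
  assumes zz: "\<And>i. z (z i) = i" and od: "\<And>i. z (- i) = - z i" and f: "\<And>i. i \<in> {1..M} \<Longrightarrow> \<bar>z i\<bar> \<noteq> i"
    and r: "\<And>i. i \<in> {1..M} \<Longrightarrow> 1 \<le> \<bar>z i\<bar> \<and> \<bar>z i\<bar> \<le> M"
  shows "even (card {i\<in>{1..M}. z i < 0})"
proof -
  let ?A = "{i\<in>{1..M}. z i < - i}" and ?B = "{i\<in>{1..M}. - i < z i \<and> z i < 0}"
  have fin: "finite ?A" "finite ?B" by (rule finite_subset[of _ "{1..M}"]; auto)+
  have u: "{i\<in>{1..M}. z i < 0} = ?A \<union> ?B"
  proof (intro equalityI subsetI)
    fix i assume "i \<in> {i\<in>{1..M}. z i < 0}"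
    then show "i \<in> ?A \<union> ?B" using f[of i] by auto
  qed auto
  have "bij_betw (\<lambda>i. - z i) ?A ?B"
  proof (rule bij_betw_byWitness[where f' = "\<lambda>i. - z i"])
    show "\<forall>i\<in>?A. - z (- z i) = i" "\<forall>i\<in>?B. - z (- z i) = i" using zz od by auto
    show "(\<lambda>i. - z i) ` ?A \<subseteq> ?B" "(\<lambda>i. - z i) ` ?B \<subseteq> ?A" using r zz od by fastforce+
  qed
  then have "card ?A = card ?B" by (rule bij_betw_same_card)
  then have "card {i\<in>{1..M}. z i < 0} = 2 * card ?A" unfolding u using fin by (subst card_Un_disjoint) auto
  then show ?thesis by simp
qed

text \<open>In type D the parity in \<open>F_D\<close> is taken over 1, ..., n and that in
  \<open>FX\<close> over 1, ..., 2n; absence of visible descents beyond n makes the further indices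
  contribute nothing.\<close>

lemma Gset_FX:
  assumes n: "n \<ge> 2"
  shows "Gset t n = {z \<in> FX t (2 * n). \<forall>i > int n. \<not> visdes z i}"
proof (cases t)
  case TA
  have "(\<forall>i\<in>{1..2 * int n}. z i \<noteq> i) \<longleftrightarrow> (\<forall>i\<in>{1..2 * int n}. \<bar>z i\<bar> \<noteq> i)" if "z \<in> Wgrp TA (2 * n)" for z
  proof -
    have "\<bar>z i\<bar> = z i" if "i \<in> {1..2 * int n}" for i using Wgrp_TA_pos[OF \<open>z \<in> _\<close>, of i] that by simp
    then show ?thesis by auto
  qed
  then show ?thesis unfolding TA Gset_def FX_def F_A_def by auto
next
  case TBC then show ?thesis unfolding Gset_def FX_def F_BC_def by (auto simp: Wgrp_def)
next
  case TD
  have "z \<in> F_D n \<longleftrightarrow> z \<in> FX TD (2 * n)" if v: "\<forall>i > int n. \<not> visdes z i" for z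
  proof -
    have "z i < - i \<longleftrightarrow> False" if "int n < i" for i using v that by (auto simp: visdes_def)
    then have e: "{i\<in>{1..2 * int n}. z i < - i} = {i\<in>{1..int n}. z i < - i}" by force
    have "even (card {i \<in> {1..2 * int n}. z i < 0})" if z: "z \<in> F_BC n"
    proof (rule even_card_negative)
      have w: "z \<in> W_BC (2 * n)" using z by (simp add: F_BC_def)
      show "z (z i) = i" for i using z unfolding F_BC_def by (metis (mono_tags, lifting) mem_Collect_eq o_apply id_apply)
      show "z (- i) = - z i" for i using w by (simp add: W_BC_def)
      show "\<bar>z i\<bar> \<noteq> i" if "i \<in> {1..2 * int n}" for i using z that by (simp add: F_BC_def)
      show "1 \<le> \<bar>z i\<bar> \<and> \<bar>z i\<bar> \<le> 2 * int n" if "i \<in> {1..2 * int n}" for i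
        using W_BC_supp[OF w, of i] that by (auto simp: supp_set_def)
    qed
    then show ?thesis unfolding F_D_def FX_def using e by (auto simp: F_BC_def Wgrp_def W_D_def)
  qed
  then show ?thesis unfolding TD Gset_def by auto
qed

text \<open>The scalar of a generator in \<open>DesEq\<close>; \<open>aeq\<close> is that of a
  generator in \<open>AscEq\<close>. They are the two roots of the quadratic relation, and
  \<open>ModM\<close> and \<open>ModN\<close> exchange them.\<close>

definition deq :: "modtype \<Rightarrow> lpoly" where "deq mt = (case mt of ModM \<Rightarrow> lx | ModN \<Rightarrow> - lxinv)"
definition aeq :: "modtype \<Rightarrow> lpoly" where "aeq mt = (case mt of ModM \<Rightarrow> - lxinv | ModN \<Rightarrow> lx)"

lemma hecke_root_deq: "hecke_root (deq mt)"
  by (cases mt) (simp_all add: hecke_root_def deq_def algebra_simps lbar_uminus)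

lemma hecke_root_aeq: "hecke_root (aeq mt)"
  by (cases mt) (simp_all add: hecke_root_def aeq_def algebra_simps lbar_uminus)

section \<open>Decomposition of the index set by the number of pairs crossing n\<close>

locale small =
  fixes t :: ctype and n :: nat and mt :: modtype
  assumes n2: "n \<ge> 2"

sublocale small \<subseteq> F: fpf_module t "2 * n" "deq mt"
  by unfold_locales (use n2 hecke_root_deq in auto)

context small
begin

abbreviation "N \<equiv> 2 * n"
abbreviation "X \<equiv> FX t N"
abbreviation "\<epsilon> \<equiv> aeq mt"
abbreviation "ln \<equiv> len t N"

lemma N2: "N \<ge> 2" using n2 by simp

text \<open>The stable set without monotonicity. Adding \<open>inc k\<close> cuts out the part of
  \<open>Gset\<close> belonging to \<open>k\<close>, by \<open>G_struct\<close> and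
  \<open>A_inc_G\<close>.\<close>

definition A :: "nat \<Rightarrow> perm set" where
  "A k = {y \<in> X. k \<le> n \<and> (\<forall>p. int n < p \<and> p \<le> int n + int k \<longrightarrow> \<bar>y p\<bar> \<le> int n)
     \<and> (\<forall>p. int n + int k < p \<and> p \<le> 2 * int n \<longrightarrow> y p = (if odd (p - int n - int k) then p + 1 else p - 1))}"

definition inc :: "nat \<Rightarrow> perm \<Rightarrow> bool" where
  "inc k y \<longleftrightarrow> (\<forall>p. int n < p \<and> p < int n + int k \<longrightarrow> y p < y (p + 1))"

lemma A_X: "y \<in> A k \<Longrightarrow> y \<in> X" by (simp add: A_def)

lemma A_tail:
  "y \<in> A k \<Longrightarrow> int n + int k < p \<Longrightarrow> p \<le> 2 * int n \<Longrightarrow> y p = (if odd (p - int n - int k) then p + 1 else p - 1)"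
  unfolding A_def by blast

lemma A_tail_gt: "y \<in> A k \<Longrightarrow> int n + int k < p \<Longrightarrow> p \<le> 2 * int n \<Longrightarrow> y p > int n + int k"
proof -
  assume h: "y \<in> A k" "int n + int k < p" "p \<le> 2 * int n"
  show ?thesis
  proof (cases "odd (p - int n - int k)")
    case True
    then show ?thesis using A_tail[OF h] h(2) unfolding if_P[OF True] by simp
  next
    case False
    then have "p - int n - int k \<noteq> 1" by (metis odd_one)
    then show ?thesis using A_tail[OF h] h(2) unfolding if_not_P[OF False] by simp
  qed
qed

lemma A_low: "y \<in> A k \<Longrightarrow> int n < p \<Longrightarrow> p \<le> int n + int k \<Longrightarrow> \<bar>y p\<bar> \<le> int n"
  unfolding A_def by blast

lemma A_kn: "y \<in> A k \<Longrightarrow> k \<le> n" unfolding A_def by blast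

lemma X_range:
  assumes "y \<in> X" "\<bar>i\<bar> \<le> 2 * int n"
  shows "\<bar>y i\<bar> \<le> 2 * int n"
  using assms FX_supp[OF assms(1) N2, of i] oddbij_0[OF FX_oddbij[OF assms(1) N2]]
  by (cases "i = 0") (auto simp: supp_set_def)

lemma X_out: "y \<in> X \<Longrightarrow> \<bar>i\<bar> > 2 * int n \<Longrightarrow> y i = i"
  using Wgrp_W_BC[OF FX_Wgrp N2] by (auto simp: W_BC_iff supp_set_def)

lemma A_unique_k: "y \<in> A k \<Longrightarrow> y \<in> A k' \<Longrightarrow> k = k'"
proof -
  have "\<not> k < k'" if y: "y \<in> A k" "y \<in> A k'" for k k'
  proof
    assume l: "k < k'"
    let ?p = "int n + int k + 1"
    have "\<bar>y ?p\<bar> \<le> int n" using A_low[OF y(2), of ?p] l by simp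
    moreover have "y ?p > int n + int k" using A_tail_gt[OF y(1), of ?p] l A_kn[OF y(2)] by simp
    ultimately show False by simp
  qed
  then show "y \<in> A k \<Longrightarrow> y \<in> A k' \<Longrightarrow> k = k'" by (meson linorder_neqE_nat)
qed

text \<open>Let n + 1, ..., n + k be the longest run with partners in the range up to n; absence of
  visible descents makes their partners increase. The rest is paired consecutively by strong
  induction: the first free index has a larger partner, and \<open>no_nesting\<close> makes it
  adjacent.\<close>

lemma G_struct:
  assumes z: "z \<in> Gset t n"
  shows "\<exists>k. z \<in> A k \<and> inc k z"
proof -
  have zX: "z \<in> X" and nv: "\<And>i. i > int n \<Longrightarrow> \<not> visdes z i" using z Gset_FX[OF n2] by auto
  have vd: "min r (z r) \<le> z (r + 1)" "- r \<le> z r" if "r > int n" for r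
    using nv[OF that] that by (auto simp: visdes_def)
  let ?P = "\<lambda>k. k \<le> n \<and> (\<forall>p. int n < p \<and> p \<le> int n + int k \<longrightarrow> \<bar>z p\<bar> \<le> int n)"
  have fin: "finite {k. ?P k}" by (rule finite_subset[of _ "{..n}"]) auto
  have ne: "0 \<in> {k. ?P k}" by simp
  define k where "k = Max {k. ?P k}"
  have k: "?P k" unfolding k_def using Max_in[OF fin] ne by blast
  have kmax: "k' \<le> k" if "?P k'" for k' unfolding k_def using Max_ge[OF fin] that by blast
  have "inc k z" unfolding inc_def
  proof (intro allI impI)
    fix p assume p: "int n < p \<and> p < int n + int k"
    have "min p (z p) \<le> z (p + 1)" using vd p by blast
    moreover have "\<bar>z p\<bar> \<le> int n" using k p by auto
    moreover have "z p \<noteq> z (p + 1)" using oddbij_inj[OF FX_oddbij[OF zX N2], of p "p + 1"] by simp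
    ultimately show "z p < z (p + 1)" using p by auto
  qed
  have first: "\<bar>z (int n + int k + 1)\<bar> > int n" if "k < n"
  proof (rule ccontr)
    assume h: "\<not> \<bar>z (int n + int k + 1)\<bar> > int n"
    have "\<bar>z p\<bar> \<le> int n" if "int n < p \<and> p \<le> int n + int (Suc k)" for p
    proof (cases "p \<le> int n + int k")
      case True then show ?thesis using k that by blast
    next
      case False
      then have "p = int n + int k + 1" using that by simp
      then show ?thesis using h by simp
    qed
    then have "?P (Suc k)" using that by simp
    then show False using kmax[of "Suc k"] by simp
  qed
  have pair: "z (int n + int k + 2 * int i + 1) = int n + int k + 2 * int i + 2"
    if "int n + int k + 2 * int i + 1 \<le> 2 * int n" for i
    using that
  proof (induction i rule: less_induct)
    case (less i)
    let ?p = "int n + int k + 2 * int i + 1"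
    \<comment> \<open>Everything between n and \<open>?p\<close> is already matched below
      \<open>?p\<close>, so a partner of \<open>?p\<close> that is smaller in absolute value would
      have to lie within n.\<close>
    have before: "\<bar>z q\<bar> < ?p" if q: "int n < q" "q < ?p" for q
    proof (cases "q \<le> int n + int k")
      case True then show ?thesis using k q by force
    next
      case False
      define j where "j = nat ((q - int n - int k - 1) div 2)"
      have j: "int j = (q - int n - int k - 1) div 2" using False by (simp add: j_def)
      have ji: "j < i" using q j by linarith
      have "q = int n + int k + 2 * int j + 1 \<or> q = int n + int k + 2 * int j + 2" using j by linarith
      moreover have zj: "z (int n + int k + 2 * int j + 1) = int n + int k + 2 * int j + 2"
        using less.IH[OF ji] less.prems ji by simp
      moreover have "z (int n + int k + 2 * int j + 2) = int n + int k + 2 * int j + 1"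
        using FX_zz[OF zX, of "int n + int k + 2 * int j + 1"] zj by simp
      ultimately show ?thesis using ji by auto
    qed
    \<comment> \<open>At the first index this is maximality of \<open>k\<close>. Later, the previous
      index maps to \<open>?p - 2\<close>, and a smaller value at \<open>?p\<close> would be a
      visible descent.\<close>
    have big: "\<bar>z ?p\<bar> > int n"
    proof (cases "i = 0")
      case True then show ?thesis using first less.prems by simp
    next
      case False
      define j where "j = i - 1"
      have ij: "int i = int j + 1" "j < i" using False by (auto simp: j_def)
      have zj: "z (int n + int k + 2 * int j + 1) = int n + int k + 2 * int j + 2"
        using less.IH[OF ij(2)] less.prems ij by simp
      have "z (?p - 1) = ?p - 2"
        using FX_zz[OF zX, of "int n + int k + 2 * int j + 1"] zj ij(1) by (simp add: algebra_simps)
      moreover have "min (?p - 1) (z (?p - 1)) \<le> z (?p - 1 + 1)" using vd(1)[of "?p - 1"] ij by simp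
      ultimately have "z ?p \<ge> ?p - 2" by simp
      then show ?thesis using ij by simp
    qed
    have gt: "z ?p > ?p"
    proof -
      have ne: "\<bar>z ?p\<bar> \<noteq> ?p" using FX_fpf[OF zX N2, of ?p] less.prems by (auto simp: supp_set_def)
      have "\<not> \<bar>z ?p\<bar> < ?p"
      proof
        assume l: "\<bar>z ?p\<bar> < ?p"
        have "\<bar>z \<bar>z ?p\<bar>\<bar> < ?p" using before[of "\<bar>z ?p\<bar>"] big l by simp
        moreover have "\<bar>z \<bar>z ?p\<bar>\<bar> = \<bar>z (z ?p)\<bar>"
          using FX_odd[OF zX N2, of "z ?p"] by (cases "z ?p \<ge> 0") simp_all
        ultimately show False using FX_zz[OF zX, of ?p] by simp
      qed
      moreover have "- ?p \<le> z ?p" using vd(2)[of ?p] by simp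
      ultimately show ?thesis using ne by linarith
    qed
    show ?case
    proof (rule ccontr)
      assume "z ?p \<noteq> int n + int k + 2 * int i + 2"
      then have "?p + 1 < z ?p" using gt by simp
      moreover have "min r (z r) \<le> z (r + 1)" if "?p \<le> r" for r using vd(1)[of r] that by simp
      ultimately show False using no_nesting[of z ?p "z ?p"] FX_zz[OF zX] by blast
    qed
  qed
  have "z p = (if odd (p - int n - int k) then p + 1 else p - 1)" if p: "int n + int k < p" "p \<le> 2 * int n" for p
  proof -
    define i where "i = nat ((p - int n - int k - 1) div 2)"
    have i: "int i = (p - int n - int k - 1) div 2" using p by (simp add: i_def)
    show ?thesis
    proof (cases "odd (p - int n - int k)")
      case True
      then obtain c where "p - int n - int k = 2 * c + 1" by (rule oddE)
      then have e: "p = int n + int k + 2 * int i + 1" using i by presburger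
      show ?thesis using pair[of i] p True unfolding e[symmetric] by (simp add: e)
    next
      case False
      then have "even (p - int n - int k)" by blast
      then obtain c where "p - int n - int k = 2 * c" by (rule evenE)
      then have e: "p = int n + int k + 2 * int i + 2" using i by presburger
      have "z (int n + int k + 2 * int i + 1) = p" using pair[of i] p e by simp
      then have "z p = int n + int k + 2 * int i + 1" using FX_zz[OF zX, of "int n + int k + 2 * int i + 1"] by simp
      then show ?thesis using False e by simp
    qed
  qed
  then have "z \<in> A k" using zX k by (simp add: A_def)
  then show ?thesis using \<open>inc k z\<close> by blast
qed

lemma A_inc_G:
  assumes y: "y \<in> A k" and i: "inc k y"
  shows "y \<in> Gset t n"
proof -
  have "\<not> visdes y p" if p: "p > int n" for p
  proof -
    have yX: "y \<in> X" using A_X[OF y] .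
    consider "p < int n + int k" | "p = int n + int k" "k > 0" | "int n + int k < p" "p \<le> 2 * int n" | "p > 2 * int n"
      using p by linarith
    then show ?thesis
    proof cases
      case 1
      then have "\<bar>y p\<bar> \<le> int n" "y p < y (p + 1)" using A_low[OF y] i p by (auto simp: inc_def)
      then show ?thesis using p by (auto simp: visdes_def)
    next
      case 2
      have l: "\<bar>y p\<bar> \<le> int n" using A_low[OF y] 2 p by simp
      have "y (p + 1) > int n"
      proof (cases "p + 1 \<le> 2 * int n")
        case True then show ?thesis using A_tail_gt[OF y, of "p + 1"] 2 by simp
      next
        case False then show ?thesis using X_out[OF yX, of "p + 1"] p by simp
      qed
      then show ?thesis using l p by (auto simp: visdes_def)
    next
      case 3
      have yp: "y p = (if odd (p - int n - int k) then p + 1 else p - 1)" using A_tail[OF y] 3 by blast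
      have "y (p + 1) \<ge> p"
      proof (cases "p + 1 \<le> 2 * int n")
        case True
        then have "y (p + 1) = (if odd (p + 1 - int n - int k) then p + 1 + 1 else p + 1 - 1)"
          using A_tail[OF y, of "p + 1"] 3 by simp
        then show ?thesis by auto
      next
        case False then show ?thesis using X_out[OF yX, of "p + 1"] p by simp
      qed
      then show ?thesis using yp p by (auto simp: visdes_def)
    next
      case 4
      then show ?thesis using X_out[OF yX, of "p + 1"] X_out[OF yX, of p] p by (auto simp: visdes_def)
    qed
  qed
  then show ?thesis using Gset_FX[OF n2] A_X[OF y] by blast
qed

lemma G_X: "z \<in> Gset t n \<Longrightarrow> z \<in> X" using G_struct A_X by blast

lemma gens_n_N: "s \<in> gens t n \<Longrightarrow> s \<in> gens t N" using gens_mono[of n N t] by auto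

lemma gens_n_fix: "s \<in> gens t n \<Longrightarrow> \<bar>j\<bar> > int n \<Longrightarrow> s j = j"
  using sgen_fix[OF _ n2] by (auto simp: gens_inds supp_set_def)

lemma gens_n_abs: 
  assumes s: "s \<in> gens t n" and j: "\<bar>j\<bar> \<le> int n"
  shows "\<bar>s j\<bar> \<le> int n"
proof (rule ccontr)
  assume "\<not> \<bar>s j\<bar> \<le> int n"
  then have "s (s j) = s j" using gens_n_fix[OF s] by simp
  then show False using \<open>\<not> _\<close> j s by simp
qed

lemma gens_n_root: "s \<in> gens t n \<Longrightarrow> sroot s a b \<Longrightarrow> \<bar>a\<bar> \<le> int n \<and> \<bar>b\<bar> \<le> int n"
  using gens_root_supp[OF _ n2] by (auto simp: supp_set_def)

lemma conj_A:
  assumes y: "y \<in> A k" and s: "s \<in> gens t n"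
  shows "s \<circ> y \<circ> s \<in> A k"
proof -
  have X: "s \<circ> y \<circ> s \<in> X" using F.conj_X[OF A_X[OF y] gens_n_N[OF s]] .
  have v: "(s \<circ> y \<circ> s) p = s (y p)" if "p > int n" for p using gens_n_fix[OF s, of p] that by (simp add: o_apply)
  have "\<bar>(s \<circ> y \<circ> s) p\<bar> \<le> int n" if p: "int n < p" "p \<le> int n + int k" for p
    unfolding v[OF p(1)] using gens_n_abs[OF s A_low[OF y p]] .
  moreover have "(s \<circ> y \<circ> s) p = (if odd (p - int n - int k) then p + 1 else p - 1)"
    if p: "int n + int k < p" "p \<le> 2 * int n" for p
    using v[of p] gens_n_fix[OF s, of "y p"] A_tail_gt[OF y p] A_tail[OF y p] p by simp
  ultimately show ?thesis using X A_kn[OF y] by (simp add: A_def)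
qed

lemma sgen_j_gens: "int n < j \<Longrightarrow> j < int n + int k \<Longrightarrow> k \<le> n \<Longrightarrow> sgen j \<in> gens t N"
  by (cases t) (auto simp: gens_inds inds_def)

lemma conj_A_j:
  assumes y: "y \<in> A k" and j: "int n < j" "j < int n + int k"
  shows "sgen j \<circ> y \<circ> sgen j \<in> A k"
proof -
  let ?s = "sgen j"
  have X: "?s \<circ> y \<circ> ?s \<in> X" using F.conj_X[OF A_X[OF y] sgen_j_gens[OF j A_kn[OF y]]] .
  have fx: "?s i = i" if "i > int n + int k \<or> \<bar>i\<bar> \<le> int n" for i using j that by (auto simp: sgen_def)
  have "\<bar>(?s \<circ> y \<circ> ?s) p\<bar> \<le> int n" if p: "int n < p" "p \<le> int n + int k" for p
  proof -
    have "int n < ?s p" "?s p \<le> int n + int k" using j p by (auto simp: sgen_def)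
    then have "\<bar>y (?s p)\<bar> \<le> int n" using A_low[OF y] by blast
    then show ?thesis using fx by (simp add: o_apply)
  qed
  moreover have "(?s \<circ> y \<circ> ?s) p = (if odd (p - int n - int k) then p + 1 else p - 1)"
    if p: "int n + int k < p" "p \<le> 2 * int n" for p
  proof -
    have "(?s \<circ> y \<circ> ?s) p = y p" using fx[of p] fx[of "y p"] A_tail_gt[OF y p] p by (simp add: o_apply)
    then show ?thesis using A_tail[OF y p] by simp
  qed
  ultimately show ?thesis using X A_kn[OF y] by (simp add: A_def)
qed

text \<open>On \<open>A k\<close> the map \<open>cl\<close> separates the orbits of \<open>S\<^sub>k\<close> permuting \<open>n + 1, \<dots>, n + k\<close>.\<close>

definition cl :: "perm \<Rightarrow> perm" where
  "cl y i = (if \<bar>i\<bar> \<le> int n then if \<bar>y i\<bar> \<le> int n then y i else sgn (y i) * (int n + 1) else 0)"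

lemma cl_conj:
  assumes s: "s \<in> gens t n"
  shows "cl (s \<circ> y \<circ> s) i = s (cl y (s i))"
proof (cases "\<bar>i\<bar> \<le> int n")
  case False
  then show ?thesis using gens_n_fix[OF s, of i] s by (auto simp: cl_def gens_inds)
next
  case True
  have si: "\<bar>s i\<bar> \<le> int n" using gens_n_abs[OF s True] .
  show ?thesis
  proof (cases "\<bar>y (s i)\<bar> \<le> int n")
    case T: True
    then show ?thesis using True si gens_n_abs[OF s T] by (simp add: cl_def o_apply)
  next
    case F: False
    have "sgn (y (s i)) = 1 \<or> sgn (y (s i)) = -1" using F by (auto simp: sgn_if)
    then have "s (sgn (y (s i)) * (int n + 1)) = sgn (y (s i)) * (int n + 1)"
      by (intro gens_n_fix[OF s]) auto
    then show ?thesis using True si F gens_n_fix[OF s, of "y (s i)"] by (simp add: cl_def o_apply)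
  qed
qed

lemma cl_conj_j:
  assumes j: "int n < j"
  shows "cl (sgen j \<circ> y \<circ> sgen j) = cl y"
proof
  fix i
  let ?s = "sgen j"
  show "cl (?s \<circ> y \<circ> ?s) i = cl y i"
  proof (cases "\<bar>i\<bar> \<le> int n")
    case True
    have si: "?s i = i" using j True by (auto simp: sgen_def)
    show ?thesis
    proof (cases "\<bar>y i\<bar> \<le> int n")
      case T: True
      then have "?s (y i) = y i" using j by (auto simp: sgen_def)
      then show ?thesis using si by (simp add: cl_def o_apply)
    next
      case F: False
      have "\<bar>?s (y i)\<bar> > int n" "sgn (?s (y i)) = sgn (y i)" using j F by (auto simp: sgen_def sgn_if)
      then show ?thesis using si F by (simp add: cl_def o_apply)
    qed
  qed (simp add: cl_def)
qed

lemma cl_top: "\<bar>i\<bar> \<le> int n \<Longrightarrow> cl y i = int n + 1 \<longleftrightarrow> y i > int n"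
  by (auto simp: cl_def sgn_if)

lemma cl_bot: "\<bar>i\<bar> \<le> int n \<Longrightarrow> cl y i = - (int n + 1) \<longleftrightarrow> y i < - int n"
  by (auto simp: cl_def sgn_if)

lemma cl_mid: "\<bar>i\<bar> \<le> int n \<Longrightarrow> \<bar>v\<bar> \<le> int n \<Longrightarrow> cl y i = v \<longleftrightarrow> y i = v"
  by (auto simp: cl_def sgn_if)

text \<open>\<open>cl\<close> sees the order of two values unless both lie beyond n on the same
  side. That exceptional case is the one isolated by \<open>cp\<close> below.\<close>

lemma cl_less:
  "\<bar>i\<bar> \<le> int n \<Longrightarrow> \<bar>j\<bar> \<le> int n \<Longrightarrow> \<not> (y i > int n \<and> y j > int n) \<Longrightarrow> \<not> (y i < - int n \<and> y j < - int n)
    \<Longrightarrow> y i < y j \<longleftrightarrow> cl y i < cl y j"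
  by (auto simp: cl_def sgn_if)

lemma A_cross:
  assumes y: "y \<in> A k" and i: "\<bar>i\<bar> \<le> int n" "y i > int n"
  shows "y i \<le> int n + int k"
proof (rule ccontr)
  assume h: "\<not> y i \<le> int n + int k"
  have "\<bar>y i\<bar> \<le> 2 * int n" using X_range[OF A_X[OF y], of i] i by simp
  then have "y (y i) > int n + int k" using A_tail_gt[OF y, of "y i"] h by simp
  then show False using FX_zz[OF A_X[OF y], of i] i by simp
qed

lemma inc_less:
  assumes "inc k y" "int n < p" "p < q" "q \<le> int n + int k"
  shows "y p < y q"
  using assms(3,4)
proof (induction q rule: int_gr_induct)
  case base then show ?case using assms by (simp add: inc_def)
next
  case (step q)
  then have "y p < y q" by simp
  also have "y q < y (q + 1)" using assms step by (simp add: inc_def)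
  finally show ?case .
qed

text \<open>\<open>cl\<close> determines which elements of the range up to n are partners of n + 1,
  ..., n + k, and \<open>inc\<close> leaves only one way to list them.\<close>

lemma cl_inject:
  assumes y: "y \<in> A k" "inc k y" and z: "z \<in> A k" "inc k z" and c: "cl y = cl z"
  shows "y = z"
proof -
  let ?I = "{int n + 1..int n + int k}"
  have img: "w ` ?I = {i. \<bar>i\<bar> \<le> int n \<and> cl w i = int n + 1}" if w: "w \<in> A k" for w
  proof (intro equalityI subsetI)
    fix i assume "i \<in> w ` ?I"
    then obtain p where p: "p \<in> ?I" "i = w p" by blast
    then have "\<bar>i\<bar> \<le> int n" "w i = p" using A_low[OF w, of p] FX_zz[OF A_X[OF w]] by auto
    then show "i \<in> {i. \<bar>i\<bar> \<le> int n \<and> cl w i = int n + 1}" using cl_top[of i w] p by simp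
  next
    fix i assume i: "i \<in> {i. \<bar>i\<bar> \<le> int n \<and> cl w i = int n + 1}"
    then have "w i > int n" using cl_top[of i w] by auto
    then have "w i \<in> ?I" using A_cross[OF w, of i] i by auto
    then show "i \<in> w ` ?I" using FX_zz[OF A_X[OF w], of i] by (metis imageI)
  qed
  have srt: "sorted_wrt (<) (map w [int n + 1..int n + int k])" if w: "inc k w" for w
    unfolding sorted_wrt_map
    by (rule sorted_wrt_mono_rel[OF _ sorted_wrt_upto]) (use inc_less[OF w] in auto)
  have "map y [int n + 1..int n + int k] = map z [int n + 1..int n + int k]"
    by (rule strict_sorted_equal[OF srt[OF z(2)] srt[OF y(2)]]) (simp add: img[OF y(1)] img[OF z(1)] c)
  then have low: "y p = z p" if "int n < p" "p \<le> int n + int k" for p using that by simp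
  note yX = A_X[OF y(1)] and zX = A_X[OF z(1)]
  have pos: "y p = z p" if "int n < p" for p
  proof -
    consider "p \<le> int n + int k" | "int n + int k < p" "p \<le> 2 * int n" | "2 * int n < p" by linarith
    then show ?thesis
      using low[of p] A_tail[OF y(1), of p] A_tail[OF z(1), of p] X_out[OF yX, of p] X_out[OF zX, of p] that
      by cases auto
  qed
  have top: "y i = z i" if i: "\<bar>i\<bar> \<le> int n" "y i > int n" for i
  proof -
    have "z (y i) = i" using pos[OF i(2)] FX_zz[OF yX, of i] by simp
    then show ?thesis using FX_zz[OF zX, of "y i"] by simp
  qed
  have mid: "y i = z i" if i: "\<bar>i\<bar> \<le> int n" for i
  proof -
    consider "\<bar>y i\<bar> \<le> int n" | "y i > int n" | "y i < - int n" by linarith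
    then show ?thesis
    proof cases
      case 1 then show ?thesis using cl_mid[OF i 1, of y] cl_mid[OF i 1, of z] c by simp
    next
      case 2 then show ?thesis using top[OF i] by simp
    next
      case 3
      then have "y (- i) = z (- i)" using top[of "- i"] i FX_odd[OF yX N2, of i] by simp
      then show ?thesis using FX_odd[OF yX N2, of i] FX_odd[OF zX N2, of i] by simp
    qed
  qed
  show ?thesis
  proof
    fix i
    consider "\<bar>i\<bar> \<le> int n" | "i > int n" | "- i > int n" by linarith
    then show "y i = z i"
    proof cases
      case 1 then show ?thesis by (rule mid)
    next
      case 2 then show ?thesis by (rule pos)
    next
      case 3 from pos[OF this] show ?thesis using FX_odd[OF yX N2, of i] FX_odd[OF zX N2, of i] by simp
    qed
  qed
qed

lemma root_j: "int n < j \<Longrightarrow> sroot (sgen j) j (j + 1)"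
  using sroot_ra[of j] by (simp add: ra_def rb_def)

lemma A_j_noncommuting:
  assumes y: "y \<in> A k" and j: "int n < j" "j < int n + int k"
  shows "sgen j \<circ> y \<noteq> y \<circ> sgen j"
proof -
  have "\<bar>y j\<bar> \<le> int n" using A_low[OF y] j by simp
  then show ?thesis
    using commutes_iff[OF A_X[OF y] N2 sgen_j_gens[OF j A_kn[OF y]] root_j[OF j(1)]] j by auto
qed

text \<open>Bubble sort of the values at n + 1, ..., n + k. Each swap of adjacent positions out of
  order is a downward conjugation, so it costs exactly 2 in length and preserves \<open>cl\<close>;
  \<open>d\<close> counts the swaps.\<close>

lemma A_sort:
  assumes "y \<in> A k"
  shows "\<exists>z d. z \<in> A k \<and> inc k z \<and> cl z = cl y \<and> ln y = ln z + 2 * d"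
  using assms
proof (induction "ln y" arbitrary: y rule: less_induct)
  case less
  show ?case
  proof (cases "inc k y")
    case True then show ?thesis using less.prems by (intro exI[of _ y] exI[of _ 0]) simp
  next
    case False
    then obtain j where j: "int n < j" "j < int n + int k" "\<not> y j < y (j + 1)" by (auto simp: inc_def)
    let ?s = "sgen j" and ?y = "sgen j \<circ> y \<circ> sgen j"
    have s: "?s \<in> gens t N" using sgen_j_gens[OF j(1,2) A_kn[OF less.prems]] .
    have d: "desc y ?s" using not_desc_iff[OF FX_oddbij[OF A_X[OF less.prems] N2] root_j[OF j(1)]] j(3) by blast
    have l: "ln y = ln ?y + 2" using conj_nodesc(2)[OF A_X[OF less.prems] N2 s A_j_noncommuting[OF less.prems j(1,2)] d] .
    obtain z d where "z \<in> A k" "inc k z" "cl z = cl ?y" "ln ?y = ln z + 2 * d"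
      using less.hyps[OF _ conj_A_j[OF less.prems j(1,2)]] l by auto
    then show ?thesis using l cl_conj_j[OF j(1)] by (intro exI[of _ z] exI[of _ "Suc d"]) simp
  qed
qed

section \<open>The module and its bar operator\<close>

abbreviation "TS \<equiv> Hs_mod mt t n"
abbreviation "TF \<equiv> TB t N (deq mt)"

text \<open>On sorted elements this is \<open>AscEq\<close>. Unlike the latter it does not ask the
  two partners to be adjacent, and so depends only on \<open>cl\<close> and makes sense on all of
  \<open>A k\<close>.\<close>

definition cp :: "perm \<Rightarrow> perm \<Rightarrow> bool" where
  "cp z s \<longleftrightarrow> (\<exists>a b. sroot s a b \<and> z a > int n \<and> z b > int n)"

lemma cp_iff:
  assumes z: "z \<in> X" and r: "sroot s a b"
  shows "cp z s \<longleftrightarrow> (z a > int n \<and> z b > int n) \<or> (z a < - int n \<and> z b < - int n)"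
proof
  assume "cp z s"
  then obtain c d where cd: "sroot s c d" "z c > int n" "z d > int n" by (auto simp: cp_def)
  from sroot_unique[OF r cd(1)] show "(z a > int n \<and> z b > int n) \<or> (z a < - int n \<and> z b < - int n)"
    using cd FX_odd[OF z N2] by auto
next
  assume "(z a > int n \<and> z b > int n) \<or> (z a < - int n \<and> z b < - int n)"
  then show "cp z s"
  proof
    assume "z a > int n \<and> z b > int n"
    then show ?thesis using r unfolding cp_def by blast
  next
    assume "z a < - int n \<and> z b < - int n"
    then have "z (- b) > int n \<and> z (- a) > int n" using FX_odd[OF z N2] by simp
    then show ?thesis using sroot_neg[OF r] unfolding cp_def by blast
  qed
qed

lemma cp_noncommuting:
  assumes y: "y \<in> X" and s: "s \<in> gens t n" and c: "cp y s"
  shows "s \<circ> y \<noteq> y \<circ> s"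
proof -
  obtain a b where r: "sroot s a b" "y a > int n" using c by (auto simp: cp_def)
  show ?thesis using commutes_iff[OF y N2 gens_n_N[OF s] r(1)] gens_n_root[OF s r(1)] r(2) by auto
qed

text \<open>An index strictly between the two partners would itself have a partner strictly between
  \<open>a\<close> and \<open>b\<close>. It would be fixed by \<open>s\<close>, and the pair with
  \<open>a\<close> would be reversed by \<open>s\<close> without being its simple root.\<close>

lemma cp_sorted:
  assumes z: "z \<in> A k" "inc k z" and s: "s \<in> gens t n" and r: "sroot s a b" and ab: "z a > int n" "z b > int n"
  shows "z b = z a + 1" "z a + 1 \<le> int n + int k"
proof -
  note zX = A_X[OF z(1)]
  have ran: "\<bar>a\<bar> \<le> int n" "\<bar>b\<bar> \<le> int n" using gens_n_root[OF s r] by auto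
  have le: "z a \<le> int n + int k" "z b \<le> int n + int k" using A_cross[OF z(1)] ran ab by auto
  have lt: "z a < z b"
  proof (rule ccontr)
    assume "\<not> z a < z b"
    moreover have "z a \<noteq> z b" using oddbij_inj[OF FX_oddbij[OF zX N2], of a b] sroot_less[OF r] by simp
    ultimately have "z (z b) < z (z a)" using inc_less[OF z(2) ab(2), of "z a"] le by simp
    then show False using FX_zz[OF zX] sroot_less[OF r] by simp
  qed
  show "z b = z a + 1"
  proof (rule ccontr)
    assume "z b \<noteq> z a + 1"
    then have q: "z a + 1 < z b" using lt by simp
    let ?c = "z (z a + 1)"
    have c: "a < ?c" "?c < b"
      using inc_less[OF z(2), of "z a" "z a + 1"] inc_less[OF z(2), of "z a + 1" "z b"] ab q le FX_zz[OF zX] by auto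
    have zc: "z ?c = z a + 1" using FX_zz[OF zX] by simp
    have "?c \<noteq> - a" "?c \<noteq> - b" using zc ab FX_odd[OF zX N2, of a] FX_odd[OF zX N2, of b] by auto
    then have sc: "s ?c = ?c" using c by (intro sroot_fix[OF r]) linarith+
    have "?c \<noteq> 0" using zc oddbij_0[OF FX_oddbij[OF zX N2]] ab by auto
    then have "s a < s ?c"
      using c sroot_nz[OF r] \<open>?c \<noteq> - a\<close> by (intro gens_mono_pair[OF s r]) auto
    then show False using sc sroot_app[OF r] c by simp
  qed
  then show "z a + 1 \<le> int n + int k" using le by simp
qed

text \<open>\<open>z s z\<close> is the reflection at the image of the root of \<open>s\<close>. For
  it to be a generator beyond n, the two partners must lie beyond n on one side;
  \<open>cp_sorted\<close> supplies the adjacency in the converse.\<close>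

lemma AscEq_iff:
  assumes z: "z \<in> A k" "inc k z" and s: "s \<in> gens t n"
  shows "s \<in> AscEq t n z \<longleftrightarrow> cp z s"
proof -
  note zX = A_X[OF z(1)]
  obtain a b where r: "sroot s a b" using gens_sroot[OF s] by blast
  have zsz: "z \<circ> s \<circ> z = rfl (z c) (z d)" if "sroot s c d" for c d
    using oddbij_rfl[OF FX_oddbij[OF zX N2], of c d] sroot_rfl[OF that] FX_zz[OF zX] by (simp add: fun_eq_iff o_apply)
  show ?thesis
  proof
    assume "s \<in> AscEq t n z"
    then obtain j where j: "j > int n" "rfl (z a) (z b) = sgen j" using zsz[OF r] by (auto simp: AscEq_def)
    have "sgen j (z a) = z b" using fun_cong[OF j(2), of "z a"] by (simp add: rfl_def)
    moreover have "z a \<noteq> z b" using oddbij_inj[OF FX_oddbij[OF zX N2], of a b] sroot_less[OF r] by simp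
    ultimately have "(z a > int n \<and> z b > int n) \<or> (z a < - int n \<and> z b < - int n)"
      using j(1) by (auto simp: sgen_def split: if_splits)
    then show "cp z s" using cp_iff[OF zX r] by simp
  next
    assume "cp z s"
    then obtain c d where cd: "sroot s c d" "z c > int n" "z d > int n" by (auto simp: cp_def)
    have "rfl (z c) (z d) = sgen (z c)"
      using cp_sorted(1)[OF z s cd] cd(2) by (simp add: sgen_rfl ra_def rb_def)
    then show "s \<in> AscEq t n z" using zsz[OF cd(1)] cd(2) s by (auto simp: AscEq_def)
  qed
qed

lemma cp_not_desc:
  assumes z: "z \<in> A k" "inc k z" and s: "s \<in> gens t n" and c: "cp z s"
  shows "\<not> desc z s"
proof -
  obtain a b where r: "sroot s a b" "z a > int n" "z b > int n" using c by (auto simp: cp_def)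
  show ?thesis
    using cp_sorted(1)[OF z s r] not_desc_iff[OF FX_oddbij[OF A_X[OF z(1)] N2] r(1)] by simp
qed

lemma glen_desc:
  assumes z: "z \<in> X" and s: "s \<in> gens t n"
  shows "glen t n (s \<circ> z) < glen t n z \<longleftrightarrow> desc z s" "glen t n (s \<circ> z) > glen t n z \<longleftrightarrow> \<not> desc z s"
proof -
  note d = left_desc[OF FX_Wgrp[OF z] N2 gens_n_N[OF s], unfolded FX_inv[OF z]]
  have "desc z s \<Longrightarrow> ln (s \<circ> z) < ln z" "\<not> desc z s \<Longrightarrow> ln z < ln (s \<circ> z)" using d by linarith+
  then show "glen t n (s \<circ> z) < glen t n z \<longleftrightarrow> desc z s" "glen t n (s \<circ> z) > glen t n z \<longleftrightarrow> \<not> desc z s"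
    unfolding glen_def by (metis less_asym)+
qed

lemma DesLt_iff:
  assumes z: "z \<in> A k" "inc k z"
  shows "s \<in> DesLt t n z \<longleftrightarrow> s \<in> gens t n \<and> desc z s \<and> s \<circ> z \<noteq> z \<circ> s"
proof (cases "s \<in> gens t n")
  case True
  then show ?thesis
    using AscEq_iff[OF z True] cp_not_desc[OF z True] glen_desc(1)[OF A_X[OF z(1)] True]
    by (auto simp: DesLt_def DesEq_def)
qed (simp add: DesLt_def)

lemma AscLt_iff:
  assumes z: "z \<in> A k" "inc k z"
  shows "s \<in> AscLt t n z \<longleftrightarrow> s \<in> gens t n \<and> \<not> desc z s \<and> s \<circ> z \<noteq> z \<circ> s \<and> \<not> cp z s"
proof (cases "s \<in> gens t n")
  case True
  then show ?thesis
    using AscEq_iff[OF z True] glen_desc(2)[OF A_X[OF z(1)] True]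
    by (auto simp: AscLt_def DesEq_def)
qed (simp add: AscLt_def)

lemma HsMz_eq:
  assumes z: "z \<in> A k" "inc k z" and s: "s \<in> gens t n"
  shows "HsMz mt t n s z = (if cp z s then msmult \<epsilon> (delta z) else Tb t N (deq mt) s z)"
proof -
  note c = cp_noncommuting[OF A_X[OF z(1)] s] cp_not_desc[OF z s]
  have de: "s \<in> DesEq t n z \<longleftrightarrow> s \<circ> z = z \<circ> s" using s by (simp add: DesEq_def)
  show ?thesis
    unfolding HsMz_def Tb_def AscLt_iff[OF z] DesLt_iff[OF z] AscEq_iff[OF z s] de
    using c s by (intro ext) (auto simp: vec_apply aeq_def deq_def)
qed

text \<open>\<open>s\<close> can reverse two consecutive partners only if they form its root, and
  that is the case \<open>cp\<close>.\<close>

lemma conj_inc: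
  assumes z: "z \<in> A k" "inc k z" and s: "s \<in> gens t n" and c: "\<not> cp z s"
  shows "inc k (s \<circ> z \<circ> s)"
  unfolding inc_def
proof (intro allI impI)
  fix p assume p: "int n < p \<and> p < int n + int k"
  note zX = A_X[OF z(1)]
  obtain a b where r: "sroot s a b" using gens_sroot[OF s] by blast
  have lt: "z p < z (p + 1)" using z(2) p by (simp add: inc_def)
  have nc: "\<not> (z a > int n \<and> z b > int n)" "\<not> (z (- b) > int n \<and> z (- a) > int n)"
    using c r sroot_neg[OF r] unfolding cp_def by blast+
  have "s (z p) < s (z (p + 1))"
  proof (rule gen_mono_image[OF zX N2 gens_n_N[OF s] r lt])
    show "(z p, z (p + 1)) \<noteq> (a, b)" using nc(1) FX_zz[OF zX, of p] FX_zz[OF zX, of "p + 1"] p by auto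
    show "(z p, z (p + 1)) \<noteq> (- b, - a)" using nc(2) FX_zz[OF zX, of p] FX_zz[OF zX, of "p + 1"] p by auto
  qed (use p in auto)
  then show "(s \<circ> z \<circ> s) p < (s \<circ> z \<circ> s) (p + 1)" using gens_n_fix[OF s] p by (simp add: o_apply)
qed

section \<open>The small module as an equivariant image of the conjugation module\<close>

lemma finite_G: "finite (Gset t n)"
  using finite_subset[OF _ finite_FX[OF N2, of t]] G_X by blast

lemma TS_lext: "TS s = lext id (Gset t n) (HsMz mt t n s)"
  by (intro ext) (simp add: Hs_mod_def lext_def vec_apply id_apply)

lemma Tb_V_small:
  assumes z: "z \<in> A k" "inc k z" and s: "s \<in> gens t n" and c: "\<not> cp z s"
  shows "Tb t N (deq mt) s z \<in> V {z \<in> A k. inc k z}"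
  unfolding Tb_def using z conj_A[OF z(1) s] conj_inc[OF z s c] by (auto intro!: V_add V_msmult V_delta)

lemma HsMz_V:
  assumes z: "z \<in> Gset t n" and s: "s \<in> gens t n"
  shows "HsMz mt t n s z \<in> V (Gset t n)"
proof -
  obtain k where k: "z \<in> A k" "inc k z" using G_struct[OF z] by blast
  have "{z \<in> A k. inc k z} \<subseteq> Gset t n" using A_inc_G by blast
  then show ?thesis
    unfolding HsMz_eq[OF k s] using Tb_V_small[OF k s] V_mono z by (auto intro!: V_msmult V_delta)
qed

lemma TS_lin: "s \<in> gens t n \<Longrightarrow> lin (Gset t n) (Gset t n) (TS s)"
  unfolding TS_lext by (intro slin_lext[OF ring_map_id] HsMz_V)

lemma TS_delta: "z \<in> Gset t n \<Longrightarrow> TS s (delta z) = HsMz mt t n s z"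
  unfolding TS_lext using lext_delta[OF ring_map_id finite_G] by blast

text \<open>Each swap among n + 1, ..., n + k is to act by the scalar \<open>\<epsilon>\<close>, so
  \<open>y\<close> becomes \<open>\<epsilon>\<close> to the number of swaps times its sorted
  representative; that number is half the difference of lengths. \<open>cl_inject\<close> makes the
  choice unique.\<close>

definition Qb :: "nat \<Rightarrow> perm \<Rightarrow> vec" where
  "Qb k y = (if y \<in> A k then
      (let z = (SOME z. z \<in> A k \<and> inc k z \<and> cl z = cl y) in msmult (\<epsilon> ^ ((ln y - ln z) div 2)) (delta z)) else 0)"

definition Q :: "nat \<Rightarrow> vec \<Rightarrow> vec" where "Q k = lext id X (Qb k)"

lemma Qb_eq:
  assumes y: "y \<in> A k" and z: "z \<in> A k" "inc k z" "cl z = cl y" "ln y = ln z + 2 * d"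
  shows "Qb k y = msmult (\<epsilon> ^ d) (delta z)"
proof -
  have "(SOME z. z \<in> A k \<and> inc k z \<and> cl z = cl y) = z"
    using z cl_inject by (intro some_equality) auto
  then show ?thesis using y z(4) by (simp add: Qb_def Let_def)
qed

lemma Qb_out: "y \<notin> A k \<Longrightarrow> Qb k y = 0" by (simp add: Qb_def)

lemma Qb_small: "z \<in> A k \<Longrightarrow> inc k z \<Longrightarrow> Qb k z = delta z"
  using Qb_eq[of z k z 0] by simp

lemma Qb_V: "Qb k y \<in> V (Gset t n)"
proof (cases "y \<in> A k")
  case True
  then obtain z d where z: "z \<in> A k" "inc k z" "cl z = cl y" "ln y = ln z + 2 * d" using A_sort by blast
  then show ?thesis using Qb_eq[OF True z] A_inc_G[OF z(1,2)] by (auto intro!: V_msmult V_delta)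
qed (simp add: Qb_out)

lemma Q_lin: "lin X (Gset t n) (Q k)"
  unfolding Q_def by (rule slin_lext[OF ring_map_id Qb_V])

lemma Q_delta: "y \<in> X \<Longrightarrow> Q k (delta y) = Qb k y"
  unfolding Q_def using lext_delta[OF ring_map_id finite_FX[OF N2]] by blast

lemma Q_add: "a \<in> V X \<Longrightarrow> b \<in> V X \<Longrightarrow> Q k (a + b) = Q k a + Q k b"
  using slin_add[OF Q_lin] by blast

lemma Q_msmult: "a \<in> V X \<Longrightarrow> Q k (msmult p a) = msmult p (Q k a)"
  using slin_msmult[OF Q_lin] by (simp add: id_apply)

lemma eps_root: "\<epsilon> * \<epsilon> = 1 + lq * \<epsilon>" "\<epsilon> - lq = lbar \<epsilon>"
proof -
  have a: "\<epsilon> * \<epsilon> = 1 + lq * \<epsilon>" "lbar \<epsilon> * \<epsilon> = 1" using hecke_root_aeq[of mt] by (auto simp: hecke_root_def)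
  show "\<epsilon> * \<epsilon> = 1 + lq * \<epsilon>" using a by simp
  have "(\<epsilon> - lq) * \<epsilon> = 1" using a by (simp add: algebra_simps)
  then have "(\<epsilon> - lq) * \<epsilon> * lbar \<epsilon> = lbar \<epsilon>" by simp
  then show "\<epsilon> - lq = lbar \<epsilon>" using a(2) by (simp only: mult.assoc mult.commute[of \<epsilon>] mult_1_right)
qed

text \<open>Serves both the swaps \<open>sgen j\<close> and the generators of rank n with
  \<open>cp\<close>. Conjugation stays in the class and changes the number of swaps by one; in the
  downward case the quadratic equation for \<open>\<epsilon>\<close> absorbs the extra term.\<close>

lemma Q_eps:
  assumes y: "y \<in> A k" and s: "s \<in> gens t N" and nc: "s \<circ> y \<noteq> y \<circ> s"
    and sy: "s \<circ> y \<circ> s \<in> A k" and c: "cl (s \<circ> y \<circ> s) = cl y"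
  shows "Q k (TF s (delta y)) = msmult \<epsilon> (Qb k y)"
proof -
  let ?y = "s \<circ> y \<circ> s"
  note yX = A_X[OF y] and sX = A_X[OF sy]
  obtain z d where z: "z \<in> A k" "inc k z" "cl z = cl y" "ln y = ln z + 2 * d" using A_sort[OF y] by blast
  obtain z' d' where z': "z' \<in> A k" "inc k z'" "cl z' = cl ?y" "ln ?y = ln z' + 2 * d'" using A_sort[OF sy] by blast
  have zz: "z' = z" using cl_inject[OF z'(1,2) z(1,2)] z'(3) z(3) c by simp
  have qy: "Qb k y = msmult (\<epsilon> ^ d) (delta z)" using Qb_eq[OF y z] .
  have qs: "Qb k ?y = msmult (\<epsilon> ^ d') (delta z)" using Qb_eq[OF sy z'] zz by simp
  show ?thesis
  proof (cases "desc y s")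
    case False
    have "d' = Suc d" using conj_desc(2)[OF yX N2 s nc False] z(4) z'(4) zz by simp
    then show ?thesis using TB_up[OF yX N2 nc False] Q_delta[OF sX] qy qs by simp
  next
    case True
    have d: "d = Suc d'" using conj_nodesc(2)[OF yX N2 s nc True] z(4) z'(4) zz by simp
    have "Q k (TF s (delta y)) = Qb k ?y + msmult lq (Qb k y)"
      using TB_down[OF yX N2 nc True] Q_add[OF V_delta[OF sX] V_msmult[OF V_delta[OF yX]]]
        Q_msmult[OF V_delta[OF yX]] Q_delta[OF sX] Q_delta[OF yX] by simp
    also have "\<dots> = msmult (\<epsilon> ^ d' * (1 + lq * \<epsilon>)) (delta z)"
      unfolding qy qs d by (simp add: fun_eq_iff vec_apply algebra_simps)
    also have "\<dots> = msmult \<epsilon> (Qb k y)" unfolding eps_root(1)[symmetric] qy d by (simp add: algebra_simps)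
    finally show ?thesis .
  qed
qed

lemma not_A_conj: "s \<in> gens t n \<Longrightarrow> y \<notin> A k \<Longrightarrow> s \<circ> y \<circ> s \<notin> A k"
  using conj_A[of "s \<circ> y \<circ> s" k s] conj_conj[of s t n y] by metis

lemma Q_zero:
  assumes y: "y \<in> X" "y \<notin> A k" and s: "s \<in> gens t N" and sy: "s \<circ> y \<circ> s \<notin> A k"
  shows "Q k (TF s (delta y)) = 0"
proof -
  have sX: "s \<circ> y \<circ> s \<in> X" using F.conj_X[OF y(1) s] .
  note d = V_delta[OF y(1)] V_delta[OF sX]
  have z: "Q k (delta y) = 0" "Q k (delta (s \<circ> y \<circ> s)) = 0"
    using Q_delta[OF y(1)] Q_delta[OF sX] Qb_out y(2) sy by auto
  show ?thesis unfolding TB_delta[OF y(1) N2] Tb_def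
    using z Q_add[OF d(2) V_msmult[OF d(1)]] Q_msmult[OF d(1)] by simp
qed

text \<open>Which case of the action applies depends on \<open>cp\<close>, on commutation and on
  descent. The first two are visible in \<open>cl\<close>, and so is the third when
  \<open>cp\<close> fails; hence \<open>y\<close> and its sorted representative \<open>z\<close>
  behave alike.\<close>

lemma Q_TF_delta:
  assumes s: "s \<in> gens t n" and y: "y \<in> X"
  shows "Q k (TF s (delta y)) = TS s (Qb k y)"
proof (cases "y \<in> A k")
  case False
  then show ?thesis
    using Q_zero[OF y False gens_n_N[OF s] not_A_conj[OF s False]] Qb_out[OF False] slin_zero[OF TS_lin[OF s]] by simp
next
  case yA: True
  let ?y = "s \<circ> y \<circ> s"
  note sN = gens_n_N[OF s]
  obtain z d where z: "z \<in> A k" "inc k z" "cl z = cl y" "ln y = ln z + 2 * d" using A_sort[OF yA] by blast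
  note zX = A_X[OF z(1)] and zG = A_inc_G[OF z(1,2)]
  have qy: "Qb k y = msmult (\<epsilon> ^ d) (delta z)" using Qb_eq[OF yA z] .
  have TSq: "TS s (Qb k y) = msmult (\<epsilon> ^ d) (HsMz mt t n s z)"
    using slin_msmult[OF TS_lin[OF s] V_delta[OF zG]] TS_delta[OF zG] by (simp add: qy id_apply)
  obtain a b where r: "sroot s a b" using gens_sroot[OF s] by blast
  have ran: "\<bar>a\<bar> \<le> int n" "\<bar>b\<bar> \<le> int n" using gens_n_root[OF s r] by auto
  have cl': "cl z i = cl y i" for i using z(3) by simp
  have cpyz: "cp y s \<longleftrightarrow> cp z s"
    unfolding cp_iff[OF y r] cp_iff[OF zX r]
    using cl_top[OF ran(1)] cl_top[OF ran(2)] cl_bot[OF ran(1)] cl_bot[OF ran(2)] cl' by metis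
  have com: "s \<circ> y = y \<circ> s \<longleftrightarrow> s \<circ> z = z \<circ> s"
  proof -
    have "\<bar>- b\<bar> \<le> int n" using ran by simp
    then show ?thesis
      unfolding commutes_iff[OF y N2 sN r] commutes_iff[OF zX N2 sN r]
      using cl_mid[OF ran(1) ran(2)] cl_mid[OF ran(1), of "- b"] cl' by metis
  qed
  have syA: "?y \<in> A k" using conj_A[OF yA s] .
  consider "cp y s" | "\<not> cp y s" "s \<circ> y = y \<circ> s" | "\<not> cp y s" "s \<circ> y \<noteq> y \<circ> s" by blast
  then show ?thesis
  proof cases
    case 1
    obtain a b where r: "sroot s a b" and ab: "y a > int n" "y b > int n" using 1 by (auto simp: cp_def)
    have ran: "\<bar>a\<bar> \<le> int n" "\<bar>b\<bar> \<le> int n" using gens_n_root[OF s r] by auto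
    \<comment> \<open>The coordinates exchanged by \<open>s\<close> carry the same label. No other
      label is moved, because coordinates of \<open>s\<close> are matched beyond n and so are no
      values inside.\<close>
    have "cl ?y i = cl y i" for i
    proof -
      have ct: "cl y a = int n + 1" "cl y b = int n + 1" "cl y (- a) = - (int n + 1)" "cl y (- b) = - (int n + 1)"
        using cl_top[of a y] cl_top[of b y] cl_bot[of "- a" y] cl_bot[of "- b" y] ran ab FX_odd[OF y N2] by auto
      have fx: "s (int n + 1) = int n + 1" "s (- (int n + 1)) = - (int n + 1)" using gens_n_fix[OF s] by auto
      note so = sroot_odd[OF r] and ap = sroot_app[OF r]
      consider "i = a" | "i = b" | "i = - a" | "i = - b" | "\<bar>i\<bar> \<noteq> \<bar>a\<bar>" "\<bar>i\<bar> \<noteq> \<bar>b\<bar>" by linarith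
      then show ?thesis
      proof cases
        case 5
        have si: "s i = i" using sroot_fix[OF r 5] .
        have "s (cl y i) = cl y i"
        proof (cases "\<bar>i\<bar> \<le> int n \<and> \<bar>y i\<bar> \<le> int n")
          case True
          have h: "\<bar>y i\<bar> \<noteq> \<bar>c\<bar>" if "\<bar>y c\<bar> > int n" for c
          proof
            assume "\<bar>y i\<bar> = \<bar>c\<bar>"
            then have "y i = c \<or> y i = - c" by linarith
            then have "\<bar>y c\<bar> = \<bar>i\<bar>" using FX_zz[OF y, of i] FX_odd[OF y N2, of c] by auto
            then show False using that True by simp
          qed
          have "s (y i) = y i" using h[of a] h[of b] ab by (intro sroot_fix[OF r]) auto
          then show ?thesis using True by (simp add: cl_def)
        next
          case False
          then have "cl y i = 0 \<or> cl y i = int n + 1 \<or> cl y i = - (int n + 1)" by (auto simp: cl_def sgn_if)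
          then show ?thesis using fx s by (auto simp: gens_inds)
        qed
        then show ?thesis using cl_conj[OF s, of y i] si by simp
      qed (use cl_conj[OF s, of y i] ct fx so ap in simp_all)
    qed
    then have c: "cl ?y = cl y" by blast
    have "Q k (TF s (delta y)) = msmult \<epsilon> (Qb k y)"
      using Q_eps[OF yA sN cp_noncommuting[OF y s 1] syA c] .
    then show ?thesis using TSq qy HsMz_eq[OF z(1,2) s] 1 cpyz by (simp add: mult.commute)
  next
    case 2
    have "Q k (TF s (delta y)) = msmult (deq mt) (Qb k y)"
      using F.T_eq[OF y 2(2)] Q_msmult[OF V_delta[OF y]] Q_delta[OF y] by simp
    then show ?thesis using TSq qy HsMz_eq[OF z(1,2) s] 2 cpyz com by (simp add: mult.commute Tb_def)
  next
    case 3
    let ?z = "s \<circ> z \<circ> s"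
    have nz: "\<not> cp z s" "s \<circ> z \<noteq> z \<circ> s" using 3 cpyz com by auto
    have z': "?z \<in> A k" "inc k ?z" using conj_A[OF z(1) s] conj_inc[OF z(1,2) s nz(1)] by auto
    have clz: "cl ?z = cl ?y" using cl_conj[OF s, of z] cl_conj[OF s, of y] z(3) by auto
    have ds: "desc y s \<longleftrightarrow> desc z s"
    proof -
      have "y a < y b \<longleftrightarrow> z a < z b"
        using cl_less[OF ran, of y] cl_less[OF ran, of z] 3(1) nz(1) cl' cp_iff[OF y r] cp_iff[OF zX r] by simp
      then show ?thesis
        using not_desc_iff[OF FX_oddbij[OF y N2] r] not_desc_iff[OF FX_oddbij[OF zX N2] r] by blast
    qed
    note sX = A_X[OF syA]
    show ?thesis
    proof (cases "desc y s")
      case False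
      have l: "ln ?y = ln ?z + 2 * d"
        using conj_desc(2)[OF y N2 sN 3(2) False] conj_desc(2)[OF zX N2 sN nz(2)] False ds z(4) by simp
      have "Qb k ?y = msmult (\<epsilon> ^ d) (delta ?z)" using Qb_eq[OF syA z' clz l] .
      then show ?thesis
        using TB_up[OF y N2 3(2) False] Q_delta[OF sX] TSq HsMz_eq[OF z(1,2) s] nz ds False by (simp add: Tb_def)
    next
      case True
      have l: "ln ?y = ln ?z + 2 * d"
        using conj_nodesc(2)[OF y N2 sN 3(2) True] conj_nodesc(2)[OF zX N2 sN nz(2)] True ds z(4) by simp
      have q: "Qb k ?y = msmult (\<epsilon> ^ d) (delta ?z)" using Qb_eq[OF syA z' clz l] .
      have "Q k (TF s (delta y)) = Qb k ?y + msmult lq (Qb k y)"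
        using TB_down[OF y N2 3(2) True] Q_add[OF V_delta[OF sX] V_msmult[OF V_delta[OF y]]]
          Q_msmult[OF V_delta[OF y]] Q_delta[OF sX] Q_delta[OF y] by simp
      also have "\<dots> = msmult (\<epsilon> ^ d) (delta ?z + msmult lq (delta z))"
        unfolding q qy by (simp add: msmult_add_right mult.commute)
      finally show ?thesis using TSq HsMz_eq[OF z(1,2) s] nz ds True by (simp add: Tb_def)
    qed
  qed
qed

lemma Q_TF:
  assumes s: "s \<in> gens t n" and m: "m \<in> V X"
  shows "Q k (TF s m) = TS s (Q k m)"
proof (rule slin_eqI[OF finite_FX[OF N2] _ _ _ m, where \<sigma> = id and F = "\<lambda>m. Q k (TF s m)" and G = "\<lambda>m. TS s (Q k m)"])
  show "lin X (Gset t n) (\<lambda>m. Q k (TF s m))"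
    using slin_comp[OF F.B.linT[OF gens_n_N[OF s]] Q_lin] by simp
  show "lin X (Gset t n) (\<lambda>m. TS s (Q k m))" using slin_comp[OF Q_lin TS_lin[OF s]] by simp
qed (use Q_TF_delta[OF s] Q_delta in simp)

lemma Q_TF_j:
  assumes j: "int n < j" "j < int n + int k" "k \<le> n" and m: "m \<in> V X"
  shows "Q k (TF (sgen j) m) = msmult \<epsilon> (Q k m)"
proof (rule slin_eqI[OF finite_FX[OF N2] _ _ _ m, where \<sigma> = id and F = "\<lambda>m. Q k (TF (sgen j) m)" and G = "\<lambda>m. msmult \<epsilon> (Q k m)"])
  note s = sgen_j_gens[OF j]
  show "lin X (Gset t n) (\<lambda>m. Q k (TF (sgen j) m))"
    using slin_comp[OF F.B.linT[OF s] Q_lin] by simp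
  have "lin (Gset t n) (Gset t n) (msmult \<epsilon>)"
    by (auto simp: slin_def id_apply msmult_add_right mult.commute intro: V_msmult)
  from slin_comp[OF Q_lin this] show "lin X (Gset t n) (\<lambda>m. msmult \<epsilon> (Q k m))" by simp
  fix y assume y: "y \<in> X"
  show "Q k (TF (sgen j) (delta y)) = msmult \<epsilon> (Q k (delta y))"
  proof (cases "y \<in> A k")
    case True
    then show ?thesis
      using Q_eps[OF True s A_j_noncommuting[OF True j(1,2)] conj_A_j[OF True j(1,2)] cl_conj_j[OF j(1)]] Q_delta[OF y] by simp
  next
    case False
    have "sgen j \<circ> y \<circ> sgen j \<notin> A k"
      using conj_A_j[of "sgen j \<circ> y \<circ> sgen j" k j] conj_conj[OF s, of y] j False by auto
    then show ?thesis using Q_zero[OF y False s] Q_delta[OF y] Qb_out[OF False] by simp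
  qed
qed

lemma Q_opw: "set ws \<subseteq> gens t n \<Longrightarrow> m \<in> V X \<Longrightarrow> Q k (opw TF ws m) = opw TS ws (Q k m)"
proof (induction ws)
  case (Cons s ws)
  have "set ws \<subseteq> gens t N" using Cons.prems gens_n_N by auto
  then have "opw TF ws m \<in> V X" using F.B.opw_T_V Cons.prems by blast
  then show ?case using Cons Q_TF[of s "opw TF ws m" k] by simp
qed simp

text \<open>Each basis vector is the image under some \<open>Q k\<close> of the same vector of the
  conjugation module, so quadratic and braid relations are carried over by equivariance.\<close>

lemma hecke_rep_small: "hecke_rep t n (Gset t n) TS"
proof -
  have d: "\<exists>k. z \<in> X \<and> Q k (delta z) = delta z" if z: "z \<in> Gset t n" for z
  proof -
    obtain k where k: "z \<in> A k" "inc k z" using G_struct[OF z] by blast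
    then show ?thesis using Q_delta[OF A_X[OF k(1)]] Qb_small[OF k] A_X[OF k(1)] by auto
  qed
  interpret pre: hecke_pre t n "Gset t n" TS
  proof
    show "n \<ge> 2" "finite (Gset t n)" using n2 finite_G by auto
    fix s assume s: "s \<in> gens t n"
    show lin: "lin (Gset t n) (Gset t n) (TS s)" using TS_lin[OF s] .
    fix m assume m: "m \<in> V (Gset t n)"
    have l2: "lin (Gset t n) (Gset t n) (\<lambda>m. TS s (TS s m))" using slin_comp[OF lin lin] by simp
    have l3: "lin (Gset t n) (Gset t n) (\<lambda>m. m + msmult lq (TS s m))"
      unfolding slin_def using lin
      by (auto simp: slin_add[OF lin] slin_msmult[OF lin] slin_V[OF lin] id_apply fun_eq_iff vec_apply
          algebra_simps intro!: V_add V_msmult)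
    show "TS s (TS s m) = m + msmult lq (TS s m)"
    proof (rule slin_eqI[OF finite_G l2 l3 _ m])
      fix z assume "z \<in> Gset t n"
      then obtain k where k: "z \<in> X" "Q k (delta z) = delta z" using d by blast
      note dz = V_delta[OF k(1)] and sN = gens_n_N[OF s]
      note tz = F.B.T_V[OF sN dz]
      have "TS s (TS s (delta z)) = Q k (TF s (TF s (delta z)))"
        using Q_TF[OF s dz, of k] Q_TF[OF s tz, of k] k by simp
      also have "\<dots> = Q k (delta z) + msmult lq (Q k (TF s (delta z)))"
        using F.B.quad[OF sN dz] Q_add[OF dz V_msmult[OF tz]] Q_msmult[OF tz] by simp
      also have "\<dots> = delta z + msmult lq (TS s (delta z))" using Q_TF[OF s dz, of k] k by simp
      finally show "TS s (TS s (delta z)) = delta z + msmult lq (TS s (delta z))" .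
    qed
  qed
  show ?thesis
  proof
    fix s s' m assume s: "s \<in> gens t n" "s' \<in> gens t n" "s \<noteq> s'" and m: "m \<in> V (Gset t n)"
    show "opw TS (bw s s') m = opw TS (bw s' s) m"
    proof (rule pre.braid_at_all[OF s(1,2) _ m])
      fix z assume "z \<in> Gset t n"
      then obtain k where k: "z \<in> X" "Q k (delta z) = delta z" using d by blast
      note dz = V_delta[OF k(1)]
      have "set (bw s s') \<subseteq> gens t n" "set (bw s' s) \<subseteq> gens t n" using s by (auto simp: bw_set)
      then show "pre.braid_at s s' (delta z)"
        unfolding pre.braid_at_def
        using Q_opw[OF _ dz, of "bw s s'" k] Q_opw[OF _ dz, of "bw s' s" k]
          F.B.braid[OF gens_n_N[OF s(1)] gens_n_N[OF s(2)] s(3) dz] k(2) by simp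
    qed
  qed
qed

end

sublocale small \<subseteq> S: hecke_rep t n "Gset t n" TS
  by (rule hecke_rep_small)

section \<open>The bar operator on the small module\<close>

context small
begin

lemma Q_Tinv:
  assumes s: "s \<in> gens t n" and m: "m \<in> V X"
  shows "Q k (F.B.Tinv s m) = S.Tinv s (Q k m)"
  unfolding F.B.Tinv_def S.Tinv_def
  using slin_diff[OF Q_lin F.B.T_V[OF gens_n_N[OF s] m] V_msmult[OF m]] Q_TF[OF s m] Q_msmult[OF m] by simp

lemma Q_Tinv_j:
  assumes j: "int n < j" "j < int n + int k" "k \<le> n" and m: "m \<in> V X"
  shows "Q k (F.B.Tinv (sgen j) m) = msmult (lbar \<epsilon>) (Q k m)"
proof -
  have "Q k (F.B.Tinv (sgen j) m) = msmult \<epsilon> (Q k m) - msmult lq (Q k m)"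
    unfolding F.B.Tinv_def
    using slin_diff[OF Q_lin F.B.T_V[OF sgen_j_gens[OF j] m] V_msmult[OF m]] Q_TF_j[OF j m] Q_msmult[OF m] by simp
  then show ?thesis unfolding eps_root(2)[symmetric] by (simp add: fun_eq_iff vec_apply left_diff_distrib)
qed

definition kk :: "perm \<Rightarrow> nat" where "kk z = (THE k. z \<in> A k)"

lemma kk_eq: "z \<in> A k \<Longrightarrow> kk z = k"
  unfolding kk_def by (rule the_equality) (auto intro: A_unique_k)

text \<open>For each basis vector the projection for its own \<open>k\<close> is used; it discards
  whatever part of \<open>F.barB (delta z)\<close> lies outside \<open>A k\<close>.\<close>

definition barS :: "vec \<Rightarrow> vec" where
  "barS = lext lbar (Gset t n) (\<lambda>z. Q (kk z) (F.barB (delta z)))"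

lemma barB_V: "z \<in> X \<Longrightarrow> F.barB (delta z) \<in> V X"
  using slin_V[OF F.barB_slin V_delta] by blast

lemma barS_slin: "slin lbar (Gset t n) (Gset t n) barS"
  unfolding barS_def using slin_V[OF Q_lin barB_V[OF G_X]] by (intro slin_lext[OF ring_map_lbar])

lemma barS_delta:
  assumes "z \<in> A k" "inc k z"
  shows "barS (delta z) = Q k (F.barB (delta z))"
  unfolding barS_def lext_delta[OF ring_map_lbar finite_G A_inc_G[OF assms]] kk_eq[OF assms(1)] ..

lemma barS_orbit:
  assumes m: "m \<in> V {z \<in> A k. inc k z}"
  shows "barS m = Q k (F.barB m)"
proof -
  let ?Y = "{z \<in> A k. inc k z}"
  have YG: "?Y \<subseteq> Gset t n" "?Y \<subseteq> X" using A_inc_G A_X by auto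
  show ?thesis
  proof (rule slin_eqI[OF finite_subset[OF YG(1) finite_G] _ _ _ m, where \<sigma> = lbar and G = "\<lambda>m. Q k (F.barB m)"])
    show "slin lbar ?Y (Gset t n) barS" using slin_subset[OF barS_slin YG(1) order_refl] .
    show "slin lbar ?Y (Gset t n) (\<lambda>m. Q k (F.barB m))"
      using slin_subset[OF slin_comp[OF F.barB_slin Q_lin] YG(2) order_refl] by (simp add: o_def id_def)
  qed (use barS_delta in simp)
qed

text \<open>If \<open>cp\<close> fails, the two actions agree on \<open>z\<close> and
  \<open>Q\<close> transports the claim. If \<open>cp\<close> holds with partners j and j + 1,
  conjugating by \<open>s\<close> or by \<open>sgen j\<close> gives the same longer element, so
  their inverses agree on the bar image, and the second becomes a scalar under
  \<open>Q\<close>.\<close>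

lemma barS_TS_delta:
  assumes z: "z \<in> Gset t n" and s: "s \<in> gens t n"
  shows "barS (TS s (delta z)) = S.Tinv s (barS (delta z))"
proof -
  obtain k where k: "z \<in> A k" "inc k z" using G_struct[OF z] by blast
  note zX = A_X[OF k(1)] and sN = gens_n_N[OF s]
  note dz = V_delta[OF zX] and bV = barB_V[OF zX]
  show ?thesis
  proof (cases "cp z s")
    case True
    then obtain a b where r: "sroot s a b" "z a > int n" "z b > int n" by (auto simp: cp_def)
    let ?j = "z a"
    have j: "z b = ?j + 1" "int n < ?j" "?j < int n + int k" using cp_sorted[OF k s r] r by auto
    let ?u = "sgen ?j"
    have u: "?u \<in> gens t N" using sgen_j_gens[OF j(2,3) A_kn[OF k(1)]] .
    have uz: "?u \<circ> z = z \<circ> s"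
      using oddbij_rfl[OF FX_oddbij[OF zX N2], of a b] sroot_rfl[OF r(1)] sroot_rfl[OF root_j[OF j(2)]] j(1) by simp
    have e: "?u (z i) = z (s i)" for i using fun_cong[OF uz, of i] by (simp add: o_apply)
    have e': "s (z i) = z (?u i)" for i using e[of "z i"] FX_zz[OF zX] by metis
    have su: "s (?u i) = ?u (s i)" for i
    proof (cases "\<bar>i\<bar> \<le> int n")
      case True
      then have "?u i = i" "?u (s i) = s i" using gens_n_abs[OF s True] j(2) by (auto simp: sgen_def)
      then show ?thesis by simp
    next
      case False
      then have "\<bar>?u i\<bar> > int n" using j(2) by (auto simp: sgen_def)
      then show ?thesis using gens_n_fix[OF s] False by simp
    qed
    have same: "s \<circ> z \<circ> s = ?u \<circ> z \<circ> ?u" using e e' su by (simp add: fun_eq_iff o_apply)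
    have up1: "TF s (delta z) = delta (s \<circ> z \<circ> s)"
      using TB_up[OF zX N2 cp_noncommuting[OF zX s True] cp_not_desc[OF k s True]] .
    have "\<not> desc z ?u"
      using not_desc_iff[OF FX_oddbij[OF zX N2] root_j[OF j(2)]] k(2) j by (auto simp: inc_def)
    then have up2: "TF ?u (delta z) = delta (?u \<circ> z \<circ> ?u)"
      using TB_up[OF zX N2 A_j_noncommuting[OF k(1) j(2,3)]] by blast
    have "F.B.Tinv s (F.barB (delta z)) = F.B.Tinv ?u (F.barB (delta z))"
      using F.barB_T[OF sN dz] F.barB_T[OF u dz] up1 up2 same by simp
    then have "S.Tinv s (barS (delta z)) = msmult (lbar \<epsilon>) (barS (delta z))"
      using Q_Tinv[OF s bV, of k] Q_Tinv_j[OF j(2,3) A_kn[OF k(1)] bV] barS_delta[OF k] by simp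
    moreover have "barS (TS s (delta z)) = msmult (lbar \<epsilon>) (barS (delta z))"
      using TS_delta[OF z] HsMz_eq[OF k s] True slin_msmult[OF barS_slin V_delta[OF z]] by simp
    ultimately show ?thesis by simp
  next
    case False
    have e: "TS s (delta z) = TF s (delta z)"
      using TS_delta[OF z] HsMz_eq[OF k s] False TB_delta[OF zX N2] by simp
    have "TS s (delta z) \<in> V {z \<in> A k. inc k z}"
      using TS_delta[OF z] HsMz_eq[OF k s] False Tb_V_small[OF k s False] by simp
    from barS_orbit[OF this] have "barS (TS s (delta z)) = Q k (F.barB (TF s (delta z)))" using e by simp
    also have "\<dots> = S.Tinv s (Q k (F.barB (delta z)))" using F.barB_T[OF sN dz] Q_Tinv[OF s bV] by simp
    finally show ?thesis using barS_delta[OF k] by simp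
  qed
qed

lemma barS_TS:
  assumes s: "s \<in> gens t n" and m: "m \<in> V (Gset t n)"
  shows "barS (TS s m) = S.Tinv s (barS m)"
proof (rule slin_eqI[OF finite_G _ _ _ m, where \<sigma> = lbar and F = "\<lambda>m. barS (TS s m)" and G = "\<lambda>m. S.Tinv s (barS m)"])
  show "slin lbar (Gset t n) (Gset t n) (\<lambda>m. barS (TS s m))"
    using slin_comp[OF TS_lin[OF s] barS_slin] by (simp add: o_def id_def)
  show "slin lbar (Gset t n) (Gset t n) (\<lambda>m. S.Tinv s (barS m))"
    using slin_comp[OF barS_slin S.Tinv_lin[OF s]] by (simp add: o_def id_def)
qed (use barS_TS_delta[OF _ s] in simp)

lemma Q_height:
  assumes r: "r \<in> V {u\<in>X. ln u < L}"
  shows "Q k r \<in> V {z\<in>A k. inc k z \<and> ln z < L}"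
proof -
  have rX: "r \<in> V X" using r by (auto simp: V_def)
  have "Q k r = (\<Sum>u\<in>X. msmult (r u) (Qb k u))"
    using slin_expand[OF finite_FX[OF N2] Q_lin rX] Q_delta by (simp add: id_apply)
  also have "\<dots> \<in> V {z\<in>A k. inc k z \<and> ln z < L}"
  proof (rule V_sum)
    fix u assume u: "u \<in> X"
    show "msmult (r u) (Qb k u) \<in> V {z\<in>A k. inc k z \<and> ln z < L}"
    proof (cases "ln u < L \<and> u \<in> A k")
      case True
      then obtain z d where z: "z \<in> A k" "inc k z" "cl z = cl u" "ln u = ln z + 2 * d" using A_sort by blast
      then show ?thesis using Qb_eq[of u k z d] True by (auto intro!: V_msmult V_delta)
    next
      case False
      then have "r u = 0 \<or> Qb k u = 0" using r Qb_out by (auto simp: V_def)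
      then show ?thesis by auto
    qed
  qed
  finally show ?thesis .
qed

lemma barS_triangular:
  assumes z: "z \<in> A k" "inc k z"
  shows "barS (delta z) - delta z \<in> V {y\<in>A k. inc k y \<and> ln y < ln z}"
proof -
  note zX = A_X[OF z(1)]
  note tr = F.barB_triangular[OF _ zX]
  have "barS (delta z) - delta z = Q k (F.barB (delta z) - delta z)"
    using slin_diff[OF Q_lin barB_V[OF zX] V_delta[OF zX]] barS_delta[OF z] Q_delta[OF zX] Qb_small[OF z] by simp
  then show ?thesis using Q_height[OF tr] by simp
qed

text \<open>\<open>lmin_structure\<close> leaves only the length \<open>j\<close> of the paired
  segment open. The remaining n - j indices are matched bijectively with n + 1, ..., n + k, so j = n
  - k, and the class depends on \<open>k\<close> alone.\<close>

lemma lmin_cl: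
  assumes z: "z \<in> A k" and lm: "lmin t n z" and i: "1 \<le> i" "i \<le> int n"
  shows "cl z i = (if i \<le> int n - int k then (if odd i then i + 1 else i - 1) else int n + 1)"
proof -
  note zX = A_X[OF z]
  have nn: "n \<le> N" by simp
  have noneg: "\<not> z p < - p" if "int n < p" "p \<le> int N" for p
  proof (cases "p \<le> int n + int k")
    case True then show ?thesis using A_low[OF z that(1) True] that by simp
  next
    case False then show ?thesis using A_tail_gt[OF z, of p] that by simp
  qed
  obtain j where je: "even j" and j: "0 \<le> j" "j \<le> int n" "\<forall>i. 1 \<le> i \<and> i \<le> j \<longrightarrow> z i = (if odd i then i + 1 else i - 1)"
      "\<forall>i. j < i \<and> i \<le> int n \<longrightarrow> z i > int n"
    using lmin_structure[OF zX N2 n2 nn lm noneg] by blast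
  have pos: "z i > 0" if "1 \<le> i" "i \<le> int n" for i using lmin_pos[OF zX N2 n2 nn lm _ that] noneg by blast
  have small: "z i \<le> int n" if "1 \<le> i" "i \<le> j" for i
  proof -
    have "z i = (if odd i then i + 1 else i - 1)" using j(3) that by blast
    moreover have "odd i \<Longrightarrow> i \<noteq> j" using je by auto
    ultimately show ?thesis using that j(2) by auto
  qed
  have "bij_betw z {j + 1..int n} {int n + 1..int n + int k}"
  proof (rule bij_betw_byWitness[where f' = z])
    show "\<forall>a\<in>{j + 1..int n}. z (z a) = a" "\<forall>a\<in>{int n + 1..int n + int k}. z (z a) = a" using FX_zz[OF zX] by auto
    show "z ` {j + 1..int n} \<subseteq> {int n + 1..int n + int k}"
    proof
      fix q assume "q \<in> z ` {j + 1..int n}"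
      then obtain p where "p \<in> {j + 1..int n}" "q = z p" by blast
      then have p: "j < p" "p \<le> int n" "q = z p" by auto
      then have "z p > int n" using j(4) by blast
      then show "q \<in> {int n + 1..int n + int k}" using A_cross[OF z, of p] p j(1) by simp
    qed
    show "z ` {int n + 1..int n + int k} \<subseteq> {j + 1..int n}"
    proof
      fix q assume "q \<in> z ` {int n + 1..int n + int k}"
      then obtain p where "p \<in> {int n + 1..int n + int k}" "q = z p" by blast
      then have p: "int n < p" "p \<le> int n + int k" "q = z p" by auto
      have q: "\<bar>q\<bar> \<le> int n" "z q = p" using A_low[OF z p(1,2)] p FX_zz[OF zX] by auto
      have "q \<noteq> 0" using q p oddbij_0[OF FX_oddbij[OF zX N2]] by auto
      moreover have "\<not> q < 0"
      proof
        assume "q < 0"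
        then have "z (- q) > 0" using pos[of "- q"] q by simp
        then show False using FX_odd[OF zX N2, of q] q p by simp
      qed
      moreover have "\<not> q \<le> j" using small[of q] q p calculation by auto
      ultimately show "q \<in> {j + 1..int n}" using q by auto
    qed
  qed
  then have "card {j + 1..int n} = card {int n + 1..int n + int k}" by (rule bij_betw_same_card)
  then have jk: "j = int n - int k" using j by simp
  show ?thesis
  proof (cases "i \<le> j")
    case True
    then have "z i = (if odd i then i + 1 else i - 1)" using j(3) i by blast
    moreover have "\<bar>z i\<bar> \<le> int n" using small[OF i(1) True] pos[OF i] by simp
    ultimately show ?thesis using True jk i by (simp add: cl_def)
  next
    case False
    then have "z i > int n" using j(4) i by simp
    then show ?thesis using False jk cl_top[of i z] i by simp
  qed
qed

lemma lmin_unique: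
  assumes y: "y \<in> A k" "inc k y" "lmin t n y" and z: "z \<in> A k" "inc k z" "lmin t n z"
  shows "y = z"
proof (rule cl_inject[OF y(1,2) z(1,2)])
  have pos: "cl y i = cl z i" if "1 \<le> i" "i \<le> int n" for i
    using lmin_cl[OF y(1,3) that] lmin_cl[OF z(1,3) that] by simp
  have odd: "cl w (- i) = - cl w i" if "w \<in> A k" for w i
    using FX_odd[OF A_X[OF that] N2, of i] by (simp add: cl_def sgn_minus)
  show "cl y = cl z"
  proof
    fix i
    consider "1 \<le> i" "i \<le> int n" | "1 \<le> - i" "- i \<le> int n" | "i = 0" | "\<bar>i\<bar> > int n" by linarith
    then show "cl y i = cl z i"
    proof cases
      case 1 then show ?thesis by (rule pos)
    next
      case 2 from pos[OF this] show ?thesis using odd[OF y(1), of i] odd[OF z(1), of i] by simp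
    next
      case 3
      then show ?thesis using oddbij_0[OF FX_oddbij[OF A_X[OF y(1)] N2]] oddbij_0[OF FX_oddbij[OF A_X[OF z(1)] N2]]
        by (simp add: cl_def)
    qed (simp add: cl_def)
  qed
qed

text \<open>Sorting and conjugation by descents never lengthen, and they end at a sorted minimal
  element, of which \<open>A k\<close> contains only one.\<close>

lemma lmin_shortest:
  assumes z: "z \<in> A k" "inc k z" "lmin t n z" and u: "u \<in> A k"
  shows "ln z \<le> ln u"
  using u
proof (induction "ln u" arbitrary: u rule: less_induct)
  case less
  obtain y d where y: "y \<in> A k" "inc k y" "cl y = cl u" "ln u = ln y + 2 * d" using A_sort[OF less.prems] by blast
  show ?case
  proof (cases "lmin t n y")
    case True then show ?thesis using lmin_unique[OF y(1,2) True z] y(4) by simp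
  next
    case False
    then obtain s where s: "s \<in> gens t n" "s \<circ> y \<noteq> y \<circ> s" "desc y s" by (auto simp: lmin_def)
    have "ln y = ln (s \<circ> y \<circ> s) + 2" using conj_nodesc(2)[OF A_X[OF y(1)] N2 gens_n_N[OF s(1)] s(2,3)] .
    then show ?thesis using less.hyps[of "s \<circ> y \<circ> s"] conj_A[OF y(1) s(1)] y(4) by simp
  qed
qed

lemma DesLt_empty_lmin:
  assumes "z \<in> A k" "inc k z" "DesLt t n z = {}"
  shows "lmin t n z"
  using assms(3) DesLt_iff[OF assms(1,2)] unfolding lmin_def by auto

text \<open>The error term would be supported on shorter elements of the same \<open>A k\<close>,
  and there are none.\<close>

lemma barS_fixes:
  assumes z: "z \<in> Gset t n" and d: "DesLt t n z = {}"
  shows "barS (delta z) = delta z"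
proof -
  obtain k where k: "z \<in> A k" "inc k z" using G_struct[OF z] by blast
  have e: "{y\<in>A k. inc k y \<and> ln y < ln z} = {}"
    using lmin_shortest[OF k DesLt_empty_lmin[OF k d]] by (auto simp: not_less)
  have "barS (delta z) - delta z \<in> V {}" using barS_triangular[OF k] unfolding e .
  then have "(barS (delta z) - delta z) y = 0" for y by (simp add: V_def)
  then show ?thesis by (simp add: fun_eq_iff vec_apply)
qed

text \<open>The step of the inductions on length: each basis vector with a strict descent is a
  generator applied to a shorter one.\<close>

lemma DesLt_step:
  assumes z: "z \<in> Gset t n" and s: "s \<in> DesLt t n z"
  shows "s \<circ> z \<circ> s \<in> Gset t n" "s \<in> gens t n" "ln (s \<circ> z \<circ> s) < ln z" "TS s (delta (s \<circ> z \<circ> s)) = delta z"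
proof -
  obtain k where k: "z \<in> A k" "inc k z" using G_struct[OF z] by blast
  note zX = A_X[OF k(1)]
  let ?y = "s \<circ> z \<circ> s"
  show sn: "s \<in> gens t n" using s DesLt_iff[OF k] by simp
  have d: "desc z s" "s \<circ> z \<noteq> z \<circ> s" using s DesLt_iff[OF k] by auto
  have c: "\<not> cp z s" using cp_not_desc[OF k sn] d by blast
  have y: "?y \<in> A k" "inc k ?y" using conj_A[OF k(1) sn] conj_inc[OF k sn c] by auto
  note sN = gens_n_N[OF sn]
  show yG: "?y \<in> Gset t n" using A_inc_G[OF y] .
  show "ln ?y < ln z" using conj_nodesc(2)[OF zX N2 sN d(2,1)] by simp
  \<comment> \<open>\<open>s\<close> fixes everything beyond n, so it can neither create nor destroy
    partners there.\<close>
  have cy: "\<not> cp ?y s"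
  proof
    assume "cp ?y s"
    then obtain a b where r: "sroot s a b" "?y a > int n" "?y b > int n" by (auto simp: cp_def)
    have v: "?y a = s (z b)" "?y b = s (z a)" using sroot_app[OF r(1)] by (simp_all add: o_apply)
    have "z i > int n" if "s (z i) > int n" for i
    proof -
      have "s (s (z i)) = s (z i)" using gens_n_fix[OF sn, of "s (z i)"] that by simp
      then show ?thesis using that sn by simp
    qed
    then have "cp z s" using r v unfolding cp_def by metis
    then show False using c by simp
  qed
  have "TS s (delta ?y) = Tb t N (deq mt) s ?y" using TS_delta[OF yG] HsMz_eq[OF y sn] cy by simp
  also have "\<dots> = delta z"
    unfolding Tb_def using conj_nodesc(1)[OF zX N2 sN d(2,1)] conj_commutes_iff[OF sN, of z] conj_conj[OF sN, of z] d by simp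
  finally show "TS s (delta ?y) = delta z" .
qed

section \<open>Compatible bar operators and canonical bases\<close>

sublocale H: hecke_module t n "Gset t n" TS
  by unfold_locales (rule n2)

lemma Hact_act: "Hact mt t n h m = S.act h m"
  by (intro ext) (simp add: Hact_def S.act_def S.Tw_def foldr_opw vec_apply)

text \<open>The bar image of a generator acts by its inverse. Conversely the relation for generators
  extends along reduced words and then semilinearly to the whole algebra.\<close>

lemma compat_bar_iff:
  "compat_bar mt t n \<phi> \<longleftrightarrow> slin lbar (Gset t n) (Gset t n) \<phi>
     \<and> (\<forall>s\<in>gens t n. \<forall>m\<in>V (Gset t n). \<phi> (TS s m) = S.Tinv s (\<phi> m))"
proof -
  have e: "compat_bar mt t n \<phi> \<longleftrightarrow> slin lbar (Gset t n) (Gset t n) \<phi>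
      \<and> (\<forall>h\<in>V (Wgrp t n). \<forall>a\<in>V (Gset t n). \<phi> (S.act h a) = S.act (Hbar t n h) (\<phi> a))"
    unfolding compat_bar_def slin_def Modset_V Hset_V madd_plus Hact_act by blast
  show ?thesis
  proof
    assume c: "compat_bar mt t n \<phi>"
    then have l: "slin lbar (Gset t n) (Gset t n) \<phi>" using e by blast
    have "\<phi> (TS s m) = S.Tinv s (\<phi> m)" if s: "s \<in> gens t n" and m: "m \<in> V (Gset t n)" for s m
    proof -
      have "delta s \<in> V (Wgrp t n)" using gens_Wgrp[OF s n2] by (rule V_delta)
      then have "\<phi> (S.act (delta s) m) = S.act (Hbar t n (delta s)) (\<phi> m)" using c m e by blast
      then show ?thesis using H.act_gen[OF s m] H.act_Hbar_gen[OF s slin_V[OF l m]] by simp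
    qed
    then show "slin lbar (Gset t n) (Gset t n) \<phi> \<and> (\<forall>s\<in>gens t n. \<forall>m\<in>V (Gset t n). \<phi> (TS s m) = S.Tinv s (\<phi> m))"
      using l by blast
  next
    assume "slin lbar (Gset t n) (Gset t n) \<phi> \<and> (\<forall>s\<in>gens t n. \<forall>m\<in>V (Gset t n). \<phi> (TS s m) = S.Tinv s (\<phi> m))"
    then show "compat_bar mt t n \<phi>" using e H.bar_act[of \<phi>] by blast
  qed
qed

lemma bar_exists: "compat_bar mt t n barS \<and> fixes_std t n barS"
  unfolding compat_bar_iff fixes_std_def
  by (intro conjI ballI impI barS_slin barS_TS barS_fixes)

lemma bar_unique:
  assumes "compat_bar mt t n \<phi>" "fixes_std t n \<phi>" "compat_bar mt t n \<psi>" "fixes_std t n \<psi>" and a: "a \<in> V (Gset t n)"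
  shows "\<phi> a = \<psi> a"
proof -
  have l: "slin lbar (Gset t n) (Gset t n) \<phi>" "slin lbar (Gset t n) (Gset t n) \<psi>"
    and T: "\<And>s m. s \<in> gens t n \<Longrightarrow> m \<in> V (Gset t n) \<Longrightarrow> \<phi> (TS s m) = S.Tinv s (\<phi> m)"
      "\<And>s m. s \<in> gens t n \<Longrightarrow> m \<in> V (Gset t n) \<Longrightarrow> \<psi> (TS s m) = S.Tinv s (\<psi> m)"
    using assms(1,3) unfolding compat_bar_iff by auto
  have "\<phi> (delta z) = \<psi> (delta z)" if "z \<in> Gset t n" for z
    using that
  proof (induction "ln z" arbitrary: z rule: less_induct)
    case less
    show ?case
    proof (cases "DesLt t n z = {}")
      case True then show ?thesis using assms(2,4) less.prems by (simp add: fixes_std_def)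
    next
      case False
      then obtain s where s: "s \<in> DesLt t n z" by blast
      note st = DesLt_step[OF less.prems s]
      show ?thesis
        using less.hyps[OF st(3,1)] T(1)[OF st(2) V_delta[OF st(1)]] T(2)[OF st(2) V_delta[OF st(1)]] st(4) by simp
    qed
  qed
  then show ?thesis using slin_eqI[OF finite_G l _ a] by blast
qed

text \<open>The square is linear, commutes with every generator and fixes the elements without
  strict descents, so it agrees with the identity by the induction used for uniqueness.\<close>

lemma bar_involution:
  assumes c: "compat_bar mt t n \<phi>" "fixes_std t n \<phi>" and a: "a \<in> V (Gset t n)"
  shows "\<phi> (\<phi> a) = a"
proof -
  have l: "slin lbar (Gset t n) (Gset t n) \<phi>"
    and T: "\<And>s m. s \<in> gens t n \<Longrightarrow> m \<in> V (Gset t n) \<Longrightarrow> \<phi> (TS s m) = S.Tinv s (\<phi> m)"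
    using c unfolding compat_bar_iff by auto
  have Ti: "\<phi> (S.Tinv s m) = TS s (\<phi> m)" if s: "s \<in> gens t n" and m: "m \<in> V (Gset t n)" for s m
  proof -
    have "\<phi> (TS s (S.Tinv s m)) = S.Tinv s (\<phi> (S.Tinv s m))" using T[OF s] S.Tinv_V[OF s m] by blast
    then have "\<phi> m = S.Tinv s (\<phi> (S.Tinv s m))" using S.T_Tinv[OF s m] by simp
    then show ?thesis using S.T_Tinv[OF s slin_V[OF l S.Tinv_V[OF s m]]] by simp
  qed
  have d: "\<phi> (\<phi> (delta z)) = delta z" if "z \<in> Gset t n" for z
    using that
  proof (induction "ln z" arbitrary: z rule: less_induct)
    case less
    show ?case
    proof (cases "DesLt t n z = {}")
      case True then show ?thesis using c(2) less.prems by (simp add: fixes_std_def)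
    next
      case False
      then obtain s where s: "s \<in> DesLt t n z" by blast
      note st = DesLt_step[OF less.prems s]
      note dy = V_delta[OF st(1)]
      have "\<phi> (\<phi> (TS s (delta (s \<circ> z \<circ> s)))) = TS s (\<phi> (\<phi> (delta (s \<circ> z \<circ> s))))"
        using T[OF st(2) dy] Ti[OF st(2) slin_V[OF l dy]] by simp
      then show ?thesis using less.hyps[OF st(3,1)] st(4) by simp
    qed
  qed
  have l2: "lin (Gset t n) (Gset t n) (\<lambda>m. \<phi> (\<phi> m))" using slin_comp[OF l l] by (simp add: o_def id_def)
  have l1: "lin (Gset t n) (Gset t n) (\<lambda>m. m)" by (simp add: slin_def id_apply)
  show ?thesis using slin_eqI[OF finite_G l2 l1 _ a] d by blast
qed

text \<open>By uniqueness any admissible operator coincides with \<open>barS\<close>, whose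
  triangularity is known.\<close>

lemma bar_triangular:
  assumes c: "compat_bar mt t n \<phi>" "fixes_std t n \<phi>" and z: "z \<in> Gset t n"
  shows "\<phi> (delta z) - delta z \<in> V {y\<in>Gset t n. ln y < ln z}"
proof -
  obtain k where k: "z \<in> A k" "inc k z" using G_struct[OF z] by blast
  have "\<phi> (delta z) = barS (delta z)" using bar_unique[OF c _ _ V_delta[OF z]] bar_exists by blast
  moreover have "V {y\<in>A k. inc k y \<and> ln y < ln z} \<subseteq> V {y\<in>Gset t n. ln y < ln z}"
    using A_inc_G by (intro V_mono) blast
  ultimately show ?thesis using barS_triangular[OF k] by auto
qed

lemma lincomb_eq: "(\<lambda>y. \<Sum>z\<in>Gset t n. c z * C z y) = (\<Sum>z\<in>Gset t n. msmult (c z) (C z))"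
  by (intro ext) (simp add: vec_apply)

lemma canonical_exists:
  assumes c: "compat_bar mt t n \<phi>" "fixes_std t n \<phi>"
  shows "\<exists>C. canon_basis t n \<phi> C"
proof -
  let ?G = "Gset t n"
  have l: "slin lbar ?G ?G \<phi>" using c unfolding compat_bar_iff by auto
  have "\<forall>z\<in>?G. \<exists>C. \<phi> C = C \<and> C - delta z \<in> V {y\<in>?G. ln y < ln z} \<and> (\<forall>y. y \<noteq> z \<longrightarrow> negpart (C y))"
    using canonical_element_exists[OF finite_G l bar_involution[OF c] bar_triangular[OF c]] by blast
  from bchoice[OF this] obtain C where C: "\<forall>z\<in>?G. \<phi> (C z) = C z \<and> C z - delta z \<in> V {y\<in>?G. ln y < ln z}
      \<and> (\<forall>y. y \<noteq> z \<longrightarrow> negpart (C z y))" by blast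
  have tri: "C z - delta z \<in> V {y\<in>?G. ln y < ln z}" if "z \<in> ?G" for z using C that by blast
  have val: "C z y = delta z y" if z: "z \<in> ?G" and y: "\<not> (y \<in> ?G \<and> ln y < ln z)" for z y
  proof -
    have "(C z - delta z) y = 0" using tri[OF z] y by (auto simp: V_def)
    then show ?thesis by (simp add: vec_apply)
  qed
  have CV: "C z \<in> V ?G" if "z \<in> ?G" for z using val[OF that] that by (auto simp: V_def delta_def)
  \<comment> \<open>\<open>triangular_span\<close> works below a height bound; \<open>L\<close>
    exceeds all lengths that occur.\<close>
  define L where "L = Suc (Max (ln ` ?G))"
  have L: "ln z < L" if "z \<in> ?G" for z
    unfolding L_def using that by (intro le_imp_less_Suc Max_ge finite_imageI finite_G imageI)
  have XL: "{y\<in>?G. ln y < L} = ?G" using L by auto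
  have span: "\<exists>c. m = (\<lambda>y. \<Sum>z\<in>?G. c z * C z y)" if "m \<in> V ?G" for m
  proof -
    have "\<exists>c. m = (\<Sum>y\<in>{y\<in>?G. ln y < L}. msmult (c y) (C y))"
      by (rule triangular_span[OF finite_G tri]) (simp_all only: XL that)
    then show ?thesis unfolding XL lincomb_eq .
  qed
  have indep: "c z = c' z" if e: "(\<lambda>y. \<Sum>z\<in>?G. c z * C z y) = (\<lambda>y. \<Sum>z\<in>?G. c' z * C z y)" and z: "z \<in> ?G" for c c' z
  proof -
    have "(\<Sum>z\<in>?G. msmult (c z - c' z) (C z)) = (\<Sum>z\<in>?G. msmult (c z) (C z)) - (\<Sum>z\<in>?G. msmult (c' z) (C z))"
      by (intro ext) (simp add: vec_apply left_diff_distrib sum_subtractf)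
    also have "\<dots> = 0" using e unfolding lincomb_eq by simp
    finally have "c z - c' z = 0"
      using triangular_indep[OF finite_G order_refl tri, where c = "\<lambda>z. c z - c' z" and y = z] z by blast
    then show ?thesis by simp
  qed
  have "is_basis t n C" unfolding is_basis_def Modset_V using CV span indep by blast
  moreover have "C z z = 1" if "z \<in> ?G" for z using val[OF that, of z] by simp
  moreover have "C z y = 0 \<or> (glen t n y < glen t n z \<and> negpart (C z y))" if z: "z \<in> ?G" and y: "y \<in> ?G" "y \<noteq> z" for z y
    using val[OF z, of y] C z y by (cases "ln y < ln z") (auto simp: glen_def delta_other)
  ultimately have "canon_basis t n \<phi> C" unfolding canon_basis_def using C by blast
  then show ?thesis by blast
qed

text \<open>The difference of two canonical elements is invariant, and its entry at \<open>z\<close>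
  cancels, so all its entries have negative exponents.\<close>

lemma canonical_unique:
  assumes c: "compat_bar mt t n \<phi>" "fixes_std t n \<phi>" and C: "canon_basis t n \<phi> C" "canon_basis t n \<phi> C'"
  shows "\<forall>z\<in>Gset t n. C z = C' z"
proof
  fix z assume z: "z \<in> Gset t n"
  let ?G = "Gset t n"
  have l: "slin lbar ?G ?G \<phi>" using c unfolding compat_bar_iff by auto
  have V: "C z \<in> V ?G" "C' z \<in> V ?G"
    using C z unfolding canon_basis_def is_basis_def Modset_V by auto
  have p: "\<phi> (C z) = C z" "\<phi> (C' z) = C' z" "C z z = 1" "C' z z = 1"
    using C z unfolding canon_basis_def by auto
  have neg: "negpart (D z y)" if "canon_basis t n \<phi> D" "D z \<in> V ?G" "y \<noteq> z" for D y
  proof (cases "y \<in> ?G")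
    case True
    then have "D z y = 0 \<or> negpart (D z y)" using that z unfolding canon_basis_def by blast
    then show ?thesis by auto
  next
    case False then show ?thesis using that by (simp add: V_def)
  qed
  have "C z - C' z = 0"
  proof (rule canonical_element_unique[OF finite_G l bar_triangular[OF c]])
    show "C z - C' z \<in> V ?G" using V by blast
    show "\<phi> (C z - C' z) = C z - C' z" using slin_diff[OF l V] p by simp
    show "negpart ((C z - C' z) y)" for y
      using neg[OF C(1) V(1), of y] neg[OF C(2) V(2), of y] p negpart_diff by (cases "y = z") (auto simp: vec_apply)
  qed
  then show "C z = C' z" by simp
qed

end

theorem mainTheorem3:
  fixes t :: ctype and n :: nat and mt :: modtype
  assumes "n \<ge> 2"
  shows "(\<exists>\<phi>. compat_bar mt t n \<phi> \<and> fixes_std t n \<phi>)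
       \<and> (\<forall>\<phi> \<psi>. compat_bar mt t n \<phi> \<and> fixes_std t n \<phi> \<longrightarrow>
                 compat_bar mt t n \<psi> \<and> fixes_std t n \<psi> \<longrightarrow>
                 (\<forall>a\<in>Modset t n. \<phi> a = \<psi> a))
       \<and> (\<forall>\<phi>. compat_bar mt t n \<phi> \<and> fixes_std t n \<phi> \<longrightarrow>
              (\<forall>a\<in>Modset t n. \<phi> (\<phi> a) = a)
            \<and> (\<exists>C. canon_basis t n \<phi> C)
            \<and> (\<forall>C C'. canon_basis t n \<phi> C \<longrightarrow> canon_basis t n \<phi> C' \<longrightarrow>
                        (\<forall>z\<in>Gset t n. C z = C' z)))"
proof -
  interpret small t n mt by unfold_locales (rule assms)
  have exists: "\<exists>\<phi>. compat_bar mt t n \<phi> \<and> fixes_std t n \<phi>"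
    by (rule exI, rule bar_exists)
  have unique: "\<forall>a\<in>Modset t n. \<phi> a = \<psi> a"
    if "compat_bar mt t n \<phi> \<and> fixes_std t n \<phi>" "compat_bar mt t n \<psi> \<and> fixes_std t n \<psi>" for \<phi> \<psi>
    unfolding Modset_V
    by (rule ballI, rule bar_unique[OF conjunct1[OF that(1)] conjunct2[OF that(1)] conjunct1[OF that(2)] conjunct2[OF that(2)]])
  have canonical: "(\<forall>a\<in>Modset t n. \<phi> (\<phi> a) = a) \<and> (\<exists>C. canon_basis t n \<phi> C)
      \<and> (\<forall>C C'. canon_basis t n \<phi> C \<longrightarrow> canon_basis t n \<phi> C' \<longrightarrow> (\<forall>z\<in>Gset t n. C z = C' z))"
    if c: "compat_bar mt t n \<phi> \<and> fixes_std t n \<phi>" for \<phi>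
  proof -
    note c = conjunct1[OF that] conjunct2[OF that]
    have i: "\<forall>a\<in>Modset t n. \<phi> (\<phi> a) = a"
      unfolding Modset_V by (rule ballI, rule bar_involution[OF c])
    have u: "\<forall>C C'. canon_basis t n \<phi> C \<longrightarrow> canon_basis t n \<phi> C' \<longrightarrow> (\<forall>z\<in>Gset t n. C z = C' z)"
      by (rule allI, rule allI, rule impI, rule impI, rule canonical_unique[OF c])
    show ?thesis by (rule conjI[OF i conjI[OF canonical_exists[OF c] u]])
  qed
  show ?thesis
    by (rule conjI[OF exists conjI], rule allI, rule allI, rule impI, rule impI, rule unique, assumption, assumption,
        rule allI, rule impI, rule canonical, assumption)
qed

end
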